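(* Let $R$ be a commutative local ring in which $2$ and $3$ are invertible, and let $G(R)\subset \mathrm{GL}_{14}(R)$ be the Chevalley group of type $G_2$ over $R$ in its adjoint representation. Then the normalizer of $G(R)$ in $\mathrm{GL}_{14}(R)$ is $\{\lambda g\mid \lambda\in R^*,\ g\in G(R)\}$.
   Context: A local ring is an associative commutative ring with unit having exactly one maximal ideal. Let $\Phi$ be the root system of type $G_2$, with simple roots $\alpha_1$ (short), $\alpha_2$ (long). Let $\mathcal L$ be the complex simple Lie algebra of type $G_2$ with a Chevalley basis $\{h_1,h_2\}\cup\{x_\alpha\mid \alpha\in\Phi\}$ ($14$ elements). For a commutative ring $R$ with $1$, the operators $(\mathrm{ad}\,x_\alpha)^k/k!$ have integral matrices in this basis, hence can be viewed in $M_{14}(R)$; write $x_\alpha(t)=\exp(t\,\mathrm{ad}\,x_\alpha)=\sum_{k\ge 0} t^k(\mathrm{ad}\,x_\alpha)^k/k!\in \mathrm{GL}_{14}(R)$ for $\alpha\in\Phi$, $t\in R$. For type $G_2$ the adjoint and universal groups coincide, and over a local ring $R$ the Chevalley group of type $G_2$ coincides with its elementary subgroup; so $G(R)$ denotes the subgroup of $\mathrm{GL}_{14}(R)$ generated by all $x_\alpha(t)$, $\alpha\in\Phi$, $t\in R$. *)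

theory Defs
  imports "HOL-Analysis.Analysis" "HOL-Algebra.Group_Action" "HOL-Algebra.Generated_Groups"
    "HOL-Algebra.Algebraic_Closure_Type"
begin

section \<open>Lie algebras\<close>

locale lie_algebra = vector_space scale
  for scale :: "'f::field \<Rightarrow> 'l::ab_group_add \<Rightarrow> 'l" +
  fixes bracket :: "'l \<Rightarrow> 'l \<Rightarrow> 'l"
  assumes linear_bracket_right: "Vector_Spaces.linear scale scale (\<lambda>v. bracket u v)"
    and linear_bracket_left: "Vector_Spaces.linear scale scale (\<lambda>u. bracket u v)"
    and bracket_self: "bracket u u = 0"
    and jacobi: "bracket u (bracket v w) + bracket v (bracket w u) + bracket w (bracket u v) = 0"
begin

definition lie_ideal :: "'l set \<Rightarrow> bool" where
  "lie_ideal I \<longleftrightarrow> subspace I \<and> (\<forall>u. \<forall>v\<in>I. bracket u v \<in> I)"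

end

locale simple_lie_algebra = lie_algebra scale bracket
  for scale :: "'f::field \<Rightarrow> 'l::ab_group_add \<Rightarrow> 'l" and bracket :: "'l \<Rightarrow> 'l \<Rightarrow> 'l" +
  assumes nonabelian: "\<exists>u v. bracket u v \<noteq> 0"
    and no_proper_ideal: "lie_ideal I \<Longrightarrow> I = {0} \<or> I = UNIV"

section \<open>The root system of type \<open>G\<^sub>2\<close>\<close>

text \<open>
  An element of the root lattice is represented by its coordinates with respect to the simple
  roots, so that the simple root \<open>\<alpha>\<^sub>i\<close> is the unit vector \<^term>\<open>axis i 1\<close>. The invariant inner
  product is normalised by \<open>(\<alpha>\<^sub>1, \<alpha>\<^sub>1) = 2\<close>, \<open>(\<alpha>\<^sub>2, \<alpha>\<^sub>2) = 6\<close>, \<open>(\<alpha>\<^sub>1, \<alpha>\<^sub>2) = -3\<close>;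
  thus \<open>\<alpha>\<^sub>1\<close> is short and \<open>\<alpha>\<^sub>2\<close> is long.
\<close>

definition g2_inner :: "int^2 \<Rightarrow> int^2 \<Rightarrow> int" where
  "g2_inner u v = 2 * u$1 * v$1 - 3 * (u$1 * v$2 + u$2 * v$1) + 6 * u$2 * v$2"

definition g2_pos_roots :: "(int^2) set" where
  "g2_pos_roots =
     {vector [1,0], vector [0,1], vector [1,1], vector [2,1], vector [3,1], vector [3,2]}"

definition g2_roots :: "(int^2) set" where
  "g2_roots = g2_pos_roots \<union> uminus ` g2_pos_roots"

abbreviation simple_root :: "2 \<Rightarrow> int^2" where
  "simple_root i \<equiv> axis i 1"

text \<open>
  The Cartan integer \<open>\<langle>\<beta>, \<alpha>\<rangle> = 2 (\<beta>, \<alpha>) / (\<alpha>, \<alpha>)\<close>; the division is exact for roots \<open>\<alpha>\<close>, \<open>\<beta>\<close>.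
\<close>

definition cartan_int :: "int^2 \<Rightarrow> int^2 \<Rightarrow> int" where
  "cartan_int \<beta> \<alpha> = 2 * g2_inner \<beta> \<alpha> div g2_inner \<alpha> \<alpha>"

text \<open>
  The coefficient of the simple coroot \<open>\<alpha>\<^sub>i\<^sup>\<or> = 2 \<alpha>\<^sub>i / (\<alpha>\<^sub>i, \<alpha>\<^sub>i)\<close> in the coroot
  \<open>\<alpha>\<^sup>\<or> = 2 \<alpha> / (\<alpha>, \<alpha>)\<close>; again the division is exact for roots \<open>\<alpha>\<close>.
\<close>

definition coroot_coeff :: "int^2 \<Rightarrow> 2 \<Rightarrow> int" where
  "coroot_coeff \<alpha> i = \<alpha>$i * g2_inner (simple_root i) (simple_root i) div g2_inner \<alpha> \<alpha>"

text \<open>The greatest \<open>p\<close> such that \<open>\<beta> - p \<alpha>\<close> is a root.\<close>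

definition string_length :: "int^2 \<Rightarrow> int^2 \<Rightarrow> nat" where
  "string_length \<alpha> \<beta> = (GREATEST p. \<beta> - int p *s \<alpha> \<in> g2_roots)"

text \<open>
  The roots as a type of their own. The sum type \<open>2 + g2_root\<close> then indexes the
  \<open>14\<close> elements \<open>h\<^sub>1, h\<^sub>2, x\<^sub>\<alpha>\<close> of a Chevalley basis, and \<open>14 \<times> 14\<close> matrices over \<open>R\<close> are
  indexed by this type.
\<close>

typedef g2_root = g2_roots
  by (auto simp: g2_roots_def g2_pos_roots_def)

lemma finite_g2_roots: "finite g2_roots"
  by (simp add: g2_roots_def g2_pos_roots_def)

lemma card_g2_roots: "card g2_roots = 12"
  by (simp add: g2_roots_def g2_pos_roots_def vec_eq_iff forall_2)

instance g2_root :: finite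
proof
  show "finite (UNIV :: g2_root set)"
    using finite_g2_roots type_definition.Abs_image[OF type_definition_g2_root]
    by (metis finite_imageI)
qed

lemma card_g2_index: "CARD(2 + g2_root) = 14"
  using card_g2_roots type_definition.card[OF type_definition_g2_root] by simp

section \<open>Chevalley bases and Chevalley groups of type \<open>G\<^sub>2\<close>\<close>

definition GL :: "('a::comm_ring_1^'n^'n) monoid" where
  "GL = \<lparr>carrier = {A. invertible A}, monoid.mult = (**), one = mat 1\<rparr>"

text \<open>
  Only the values of \<open>x\<close> at roots are relevant.
\<close>

locale g2_chevalley_basis = simple_lie_algebra scale bracket
  for scale :: "complex \<Rightarrow> 'l::ab_group_add \<Rightarrow> 'l" and bracket :: "'l \<Rightarrow> 'l \<Rightarrow> 'l" +
  fixes h :: "2 \<Rightarrow> 'l" and x :: "int^2 \<Rightarrow> 'l"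
  assumes inj_basis: "inj (case_sum h (\<lambda>r. x (Rep_g2_root r)))"
    and independent_basis: "independent (range (case_sum h (\<lambda>r. x (Rep_g2_root r))))"
    and span_basis: "span (range (case_sum h (\<lambda>r. x (Rep_g2_root r)))) = UNIV"
    and bracket_h_h: "bracket (h i) (h j) = 0"
    and bracket_h_x: "\<alpha> \<in> g2_roots \<Longrightarrow>
      bracket (h i) (x \<alpha>) = scale (of_int (cartan_int \<alpha> (simple_root i))) (x \<alpha>)"
    and bracket_x_uminus: "\<alpha> \<in> g2_roots \<Longrightarrow>
      bracket (x \<alpha>) (x (- \<alpha>)) = (\<Sum>i\<in>UNIV. scale (of_int (coroot_coeff \<alpha> i)) (h i))"
    and bracket_x_x: "\<alpha> \<in> g2_roots \<Longrightarrow> \<beta> \<in> g2_roots \<Longrightarrow> \<alpha> + \<beta> \<in> g2_roots \<Longrightarrow>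
      \<exists>\<epsilon>\<in>{1, - 1}. bracket (x \<alpha>) (x \<beta>) =
        scale (\<epsilon> * of_nat (string_length \<alpha> \<beta> + 1)) (x (\<alpha> + \<beta>))"
    and bracket_x_x_0: "\<alpha> \<in> g2_roots \<Longrightarrow> \<beta> \<in> g2_roots \<Longrightarrow> \<alpha> + \<beta> \<notin> g2_roots \<Longrightarrow>
      \<alpha> + \<beta> \<noteq> 0 \<Longrightarrow> bracket (x \<alpha>) (x \<beta>) = 0"
begin

definition basis :: "2 + g2_root \<Rightarrow> 'l" where
  "basis = case_sum h (\<lambda>r. x (Rep_g2_root r))"

definition ad_power :: "int^2 \<Rightarrow> nat \<Rightarrow> 'l \<Rightarrow> 'l" where
  "ad_power \<alpha> k = bracket (x \<alpha>) ^^ k"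

text \<open>
  The \<open>(i, j)\<close> entry of the matrix of \<open>(ad x\<^sub>\<alpha>)\<^sup>k / k!\<close> with respect to the basis, acting on
  column vectors. It is an integer, which is what makes the definite description meaningful.
\<close>

definition ad_entry :: "int^2 \<Rightarrow> nat \<Rightarrow> 2 + g2_root \<Rightarrow> 2 + g2_root \<Rightarrow> int" where
  "ad_entry \<alpha> k i j = (THE m. of_int m =
     representation (range basis) (scale (1 / fact k) (ad_power \<alpha> k (basis j))) (basis i))"

text \<open>
  The exponential \<open>x\<^sub>\<alpha>(t)\<close>. As \<open>ad x\<^sub>\<alpha>\<close> is nilpotent, the exponential series is the sum over the
  finitely many \<open>k\<close> with \<open>(ad x\<^sub>\<alpha>)\<^sup>k \<noteq> 0\<close>.
\<close>

definition root_elt ::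
    "int^2 \<Rightarrow> 'a::comm_ring_1 \<Rightarrow> 'a^(2 + g2_root)^(2 + g2_root)" where
  "root_elt \<alpha> t = (\<chi> i j. \<Sum>k | ad_power \<alpha> k \<noteq> (\<lambda>v. 0). t ^ k * of_int (ad_entry \<alpha> k i j))"

definition chevalley_group :: "('a::comm_ring_1^(2 + g2_root)^(2 + g2_root)) set" where
  "chevalley_group = generate GL {root_elt \<alpha> t | \<alpha> t. \<alpha> \<in> g2_roots}"

end

section \<open>Local rings\<close>

definition local_ring :: "'a::comm_ring_1 itself \<Rightarrow> bool" where
  "local_ring _ \<longleftrightarrow> (\<exists>!M. maximalideal M (ring_of_type_algebra :: 'a ring))"

end

theory Submission
  imports Defs
begin

text \<open>
  Let \<open>N\<close> normalise \<open>G\<close>. For a long root the exponential is \<open>1 + s X + s\<^sup>2 X\<^sup>2 / 2\<close>, so conjugating it by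
  \<open>N\<close> for \<open>s = \<plusminus>1, \<plusminus>2\<close> gives automorphisms of the Lie algebra \<open>L\<close> over \<open>R\<close> whose linear coefficient
  \<open>N X N\<^sup>-\<^sup>1\<close> must be a derivation, as \<open>6\<close> is invertible. The \<open>u\<close> for which \<open>N (ad u) N\<^sup>-\<^sup>1\<close> is a
  derivation form a \<open>G\<close>-stable submodule, hence all of \<open>L\<close>. Derivations are inner because the Killing form
  is unimodular, so \<open>N\<close> induces an automorphism \<open>\<phi>\<close> of \<open>L\<close>, and \<open>\<phi>\<^sup>-\<^sup>1 N\<close> centralises \<open>ad L\<close>, i.e. is
  a scalar.

  Over a local ring every automorphism \<open>\<phi>\<close> lies in \<open>G\<close>. The image \<open>f\<close> of the highest root vector \<open>e\<^sub>\<theta>\<close>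
  can be moved by \<open>G\<close> so that its \<open>\<theta>\<close>-coordinate is a unit; lowering root elements then clear the
  coordinates next to it, and \<open>[f, [f, y]] \<in> R f\<close> forces \<open>f \<in> R e\<^sub>\<theta>\<close>. The same works for \<open>e\<^bsub>-\<theta>\<^esub>\<close>, then for
  \<open>e\<^bsub>\<plusminus>a\<^esub>\<close> in the copy of \<open>sl\<^sub>2\<close> that centralises \<open>e\<^bsub>\<plusminus>\<theta>\<^esub>\<close>, and what remains is an element of the torus.
\<close>

section \<open>The split Lie algebra of type \<open>G\<^sub>2\<close> over a commutative ring\<close>

text \<open>The ring need not contain the rationals, so each infinitesimal statement is drawn from
  finitely many group elements: the parameters 1, -1, 2, -2 isolate the linear coefficient of a
  polynomial of degree at most 4, up to the factor 12. A long root serves because its third divided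
  power is zero, which keeps the automorphism identity within that degree. The other denominators
  come from the Killing form and the structure constants and have only the prime factors 2 and 3.

  Locality enters as closure of the non-units under addition. It turns the condition of never
  pairing to a unit with f into a submodule condition, so that generation of L by one root vector
  yields the unit coordinate.

  The copy of sl_2 belongs to the short root a, since +-a are the only roots orthogonal to theta =
  3a + 2b. No diagonal automorphism is left over, because the Cartan matrix of G2 has determinant 1.

  A Chevalley basis determines its structure constants only up to signs. All computations therefore
  use one integral table, and the given group is conjugate to that of the table by a diagonal matrix
  of signs.\<close>

datatype g2_index = H1 | H2 | P10 | P01 | P11 | P21 | P31 | P32 | N10 | N01 | N11 | N21 | N31 | N32

primrec weight :: "g2_index \<Rightarrow> int^2" where
  "weight H1 = vector [0, 0]"
| "weight H2 = vector [0, 0]"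
| "weight P10 = vector [1, 0]"
| "weight P01 = vector [0, 1]"
| "weight P11 = vector [1, 1]"
| "weight P21 = vector [2, 1]"
| "weight P31 = vector [3, 1]"
| "weight P32 = vector [3, 2]"
| "weight N10 = vector [-1, 0]"
| "weight N01 = vector [0, -1]"
| "weight N11 = vector [-1, -1]"
| "weight N21 = vector [-2, -1]"
| "weight N31 = vector [-3, -1]"
| "weight N32 = vector [-3, -2]"

text \<open>The matrices of the statement are indexed by \<open>2 + g2_root\<close>. Enumerating
  this index set by fourteen constructors turns identities of vectors into finite case
  checks.\<close>

definition idx :: "g2_index \<Rightarrow> 2 + g2_root" where
  "idx i = (case i of H1 \<Rightarrow> Inl 1 | H2 \<Rightarrow> Inl 2 | _ \<Rightarrow> Inr (Abs_g2_root (weight i)))"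

lemma weight_in_roots: "i \<noteq> H1 \<Longrightarrow> i \<noteq> H2 \<Longrightarrow> weight i \<in> g2_roots"
  by (cases i) (simp_all add: g2_roots_def g2_pos_roots_def vec_eq_iff forall_2)

lemma UNIV_g2_index: "UNIV = {H1, H2, P10, P01, P11, P21, P31, P32, N10, N01, N11, N21, N31, N32}"
  using g2_index.exhaust by auto

instance g2_index :: finite
  by standard (simp add: UNIV_g2_index)

lemma weight_inject: "weight i = weight j \<Longrightarrow> i \<notin> {H1, H2} \<Longrightarrow> j \<notin> {H1, H2} \<Longrightarrow> i = j"
  by (cases i; cases j; simp add: vec_eq_iff forall_2)

lemma Rep_Abs_weight: "i \<notin> {H1, H2} \<Longrightarrow> Rep_g2_root (Abs_g2_root (weight i)) = weight i"
  by (simp add: Abs_g2_root_inverse weight_in_roots)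

lemma idx_root: "i \<notin> {H1, H2} \<Longrightarrow> idx i = Inr (Abs_g2_root (weight i))"
  by (cases i) (simp_all add: idx_def)

lemma inj_idx: "inj idx"
proof (rule injI)
  fix i j assume eq: "idx i = idx j"
  show "i = j"
  proof (cases "i \<in> {H1, H2} \<or> j \<in> {H1, H2}")
    case True
    then show ?thesis using eq
      by (auto simp: idx_def split: g2_index.splits)
  next
    case False
    then have "Abs_g2_root (weight i) = Abs_g2_root (weight j)"
      using eq by (simp add: idx_root)
    then show ?thesis
      using False Rep_Abs_weight weight_inject by metis
  qed
qed

lemma bij_idx: "bij idx"
proof -
  have "card (range idx) = CARD(2 + g2_root)"
    using inj_idx by (simp only: card_g2_index card_image) (simp add: UNIV_g2_index)
  then have "range idx = UNIV"
    by (intro card_subset_eq) auto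
  then show ?thesis
    using inj_idx by (simp add: bij_def)
qed

lemma idx_eq_iff [simp]: "idx i = idx j \<longleftrightarrow> i = j"
  using inj_idx by (simp add: inj_eq)

lemma inv_into_idx [simp]: "inv_into UNIV idx (idx i) = i"
  using inj_idx by simp

lemma all_idx: "(\<forall>k. P k) \<longleftrightarrow> (\<forall>i. P (idx i))"
  by (metis bij_idx bij_is_surj surjD)

lemma sum_idx: "(\<Sum>k\<in>UNIV. f k) = (\<Sum>i\<in>UNIV. f (idx i))"
  using sum.reindex_bij_betw[OF bij_idx, of f] by simp

lemma all_index: "(\<forall>i. P i) \<longleftrightarrow> P H1 \<and> P H2 \<and> P P10 \<and> P P01 \<and> P P11 \<and> P P21 \<and> P P31 \<and> P P32 \<and> P N10 \<and> P N01 \<and> P N11 \<and> P N21 \<and> P N31 \<and> P N32"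
proof -
  have "(\<forall>i. P i) \<longleftrightarrow> (\<forall>i\<in>UNIV. P i)" by simp
  then show ?thesis unfolding UNIV_g2_index by simp
qed

lemma sum_index: "(\<Sum>i\<in>UNIV. f i) = f H1 + f H2 + f P10 + f P01 + f P11 + f P21 + f P31 + f P32 + f N10 + f N01 + f N11 + f N21 + f N31 + f N32"
  for f :: "g2_index \<Rightarrow> 'a::comm_monoid_add"
  by (simp add: UNIV_g2_index add.assoc)

type_synonym 'a g2_vec = "'a^(2 + g2_root)"
type_synonym 'a g2_mat = "'a^(2 + g2_root)^(2 + g2_root)"

abbreviation coord :: "'a g2_vec \<Rightarrow> g2_index \<Rightarrow> 'a" ("_\<langle>_\<rangle>" [1000, 0] 1000) where
  "u\<langle>i\<rangle> \<equiv> u $ idx i"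

abbreviation E :: "g2_index \<Rightarrow> 'a::comm_ring_1 g2_vec" where
  "E i \<equiv> axis (idx i) 1"

lemma vec_eq_idx: "u = v \<longleftrightarrow> (\<forall>i. u\<langle>i\<rangle> = v\<langle>i\<rangle>)"
  by (simp add: vec_eq_iff all_idx)

definition of_coords :: "(g2_index \<Rightarrow> 'a) \<Rightarrow> 'a g2_vec" where
  "of_coords f = (\<chi> k. f (inv_into UNIV idx k))"

lemma of_coords_nth [simp]: "(of_coords f)\<langle>i\<rangle> = f i"
  by (simp add: of_coords_def)

lemma E_nth [simp]: "(E i)\<langle>j\<rangle> = (if j = i then 1 else 0)"
  by (simp add: axis_def)

text \<open>
  The structure constants are normalised, with \<open>a\<close>, \<open>b\<close> the simple roots and \<open>e\<close> the root vectors, by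
  \<open>[e\<^sub>a, e\<^sub>b] = e\<^bsub>a+b\<^esub>\<close>, \<open>[e\<^sub>a, e\<^bsub>a+b\<^esub>] = 2 e\<^bsub>2a+b\<^esub>\<close>, \<open>[e\<^sub>a, e\<^bsub>2a+b\<^esub>] = 3 e\<^bsub>3a+b\<^esub>\<close>,
  \<open>[e\<^sub>b, e\<^bsub>3a+b\<^esub>] = e\<^bsub>3a+2b\<^esub>\<close>, and by the negatives of these constants for the negative roots. The
  constructor \<open>Pmn\<close> (\<open>Nmn\<close>) stands for the root \<open>m a + n b\<close> (\<open>- m a - n b\<close>).
\<close>

primrec bracket_coord :: "g2_index \<Rightarrow> 'a::comm_ring_1 g2_vec \<Rightarrow> 'a g2_vec \<Rightarrow> 'a" where
  "bracket_coord H1 u v = (u\<langle>P10\<rangle> * v\<langle>N10\<rangle> - u\<langle>N10\<rangle> * v\<langle>P10\<rangle>) + (u\<langle>P11\<rangle> * v\<langle>N11\<rangle> - u\<langle>N11\<rangle> * v\<langle>P11\<rangle>) + 2 * (u\<langle>P21\<rangle> * v\<langle>N21\<rangle> - u\<langle>N21\<rangle> * v\<langle>P21\<rangle>) + (u\<langle>P31\<rangle> * v\<langle>N31\<rangle> - u\<langle>N31\<rangle> * v\<langle>P31\<rangle>) + (u\<langle>P32\<rangle> * v\<langle>N32\<rangle> - u\<langle>N32\<rangle> * v\<langle>P32\<rangle>)"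
| "bracket_coord H2 u v = (u\<langle>P01\<rangle> * v\<langle>N01\<rangle> - u\<langle>N01\<rangle> * v\<langle>P01\<rangle>) + 3 * (u\<langle>P11\<rangle> * v\<langle>N11\<rangle> - u\<langle>N11\<rangle> * v\<langle>P11\<rangle>) + 3 * (u\<langle>P21\<rangle> * v\<langle>N21\<rangle> - u\<langle>N21\<rangle> * v\<langle>P21\<rangle>) + (u\<langle>P31\<rangle> * v\<langle>N31\<rangle> - u\<langle>N31\<rangle> * v\<langle>P31\<rangle>) + 2 * (u\<langle>P32\<rangle> * v\<langle>N32\<rangle> - u\<langle>N32\<rangle> * v\<langle>P32\<rangle>)"
| "bracket_coord P10 u v = 2 * (u\<langle>H1\<rangle> * v\<langle>P10\<rangle> - u\<langle>P10\<rangle> * v\<langle>H1\<rangle>) + (u\<langle>P10\<rangle> * v\<langle>H2\<rangle> - u\<langle>H2\<rangle> * v\<langle>P10\<rangle>) + (u\<langle>P11\<rangle> * v\<langle>N01\<rangle> - u\<langle>N01\<rangle> * v\<langle>P11\<rangle>) + 2 * (u\<langle>P21\<rangle> * v\<langle>N11\<rangle> - u\<langle>N11\<rangle> * v\<langle>P21\<rangle>) + (u\<langle>P31\<rangle> * v\<langle>N21\<rangle> - u\<langle>N21\<rangle> * v\<langle>P31\<rangle>)"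
| "bracket_coord P01 u v = 3 * (u\<langle>P01\<rangle> * v\<langle>H1\<rangle> - u\<langle>H1\<rangle> * v\<langle>P01\<rangle>) + 2 * (u\<langle>H2\<rangle> * v\<langle>P01\<rangle> - u\<langle>P01\<rangle> * v\<langle>H2\<rangle>) + 3 * (u\<langle>N10\<rangle> * v\<langle>P11\<rangle> - u\<langle>P11\<rangle> * v\<langle>N10\<rangle>) + (u\<langle>P32\<rangle> * v\<langle>N31\<rangle> - u\<langle>N31\<rangle> * v\<langle>P32\<rangle>)"
| "bracket_coord P11 u v = (u\<langle>P11\<rangle> * v\<langle>H1\<rangle> - u\<langle>H1\<rangle> * v\<langle>P11\<rangle>) + (u\<langle>H2\<rangle> * v\<langle>P11\<rangle> - u\<langle>P11\<rangle> * v\<langle>H2\<rangle>) + (u\<langle>P10\<rangle> * v\<langle>P01\<rangle> - u\<langle>P01\<rangle> * v\<langle>P10\<rangle>) + 2 * (u\<langle>N10\<rangle> * v\<langle>P21\<rangle> - u\<langle>P21\<rangle> * v\<langle>N10\<rangle>) + (u\<langle>N21\<rangle> * v\<langle>P32\<rangle> - u\<langle>P32\<rangle> * v\<langle>N21\<rangle>)"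
| "bracket_coord P21 u v = (u\<langle>H1\<rangle> * v\<langle>P21\<rangle> - u\<langle>P21\<rangle> * v\<langle>H1\<rangle>) + 2 * (u\<langle>P10\<rangle> * v\<langle>P11\<rangle> - u\<langle>P11\<rangle> * v\<langle>P10\<rangle>) + (u\<langle>N10\<rangle> * v\<langle>P31\<rangle> - u\<langle>P31\<rangle> * v\<langle>N10\<rangle>) + (u\<langle>P32\<rangle> * v\<langle>N11\<rangle> - u\<langle>N11\<rangle> * v\<langle>P32\<rangle>)"
| "bracket_coord P31 u v = 3 * (u\<langle>H1\<rangle> * v\<langle>P31\<rangle> - u\<langle>P31\<rangle> * v\<langle>H1\<rangle>) + (u\<langle>P31\<rangle> * v\<langle>H2\<rangle> - u\<langle>H2\<rangle> * v\<langle>P31\<rangle>) + 3 * (u\<langle>P10\<rangle> * v\<langle>P21\<rangle> - u\<langle>P21\<rangle> * v\<langle>P10\<rangle>) + (u\<langle>N01\<rangle> * v\<langle>P32\<rangle> - u\<langle>P32\<rangle> * v\<langle>N01\<rangle>)"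
| "bracket_coord P32 u v = (u\<langle>H2\<rangle> * v\<langle>P32\<rangle> - u\<langle>P32\<rangle> * v\<langle>H2\<rangle>) + (u\<langle>P01\<rangle> * v\<langle>P31\<rangle> - u\<langle>P31\<rangle> * v\<langle>P01\<rangle>) + 3 * (u\<langle>P21\<rangle> * v\<langle>P11\<rangle> - u\<langle>P11\<rangle> * v\<langle>P21\<rangle>)"
| "bracket_coord N10 u v = 2 * (u\<langle>N10\<rangle> * v\<langle>H1\<rangle> - u\<langle>H1\<rangle> * v\<langle>N10\<rangle>) + (u\<langle>H2\<rangle> * v\<langle>N10\<rangle> - u\<langle>N10\<rangle> * v\<langle>H2\<rangle>) + (u\<langle>P01\<rangle> * v\<langle>N11\<rangle> - u\<langle>N11\<rangle> * v\<langle>P01\<rangle>) + 2 * (u\<langle>P11\<rangle> * v\<langle>N21\<rangle> - u\<langle>N21\<rangle> * v\<langle>P11\<rangle>) + (u\<langle>P21\<rangle> * v\<langle>N31\<rangle> - u\<langle>N31\<rangle> * v\<langle>P21\<rangle>)"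
| "bracket_coord N01 u v = 3 * (u\<langle>H1\<rangle> * v\<langle>N01\<rangle> - u\<langle>N01\<rangle> * v\<langle>H1\<rangle>) + 2 * (u\<langle>N01\<rangle> * v\<langle>H2\<rangle> - u\<langle>H2\<rangle> * v\<langle>N01\<rangle>) + 3 * (u\<langle>N11\<rangle> * v\<langle>P10\<rangle> - u\<langle>P10\<rangle> * v\<langle>N11\<rangle>) + (u\<langle>P31\<rangle> * v\<langle>N32\<rangle> - u\<langle>N32\<rangle> * v\<langle>P31\<rangle>)"
| "bracket_coord N11 u v = (u\<langle>H1\<rangle> * v\<langle>N11\<rangle> - u\<langle>N11\<rangle> * v\<langle>H1\<rangle>) + (u\<langle>N11\<rangle> * v\<langle>H2\<rangle> - u\<langle>H2\<rangle> * v\<langle>N11\<rangle>) + 2 * (u\<langle>N21\<rangle> * v\<langle>P10\<rangle> - u\<langle>P10\<rangle> * v\<langle>N21\<rangle>) + (u\<langle>N32\<rangle> * v\<langle>P21\<rangle> - u\<langle>P21\<rangle> * v\<langle>N32\<rangle>) + (u\<langle>N01\<rangle> * v\<langle>N10\<rangle> - u\<langle>N10\<rangle> * v\<langle>N01\<rangle>)"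
| "bracket_coord N21 u v = (u\<langle>N21\<rangle> * v\<langle>H1\<rangle> - u\<langle>H1\<rangle> * v\<langle>N21\<rangle>) + (u\<langle>N31\<rangle> * v\<langle>P10\<rangle> - u\<langle>P10\<rangle> * v\<langle>N31\<rangle>) + (u\<langle>P11\<rangle> * v\<langle>N32\<rangle> - u\<langle>N32\<rangle> * v\<langle>P11\<rangle>) + 2 * (u\<langle>N11\<rangle> * v\<langle>N10\<rangle> - u\<langle>N10\<rangle> * v\<langle>N11\<rangle>)"
| "bracket_coord N31 u v = 3 * (u\<langle>N31\<rangle> * v\<langle>H1\<rangle> - u\<langle>H1\<rangle> * v\<langle>N31\<rangle>) + (u\<langle>H2\<rangle> * v\<langle>N31\<rangle> - u\<langle>N31\<rangle> * v\<langle>H2\<rangle>) + (u\<langle>N32\<rangle> * v\<langle>P01\<rangle> - u\<langle>P01\<rangle> * v\<langle>N32\<rangle>) + 3 * (u\<langle>N21\<rangle> * v\<langle>N10\<rangle> - u\<langle>N10\<rangle> * v\<langle>N21\<rangle>)"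
| "bracket_coord N32 u v = (u\<langle>N32\<rangle> * v\<langle>H2\<rangle> - u\<langle>H2\<rangle> * v\<langle>N32\<rangle>) + (u\<langle>N31\<rangle> * v\<langle>N01\<rangle> - u\<langle>N01\<rangle> * v\<langle>N31\<rangle>) + 3 * (u\<langle>N11\<rangle> * v\<langle>N21\<rangle> - u\<langle>N21\<rangle> * v\<langle>N11\<rangle>)"

definition br :: "'a::comm_ring_1 g2_vec \<Rightarrow> 'a g2_vec \<Rightarrow> 'a g2_vec" where
  "br u v = of_coords (\<lambda>i. bracket_coord i u v)"

lemma br_nth [simp]: "(br u v)\<langle>i\<rangle> = bracket_coord i u v"
  by (simp add: br_def)

text \<open>
  The tables \<open>ad_div2\<close> and \<open>ad_div3\<close> hold \<open>(ad e\<^sub>r)\<^sup>2 / 2\<close> and \<open>(ad e\<^sub>r)\<^sup>3 / 6\<close>; their values at the two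
  Cartan indices are junk.
\<close>

primrec ad_div2 :: "g2_index \<Rightarrow> 'a::comm_ring_1 g2_vec \<Rightarrow> g2_index \<Rightarrow> 'a" where
  "ad_div2 H1 u i = 0"
| "ad_div2 H2 u i = 0"
| "ad_div2 P10 u i = (case i of P10 \<Rightarrow> - u\<langle>N10\<rangle> | P21 \<Rightarrow> u\<langle>P01\<rangle> | P31 \<Rightarrow> 3 * u\<langle>P11\<rangle> | N01 \<Rightarrow> 3 * u\<langle>N21\<rangle> | N11 \<Rightarrow> u\<langle>N31\<rangle> | _ \<Rightarrow> 0)"
| "ad_div2 P01 u i = (case i of P01 \<Rightarrow> - u\<langle>N01\<rangle> | _ \<Rightarrow> 0)"
| "ad_div2 P11 u i = (case i of P01 \<Rightarrow> - 3 * u\<langle>N21\<rangle> | P11 \<Rightarrow> - u\<langle>N11\<rangle> | P21 \<Rightarrow> - u\<langle>N01\<rangle> | P32 \<Rightarrow> 3 * u\<langle>P10\<rangle> | N10 \<Rightarrow> u\<langle>N32\<rangle> | _ \<Rightarrow> 0)"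
| "ad_div2 P21 u i = (case i of P10 \<Rightarrow> - u\<langle>N32\<rangle> | P11 \<Rightarrow> - u\<langle>N31\<rangle> | P21 \<Rightarrow> - u\<langle>N21\<rangle> | P31 \<Rightarrow> - 3 * u\<langle>N11\<rangle> | P32 \<Rightarrow> - 3 * u\<langle>N10\<rangle> | _ \<Rightarrow> 0)"
| "ad_div2 P31 u i = (case i of P31 \<Rightarrow> - u\<langle>N31\<rangle> | _ \<Rightarrow> 0)"
| "ad_div2 P32 u i = (case i of P32 \<Rightarrow> - u\<langle>N32\<rangle> | _ \<Rightarrow> 0)"
| "ad_div2 N10 u i = (case i of P01 \<Rightarrow> 3 * u\<langle>P21\<rangle> | P11 \<Rightarrow> u\<langle>P31\<rangle> | N10 \<Rightarrow> - u\<langle>P10\<rangle> | N21 \<Rightarrow> u\<langle>N01\<rangle> | N31 \<Rightarrow> 3 * u\<langle>N11\<rangle> | _ \<Rightarrow> 0)"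
| "ad_div2 N01 u i = (case i of N01 \<Rightarrow> - u\<langle>P01\<rangle> | _ \<Rightarrow> 0)"
| "ad_div2 N11 u i = (case i of P10 \<Rightarrow> u\<langle>P32\<rangle> | N01 \<Rightarrow> - 3 * u\<langle>P21\<rangle> | N11 \<Rightarrow> - u\<langle>P11\<rangle> | N21 \<Rightarrow> - u\<langle>P01\<rangle> | N32 \<Rightarrow> 3 * u\<langle>N10\<rangle> | _ \<Rightarrow> 0)"
| "ad_div2 N21 u i = (case i of N10 \<Rightarrow> - u\<langle>P32\<rangle> | N11 \<Rightarrow> - u\<langle>P31\<rangle> | N21 \<Rightarrow> - u\<langle>P21\<rangle> | N31 \<Rightarrow> - 3 * u\<langle>P11\<rangle> | N32 \<Rightarrow> - 3 * u\<langle>P10\<rangle> | _ \<Rightarrow> 0)"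
| "ad_div2 N31 u i = (case i of N31 \<Rightarrow> - u\<langle>P31\<rangle> | _ \<Rightarrow> 0)"
| "ad_div2 N32 u i = (case i of N32 \<Rightarrow> - u\<langle>P32\<rangle> | _ \<Rightarrow> 0)"

primrec ad_div3 :: "g2_index \<Rightarrow> 'a::comm_ring_1 g2_vec \<Rightarrow> g2_index \<Rightarrow> 'a" where
  "ad_div3 H1 u i = 0"
| "ad_div3 H2 u i = 0"
| "ad_div3 P10 u i = (case i of P31 \<Rightarrow> u\<langle>P01\<rangle> | N01 \<Rightarrow> - u\<langle>N31\<rangle> | _ \<Rightarrow> 0)"
| "ad_div3 P01 u i = 0"
| "ad_div3 P11 u i = (case i of P01 \<Rightarrow> - u\<langle>N32\<rangle> | P32 \<Rightarrow> u\<langle>N01\<rangle> | _ \<Rightarrow> 0)"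
| "ad_div3 P21 u i = (case i of P31 \<Rightarrow> u\<langle>N32\<rangle> | P32 \<Rightarrow> - u\<langle>N31\<rangle> | _ \<Rightarrow> 0)"
| "ad_div3 P31 u i = 0"
| "ad_div3 P32 u i = 0"
| "ad_div3 N10 u i = (case i of P01 \<Rightarrow> u\<langle>P31\<rangle> | N31 \<Rightarrow> - u\<langle>N01\<rangle> | _ \<Rightarrow> 0)"
| "ad_div3 N01 u i = 0"
| "ad_div3 N11 u i = (case i of N01 \<Rightarrow> u\<langle>P32\<rangle> | N32 \<Rightarrow> - u\<langle>P01\<rangle> | _ \<Rightarrow> 0)"
| "ad_div3 N21 u i = (case i of N31 \<Rightarrow> - u\<langle>P32\<rangle> | N32 \<Rightarrow> u\<langle>P31\<rangle> | _ \<Rightarrow> 0)"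
| "ad_div3 N31 u i = 0"
| "ad_div3 N32 u i = 0"


section \<open>Divided powers and exponentials of root vectors\<close>

definition div_power :: "g2_index \<Rightarrow> nat \<Rightarrow> 'a::comm_ring_1 g2_vec \<Rightarrow> 'a g2_vec" where
  "div_power r k u = (if k = 0 then u else if k = 1 then br (E r) u
     else of_coords (if k = 2 then ad_div2 r u else if k = 3 then ad_div3 r u else (\<lambda>i. 0)))"

definition root_exp :: "g2_index \<Rightarrow> 'a::comm_ring_1 \<Rightarrow> 'a g2_vec \<Rightarrow> 'a g2_vec" where
  "root_exp r t u = (\<Sum>k<4. t ^ k *s div_power r k u)"

lemma root_exp_nth [simp]:
  "(root_exp r t u)\<langle>i\<rangle> = u\<langle>i\<rangle> + t * bracket_coord i (E r) u + t^2 * ad_div2 r u i + t^3 * ad_div3 r u i"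
  by (simp add: root_exp_def div_power_def eval_nat_numeral)

definition mat_of :: "('a g2_vec \<Rightarrow> 'a g2_vec) \<Rightarrow> 'a::comm_ring_1 g2_mat" where
  "mat_of f = (\<chi> i j. f (axis j 1) $ i)"

lemma mat_of_mult_vec:
  assumes add: "\<And>u v. f (u + v) = f u + f v" and scale: "\<And>c u. f (c *s u) = c *s f u"
  shows "mat_of f *v u = f u"
proof -
  have zero: "f 0 = 0" using scale[of 0 0] by simp
  have sum: "f (\<Sum>i\<in>S. g i) = (\<Sum>i\<in>S. f (g i))" if "finite S" for S and g :: "2 + g2_root \<Rightarrow> _"
    using that by (induction S rule: finite_induct) (simp_all add: add zero)
  have "f u = f (\<Sum>i\<in>UNIV. (u$i) *s axis i 1)" by (simp add: basis_expansion)
  also have "\<dots> = mat_of f *v u"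
    by (simp add: sum scale vec_eq_iff mat_of_def matrix_vector_mult_def mult.commute)
  finally show ?thesis by simp
qed

lemma br_add_left: "br (u + u') v = br u v + br u' v"
  and br_add_right: "br u (v + v') = br u v + br u v'"
  and br_scale_left: "br (c *s u) v = c *s br u v"
  and br_scale_right: "br u (c *s v) = c *s br u v"
  and br_anticomm: "br v u = - br u v"
  unfolding vec_eq_idx all_index by (simp_all add: algebra_simps)

lemma br_jacobi: "br u (br v w) = br (br u v) w + br v (br u w)"
  unfolding vec_eq_idx all_index by (simp add: algebra_simps)

lemma root_exp_exp:
  assumes "r \<notin> {H1, H2}"
  shows "root_exp r s (root_exp r t u) = root_exp r (s + t) u"
  using assms unfolding vec_eq_idx all_index
  by (cases r) (simp_all add: algebra_simps power2_eq_square power3_eq_cube)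

text \<open>Over the rationals this is the exponential of a derivation. As an identity of
  polynomials in \<open>t\<close> with integral coefficients it can be checked coordinate by
  coordinate, and no factorial has to be inverted.\<close>

lemma root_exp_br:
  assumes "r \<notin> {H1, H2}"
  shows "root_exp r t (br u v) = br (root_exp r t u) (root_exp r t v)"
  using assms unfolding vec_eq_idx all_index
  by (cases r) (simp_all add: algebra_simps power2_eq_square power3_eq_cube)

definition killing :: "'a::comm_ring_1 g2_vec \<Rightarrow> 'a g2_vec \<Rightarrow> 'a" where
  "killing u v = trace (mat_of (br u) ** mat_of (br v))"

text \<open>The Gram matrix consists of the Cartan block [[48, -24], [-24, 16]] of determinant 192 =
  2^6 * 3 and of pairings of opposite root vectors with value 24 (short) or 8 (long). Hence the form
  is unimodular as soon as 2 and 3 are units.\<close>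

lemma killing_eq: "killing u v = 48 * u\<langle>H1\<rangle> * v\<langle>H1\<rangle> - 24 * (u\<langle>H1\<rangle> * v\<langle>H2\<rangle> + u\<langle>H2\<rangle> * v\<langle>H1\<rangle>)
   + 16 * u\<langle>H2\<rangle> * v\<langle>H2\<rangle> 
   + 24 * (u\<langle>P10\<rangle> * v\<langle>N10\<rangle> + u\<langle>N10\<rangle> * v\<langle>P10\<rangle> + u\<langle>P11\<rangle> * v\<langle>N11\<rangle> + u\<langle>N11\<rangle> * v\<langle>P11\<rangle>
       + u\<langle>P21\<rangle> * v\<langle>N21\<rangle> + u\<langle>N21\<rangle> * v\<langle>P21\<rangle>)
   + 8 * (u\<langle>P01\<rangle> * v\<langle>N01\<rangle> + u\<langle>N01\<rangle> * v\<langle>P01\<rangle> + u\<langle>P31\<rangle> * v\<langle>N31\<rangle> + u\<langle>N31\<rangle> * v\<langle>P31\<rangle>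
       + u\<langle>P32\<rangle> * v\<langle>N32\<rangle> + u\<langle>N32\<rangle> * v\<langle>P32\<rangle>)"
  unfolding killing_def trace_def matrix_matrix_mult_def mat_of_def
  by (simp add: sum_idx sum_index algebra_simps)

lemma div_power_0 [simp]: "div_power r 0 u = u"
  and div_power_1: "div_power r (Suc 0) u = br (E r) u"
  by (simp_all add: div_power_def)

lemma div_power_ge: "k > 3 \<Longrightarrow> div_power r k u = 0"
  by (simp add: div_power_def vec_eq_idx)

lemma br_div_power:
  assumes "r \<notin> {H1, H2}"
  shows "br (E r) (div_power r k u) = of_nat (Suc k) *s div_power r (Suc k) u"
proof -
  consider "k = 0" | "k = 1" | "k = 2" | "k = 3" | "k > 3" by linarith
  then show ?thesis
  proof cases
    case 1 then show ?thesis by (simp add: div_power_1)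
  next
    case 2 then show ?thesis using assms unfolding vec_eq_idx all_index
      by (cases r) (simp_all add: div_power_def)
  next
    case 3 then show ?thesis using assms unfolding vec_eq_idx all_index
      by (cases r) (simp_all add: div_power_def)
  next
    case 4 then show ?thesis using assms unfolding vec_eq_idx all_index
      by (cases r) (simp_all add: div_power_def)
  next
    case 5
    have "br (E r) 0 = 0" using br_scale_right[of "E r" 0 0] by simp
    then show ?thesis using 5 by (simp add: div_power_ge)
  qed
qed

lemma br_power:
  assumes "r \<notin> {H1, H2}"
  shows "(br (E r) ^^ k) u = fact k *s div_power r k u"
proof (induction k)
  case (Suc k)
  have "(br (E r) ^^ Suc k) u = fact k *s (of_nat (Suc k) *s div_power r (Suc k) u)"
    using assms by (simp only: funpow.simps o_apply Suc.IH br_scale_right br_div_power[OF assms])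
  then show ?case
    by (simp only: vector_smult_assoc fact_Suc mult.commute of_nat_fact of_nat_mult)
qed simp

lemma div_power_add: "div_power r k (u + v) = div_power r k u + div_power r k v"
  and div_power_scale: "div_power r k (c *s u) = c *s div_power r k u"
  unfolding vec_eq_idx all_index
  by (cases r; simp add: div_power_def algebra_simps)+

lemma root_exp_add: "root_exp r t (u + v) = root_exp r t u + root_exp r t v"
  and root_exp_scale: "root_exp r t (c *s u) = c *s root_exp r t u"
  by (simp_all add: root_exp_def div_power_add div_power_scale sum.distrib
      vec_eq_iff sum_distrib_left algebra_simps)

lemma root_exp_0: "root_exp r 0 u = u"
  by (simp add: vec_eq_idx)

lemma of_int_div_power:
  "(\<chi> i. of_int ((div_power r k u) $ i)) = div_power r k (\<chi> i. of_int (u $ i))"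
  unfolding vec_eq_idx all_index
  by (cases r) (simp_all add: div_power_def)

section \<open>Automorphisms and derivations\<close>

lemma vec_expansion: "u = (\<Sum>i\<in>UNIV. u\<langle>i\<rangle> *s E i)" for u :: "'a::comm_ring_1 g2_vec"
  by (simp add: vec_eq_idx)  (simp add: if_distrib cong: if_cong)

lemma br_zero_left [simp]: "br 0 v = 0" and br_zero_right [simp]: "br u 0 = 0"
  using br_scale_left[of 0 0 v] br_scale_right[of u 0 0] by simp_all

lemma matrix_vector_scale: "A *v (c *s v) = c *s (A *v v)" for A :: "'a::comm_ring_1^'n^'m"
  by (simp add: vec_eq_iff matrix_vector_mult_def sum_distrib_left algebra_simps)

lemma matrix_add_rdistrib: "(A + B) ** C = A ** C + B ** C" for A :: "'a::comm_ring_1^'n^'m"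
  by (simp add: vec_eq_iff matrix_matrix_mult_def sum.distrib algebra_simps)

section \<open>The Killing form, derivations and the adjoint representation\<close>

definition adm :: "'a::comm_ring_1 g2_vec \<Rightarrow> 'a g2_mat" where
  "adm u = mat_of (br u)"

lemma adm_mult_vec [simp]: "adm u *v v = br u v"
  unfolding adm_def by (rule mat_of_mult_vec) (simp_all add: br_add_right br_scale_right)

lemma killing_adm: "killing u v = trace (adm u ** adm v)"
  by (simp add: killing_def adm_def)

lemma adm_add: "adm (u + v) = adm u + adm v"
  by (simp add: matrix_eq matrix_vector_mult_add_rdistrib br_add_left)

definition automorphism :: "'a::comm_ring_1 g2_mat \<Rightarrow> bool" where
  "automorphism g \<longleftrightarrow> invertible g \<and> (\<forall>u v. g *v br u v = br (g *v u) (g *v v))"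

definition derivation :: "'a::comm_ring_1 g2_mat \<Rightarrow> bool" where
  "derivation D \<longleftrightarrow> (\<forall>u v. D *v br u v = br (D *v u) v + br u (D *v v))"

definition submod :: "'a::comm_ring_1 g2_vec set \<Rightarrow> bool" where
  "submod W \<longleftrightarrow> 0 \<in> W \<and> (\<forall>u\<in>W. \<forall>v\<in>W. u + v \<in> W) \<and> (\<forall>c. \<forall>u\<in>W. c *s u \<in> W)"

lemma adm_automorphism: "automorphism g \<Longrightarrow> adm (g *v u) ** g = g ** adm u"
  by (simp add: matrix_eq automorphism_def flip: matrix_vector_mul_assoc)

text \<open>An automorphism \<open>g\<close> conjugates \<open>adm u\<close> into
  \<open>adm (g *v u)\<close>, and a trace is invariant under conjugation.\<close>

lemma killing_automorphism:
  assumes "automorphism g"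
  shows "killing (g *v u) (g *v v) = killing u v"
proof -
  obtain g' where g': "g ** g' = mat 1" "g' ** g = mat 1"
    using assms by (auto simp: automorphism_def invertible_def)
  have ad: "adm (g *v u) = g ** adm u ** g'" for u
    using arg_cong[OF adm_automorphism[OF assms, of u], of "\<lambda>A. A ** g'"] g'
    by (simp flip: matrix_mul_assoc)
  have "adm (g *v u) ** adm (g *v v) = g ** adm u ** (g' ** g) ** adm v ** g'"
    unfolding ad by (simp only: matrix_mul_assoc)
  also have "\<dots> = g ** (adm u ** adm v) ** g'"
    by (simp only: g' matrix_mul_rid matrix_mul_assoc)
  finally have "killing (g *v u) (g *v v) = trace (g' ** (g ** (adm u ** adm v)))"
    by (simp only: killing_adm trace_mul_sym[of "g ** (adm u ** adm v)" g'])
  then show ?thesis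
    by (simp only: matrix_mul_assoc g' matrix_mul_lid killing_adm)
qed

text \<open>A common denominator: with \<open>24 * e = 1\<close> the inverses of 2, 3, 8 and 12 are
  \<open>12 * e\<close>, \<open>8 * e\<close>, \<open>3 * e\<close> and
  \<open>2 * e\<close>.\<close>

lemma unit_24:
  assumes "(2::'a::comm_ring_1) dvd 1" "(3::'a::comm_ring_1) dvd 1"
  obtains e :: "'a::comm_ring_1" where "24 * e = 1"
proof -
  obtain a b :: 'a where "1 = 2 * a" "1 = 3 * b" using assms by (auto simp: dvd_def)
  then have "(2 * a) * (2 * a) * (2 * a) * (3 * b) = 1" by simp
  then have "24 * (a * a * a * b) = 1" by (simp add: algebra_simps)
  then show ?thesis using that by blast
qed

lemma killing_represents:
  fixes f :: "'a::comm_ring_1 g2_vec \<Rightarrow> 'a"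
  assumes "(2::'a) dvd 1" "(3::'a) dvd 1"
    and add: "\<And>u v. f (u + v) = f u + f v" and scale: "\<And>c u. f (c *s u) = c * f u"
  obtains w where "\<And>v. killing w v = f v"
proof -
  obtain e :: 'a where e: "24 * e = 1" using unit_24 assms(1,2) by blast
  \<comment> \<open>These are the coefficients of the inverse Gram matrix: the Cartan block inverts
    to e * [[2, 3], [3, 6]], and a pair of opposite root vectors contributes 1/24 = e if short, 1/8
    = 3 * e if long.\<close>
  define w where "w = of_coords (\<lambda>i. case i of
      H1 \<Rightarrow> e * (2 * f (E H1) + 3 * f (E H2)) | H2 \<Rightarrow> e * (3 * f (E H1) + 6 * f (E H2))
    | P10 \<Rightarrow> e * f (E N10) | P01 \<Rightarrow> 3 * e * f (E N01) | P11 \<Rightarrow> e * f (E N11) | P21 \<Rightarrow> e * f (E N21)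
    | P31 \<Rightarrow> 3 * e * f (E N31) | P32 \<Rightarrow> 3 * e * f (E N32) | N10 \<Rightarrow> e * f (E P10) | N01 \<Rightarrow> 3 * e * f (E P01)
    | N11 \<Rightarrow> e * f (E P11) | N21 \<Rightarrow> e * f (E P21) | N31 \<Rightarrow> 3 * e * f (E P31) | N32 \<Rightarrow> 3 * e * f (E P32))"
  have zero: "f 0 = 0" using scale[of 0 0] by simp
  have sum: "f (\<Sum>i\<in>S. g i) = (\<Sum>i\<in>S. f (g i))" if "finite S" for S and g :: "g2_index \<Rightarrow> _"
    using that by (induction S rule: finite_induct) (simp_all add: add zero)
  have "killing w v = f v" for v
  proof -
    have "f v = (\<Sum>i\<in>UNIV. v\<langle>i\<rangle> * f (E i))"
      by (subst vec_expansion[of v]) (simp add: sum scale)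
    also have "\<dots> = 24 * e * (\<Sum>i\<in>UNIV. v\<langle>i\<rangle> * f (E i))"
      by (simp add: e)
    also have "\<dots> = killing w v"
      by (simp add: sum_index killing_eq w_def algebra_simps)
    finally show ?thesis by simp
  qed
  then show ?thesis using that by blast
qed

lemma killing_nondegenerate:
  fixes u :: "'a::comm_ring_1 g2_vec"
  assumes "(2::'a) dvd 1" "(3::'a) dvd 1" and "\<And>v. killing u v = 0"
  shows "u = 0"
proof -
  obtain e :: 'a where e: "24 * e = 1" using unit_24 assms(1,2) by blast
  \<comment> \<open>The test vectors \<open>w\<close> used below are the columns of 24 times the
    inverse Gram matrix.\<close>
  have coord: "u\<langle>i\<rangle> = 0" if "killing u w = 24 * u\<langle>i\<rangle>" for i w
    using that assms(3)[of w] e by (metis mult.assoc mult.commute mult_1 mult_zero_right)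
  have "u\<langle>H1\<rangle> = 0" by (rule coord[of "2 *s E H1 + 3 *s E H2"]) (simp add: killing_eq algebra_simps)
  moreover have "u\<langle>H2\<rangle> = 0" by (rule coord[of "3 *s E H1 + 6 *s E H2"]) (simp add: killing_eq algebra_simps)
  moreover have "u\<langle>P10\<rangle> = 0" by (rule coord[of "E N10"]) (simp add: killing_eq)
  moreover have "u\<langle>P01\<rangle> = 0" by (rule coord[of "3 *s E N01"]) (simp add: killing_eq)
  moreover have "u\<langle>P11\<rangle> = 0" by (rule coord[of "E N11"]) (simp add: killing_eq)
  moreover have "u\<langle>P21\<rangle> = 0" by (rule coord[of "E N21"]) (simp add: killing_eq)
  moreover have "u\<langle>P31\<rangle> = 0" by (rule coord[of "3 *s E N31"]) (simp add: killing_eq)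
  moreover have "u\<langle>P32\<rangle> = 0" by (rule coord[of "3 *s E N32"]) (simp add: killing_eq)
  moreover have "u\<langle>N10\<rangle> = 0" by (rule coord[of "E P10"]) (simp add: killing_eq)
  moreover have "u\<langle>N01\<rangle> = 0" by (rule coord[of "3 *s E P01"]) (simp add: killing_eq)
  moreover have "u\<langle>N11\<rangle> = 0" by (rule coord[of "E P11"]) (simp add: killing_eq)
  moreover have "u\<langle>N21\<rangle> = 0" by (rule coord[of "E P21"]) (simp add: killing_eq)
  moreover have "u\<langle>N31\<rangle> = 0" by (rule coord[of "3 *s E P31"]) (simp add: killing_eq)
  moreover have "u\<langle>N32\<rangle> = 0" by (rule coord[of "3 *s E P32"]) (simp add: killing_eq)
  ultimately show ?thesis unfolding vec_eq_idx all_index by simp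
qed

lemma killing_diff_left: "killing (u - u') v = killing u v - killing u' v"
  by (simp add: killing_eq algebra_simps)

text \<open>The Killing form depends on its argument only through \<open>adm\<close>, so
  nondegeneracy makes the adjoint representation faithful.\<close>

lemma adm_inject:
  fixes u v :: "'a::comm_ring_1 g2_vec"
  assumes "(2::'a) dvd 1" "(3::'a) dvd 1" and "adm u = adm v"
  shows "u = v"
proof -
  have "killing (u - v) w = 0" for w
    unfolding killing_diff_left using assms(3) by (simp add: killing_adm)
  then have "u - v = 0" by (rule killing_nondegenerate[OF assms(1,2)])
  then show ?thesis by simp
qed

lemma derivation_adm: "derivation (adm u)"
  unfolding derivation_def adm_mult_vec by (blast intro: br_jacobi)

text \<open>Cyclicity of the trace gives tr(D [ad u, ad v]) = tr([D, ad u] ad v), and [D, ad u] = ad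
  (D u) for a derivation D.\<close>

lemma trace_derivation:
  assumes "derivation D"
  shows "trace (D ** adm (br u v)) = killing (D *v u) v"
proof -
  have uv: "adm u ** adm v = adm (br u v) + adm v ** adm u"
    unfolding matrix_eq
    by (simp add: matrix_vector_mult_add_rdistrib br_jacobi[of u v] flip: matrix_vector_mul_assoc)
  have D: "D ** adm u = adm (D *v u) + adm u ** D"
    using assms by (simp add: matrix_eq derivation_def matrix_vector_mult_add_rdistrib
        flip: matrix_vector_mul_assoc)
  have "trace (D ** (adm u ** adm v)) = trace (D ** adm (br u v)) + trace (D ** (adm v ** adm u))"
    by (simp add: uv matrix_add_ldistrib trace_add)
  moreover have "trace (D ** (adm u ** adm v)) = killing (D *v u) v + trace (adm u ** D ** adm v)"
    by (simp add: matrix_mul_assoc D matrix_add_rdistrib trace_add killing_adm)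
  moreover have "trace (adm u ** D ** adm v) = trace (D ** (adm v ** adm u))"
    by (metis matrix_mul_assoc trace_mul_sym)
  ultimately show ?thesis by simp
qed

text \<open>Unimodularity yields w with tr(D ad v) = tr(ad w ad v) for all v. By
  \<open>trace_derivation\<close>, applied to D and to ad w, the vectors D u and [w, u] have the
  same Killing product with every v.\<close>

lemma derivation_inner:
  fixes D :: "'a::comm_ring_1 g2_mat"
  assumes units: "(2::'a) dvd 1" "(3::'a) dvd 1" and D: "derivation D"
  obtains w where "D = adm w"
proof -
  have scale: "trace (D ** adm (c *s u)) = c * trace (D ** adm u)" for c u
    by (simp add: trace_def matrix_matrix_mult_def adm_def mat_of_def br_scale_left
        sum_distrib_left algebra_simps)
  obtain w where w: "\<And>v. killing w v = trace (D ** adm v)"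
    using killing_represents[OF units, of "\<lambda>v. trace (D ** adm v)"]
    by (metis adm_add matrix_add_ldistrib trace_add scale)
  have "killing (D *v u - br w u) v = 0" for u v
    unfolding killing_diff_left
    using trace_derivation[OF D, of u v] trace_derivation[OF derivation_adm, of w u v] w[of "br u v"]
    by (simp add: killing_adm)
  then have "D *v u = br w u" for u
    using killing_nondegenerate[OF units, of "D *v u - br w u"] by simp
  then have "D = adm w" by (simp add: matrix_eq)
  then show ?thesis using that by blast
qed

text \<open>The adjoint module is generated by its highest root vector under the two simple lowering
  operators: every structure constant met on the way down is 1, 2 or 3 up to sign, hence a
  unit.\<close>

lemma submod_UNIV:
  fixes W :: "'a::comm_ring_1 g2_vec set"
  assumes units: "(2::'a) dvd 1" "(3::'a) dvd 1" and W: "submod W"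
    and top: "E P32 \<in> W"
    and lower: "\<And>u. u \<in> W \<Longrightarrow> br (E N10) u \<in> W" "\<And>u. u \<in> W \<Longrightarrow> br (E N01) u \<in> W"
  shows "u \<in> W"
proof -
  obtain e :: 'a where e: "24 * e = 1" using unit_24 units by blast
  have add: "u + v \<in> W" if "u \<in> W" "v \<in> W" for u v using W that by (auto simp: submod_def)
  have cancel: "u \<in> W" if "v \<in> W" "c * d = 1" "v = c *s u" for u v c d
  proof -
    have "u = d *s v" using that(2,3) by (simp add: vector_smult_assoc mult.commute)
    then show ?thesis using W that(1) by (auto simp: submod_def)
  qed
  note eqs = vec_eq_idx all_index
  have P31: "E P31 \<in> W" 
    by (rule cancel[OF lower(2)[OF top], of 1 1]) (simp_all add: eqs)
  have P21: "E P21 \<in> W" 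
    by (rule cancel[OF lower(1)[OF P31], of 1 1]) (simp_all add: eqs)
  have P11: "E P11 \<in> W" 
    by (rule cancel[OF lower(1)[OF P21], of 2 "12 * e"]) (simp_all add: eqs e)
  have P01: "E P01 \<in> W" 
    by (rule cancel[OF lower(1)[OF P11], of 3 "8 * e"]) (simp_all add: eqs e)
  have P10: "E P10 \<in> W" 
    by (rule cancel[OF lower(2)[OF P11], of "-1" "-1"]) (simp_all add: eqs e)
  have H1: "E H1 \<in> W" 
    by (rule cancel[OF lower(1)[OF P10], of "-1" "-1"]) (simp_all add: eqs e)
  have H2: "E H2 \<in> W" 
    by (rule cancel[OF lower(2)[OF P01], of "-1" "-1"]) (simp_all add: eqs e)
  have N10: "E N10 \<in> W" 
    by (rule cancel[OF lower(1)[OF H1], of 2 "12 * e"]) (simp_all add: eqs e)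
  have N01: "E N01 \<in> W" 
    by (rule cancel[OF lower(2)[OF H2], of 2 "12 * e"]) (simp_all add: eqs e)
  have N11: "E N11 \<in> W" 
    by (rule cancel[OF lower(1)[OF N01], of "-1" "-1"]) (simp_all add: eqs e)
  have N21: "E N21 \<in> W" 
    by (rule cancel[OF lower(1)[OF N11], of "-2" "-12 * e"]) (simp_all add: eqs e)
  have N31: "E N31 \<in> W" 
    by (rule cancel[OF lower(1)[OF N21], of "-3" "-8 * e"]) (simp_all add: eqs e)
  have N32: "E N32 \<in> W" 
    by (rule cancel[OF lower(2)[OF N31], of "-1" "-1"]) (simp_all add: eqs e)
  have E: "E i \<in> W" for i
    by (cases i) (use top P31 P21 P11 P01 P10 H1 H2 N10 N01 N11 N21 N31 N32 in simp_all)
  have sum: "(\<Sum>i\<in>S. u\<langle>i\<rangle> *s E i) \<in> W" if "finite S" for S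
    using that
    by (induction S rule: finite_induct) (use W E in \<open>simp_all add: submod_def add\<close>)
  show ?thesis by (subst vec_expansion[of u]) (rule sum, simp)
qed

text \<open>A version of Schur's lemma: the square of \<open>ad (E P32)\<close> reads off only the
  \<open>N32\<close>-coordinate and has its values in the line of \<open>E P32\<close>. An operator
  commuting with ad L therefore preserves this line, with the factor \<open>c\<close>, and the
  eigenvectors for \<open>c\<close> form a submodule closed under lowering.\<close>

lemma centralizer_scalar:
  fixes C :: "'a::comm_ring_1 g2_mat"
  assumes units: "(2::'a) dvd 1" "(3::'a) dvd 1"
    and comm: "\<And>u v. C *v br u v = br u (C *v v)"
  obtains c where "\<And>v. C *v v = c *s v"
proof -
  obtain e :: 'a where e: "24 * e = 1" using unit_24 units by blast
  have P32: "E P32 = (- 12 * e) *s br (E P32) (br (E P32) (E N32))"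
    unfolding vec_eq_idx all_index by (simp add: e)
  define c where "c = (C *v E N32)\<langle>N32\<rangle>"
  have "C *v E P32 = (- 12 * e) *s br (E P32) (br (E P32) (C *v E N32))"
    by (subst P32) (simp only: matrix_vector_scale comm)
  also have "\<dots> = c *s E P32"
    unfolding vec_eq_idx all_index by (simp add: c_def) (simp add: e mult.assoc[symmetric])
  finally have top: "C *v E P32 = c *s E P32" .
  have "v \<in> {v. C *v v = c *s v}" for v
  proof (rule submod_UNIV[OF units])
    show "submod {v. C *v v = c *s v}"
      by (auto simp: submod_def matrix_vector_right_distrib matrix_vector_scale vector_smult_assoc
          vector_add_ldistrib mult.commute)
  qed (use top in \<open>auto simp: comm br_scale_right\<close>)
  then show ?thesis using that by blast
qed

text \<open>
  The odd part in \<open>s\<close> of the automorphism identity for \<open>1 + s D + s\<^sup>2 Q\<close> is a cubic without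
  constant term; its values at \<open>1\<close> and \<open>2\<close> determine the linear coefficient up to a factor \<open>12\<close>.
\<close>

lemma derivation_of_quadratic_family:
  fixes D Q :: "'a::comm_ring_1 g2_vec \<Rightarrow> 'a g2_vec"
  assumes units: "(2::'a) dvd 1" "(3::'a) dvd 1"
    and F: "\<And>s u v. s \<in> {1, -1, 2, -2} \<Longrightarrow>
      br u v + s *s D (br u v) + s^2 *s Q (br u v)
        = br (u + s *s D u + s^2 *s Q u) (v + s *s D v + s^2 *s Q v)"
  shows "D (br u v) = br (D u) v + br u (D v)"
proof -
  obtain e :: 'a where e: "24 * e = 1" using unit_24 units by blast
  define L where "L = D (br u v) - br (D u) v - br u (D v)"
  define B where "B = Q (br u v) - br (Q u) v - br u (Q v) - br (D u) (D v)"
  define A where "A = br (D u) (Q v) + br (Q u) (D v)"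
  define T where "T = br (Q u) (Q v)"
  have *: "s *s L + s^2 *s B - s^3 *s A - s^4 *s T = 0" if "s \<in> {1, -1, 2, -2}" for s
    using F[OF that, of u v]
    by (simp add: L_def B_def A_def T_def br_add_left br_add_right br_scale_left br_scale_right
        vec_eq_iff algebra_simps power2_eq_square power3_eq_cube power4_eq_xxxx)
  have "12 * L $ i = 0" for i
  proof -
    define f where "f s = s * L $ i + s^2 * B $ i - s^3 * A $ i - s^4 * T $ i" for s
    have f: "f s = 0" if "s \<in> {1, -1, 2, -2}" for s
      using arg_cong[OF *[OF that], of "\<lambda>w. w $ i"] by (simp add: f_def)
    \<comment> \<open>The differences remove the coefficients of \<open>s^2\<close> and
      \<open>s^4\<close>. The weights 8 and -1 cancel that of \<open>s^3\<close>, as 8 * 2 = 2 *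
      2^3, and leave 16 - 4 = 12 for the linear one.\<close>
    have "12 * L $ i = 8 * (f 1 - f (-1)) - (f 2 - f (-2))"
      by (simp add: f_def algebra_simps)
    then show ?thesis by (simp add: f)
  qed
  then have "24 * e * L $ i = 0" for i
  proof -
    have "24 * e * L $ i = 2 * e * (12 * L $ i)" by (simp add: algebra_simps)
    then show ?thesis using \<open>\<And>i. 12 * L $ i = 0\<close> by simp
  qed
  then have "L $ i = 0" for i
    by (simp add: e)
  then have "L = 0" by (simp add: vec_eq_iff)
  then show ?thesis by (simp add: L_def algebra_simps)
qed

section \<open>The elementary group\<close>

lemma group_GL: "group (GL :: ('a::comm_ring_1^'n^'n) monoid)"
proof (rule groupI)
  fix A :: "'a^'n^'n" assume "A \<in> carrier GL"
  then obtain B where "A ** B = mat 1" "B ** A = mat 1"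
    by (auto simp: GL_def invertible_def)
  then show "\<exists>B\<in>carrier GL. B \<otimes>\<^bsub>GL\<^esub> A = \<one>\<^bsub>GL\<^esub>"
    by (auto simp: GL_def invertible_def)
qed (auto simp: GL_def invertible_mult matrix_mul_assoc invertible_def[of "mat 1"])

lemma inv_GL_eq:
  assumes "A ** B = mat 1" "B ** A = mat 1"
  shows "inv\<^bsub>GL\<^esub> A = B"
  using assms by (intro group.inv_equality[OF group_GL]) (auto simp: GL_def invertible_def)

abbreviation root_mat :: "g2_index \<Rightarrow> 'a::comm_ring_1 \<Rightarrow> 'a g2_mat" where
  "root_mat r t \<equiv> mat_of (root_exp r t)"

lemma root_mat_mult_vec [simp]: "root_mat r t *v u = root_exp r t u"
  by (rule mat_of_mult_vec) (simp_all add: root_exp_add root_exp_scale)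

lemma root_mat_inverse:
  assumes "r \<notin> {H1, H2}"
  shows "root_mat r t ** root_mat r (- t) = mat 1"
  unfolding matrix_eq
  by (simp add: root_exp_exp[OF assms] root_exp_0 flip: matrix_vector_mul_assoc)

definition elementary :: "'a::comm_ring_1 g2_mat set" where
  "elementary = generate GL {root_mat r t | r t. r \<notin> {H1, H2}}"

lemma root_mat_automorphism: 
  assumes "r \<notin> {H1, H2}"
  shows "automorphism (root_mat r t)"
  using root_mat_inverse[OF assms, of t] root_mat_inverse[OF assms, of "- t"]
  by (auto simp: automorphism_def invertible_def root_exp_br[OF assms])

lemma subgroup_elementary: "subgroup elementary GL"
  unfolding elementary_def
  by (rule group.generate_is_subgroup[OF group_GL])
    (use root_mat_automorphism in \<open>auto simp: GL_def automorphism_def\<close>)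

lemma elementary_root: "r \<notin> {H1, H2} \<Longrightarrow> root_mat r t \<in> elementary"
  unfolding elementary_def by (rule generate.incl) blast

lemma elementary_mult: "g \<in> elementary \<Longrightarrow> h \<in> elementary \<Longrightarrow> g ** h \<in> elementary"
  using subgroup.m_closed[OF subgroup_elementary] by (simp add: GL_def)

lemma elementary_one: "mat 1 \<in> elementary"
  using subgroup.one_closed[OF subgroup_elementary] by (simp add: GL_def)

lemma elementary_inverse:
  assumes "g \<in> elementary"
  obtains h where "h \<in> elementary" "g ** h = mat 1" "h ** g = mat 1"
proof -
  have "g \<in> carrier GL" using subgroup.mem_carrier[OF subgroup_elementary assms] .
  then have "inv\<^bsub>GL\<^esub> g \<in> elementary" "g ** inv\<^bsub>GL\<^esub> g = mat 1" "inv\<^bsub>GL\<^esub> g ** g = mat 1"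
    using subgroup.m_inv_closed[OF subgroup_elementary assms]
      group.r_inv[OF group_GL, of g] group.l_inv[OF group_GL, of g]
    by (simp_all add: GL_def)
  then show ?thesis using that by blast
qed

lemma automorphism_mult: "automorphism g \<Longrightarrow> automorphism h \<Longrightarrow> automorphism (g ** h)"
  by (simp add: automorphism_def invertible_mult flip: matrix_vector_mul_assoc)

lemma automorphism_inverse:
  assumes "automorphism g" "g ** h = mat 1" "h ** g = mat 1"
  shows "automorphism h"
proof -
  have gh: "g *v (h *v u) = u" and hg: "h *v (g *v u) = u" for u
    by (simp_all add: matrix_vector_mul_assoc assms)
  have "h *v br u v = h *v br (g *v (h *v u)) (g *v (h *v v))" for u v
    by (simp add: gh)
  also have "\<dots> u v = h *v (g *v br (h *v u) (h *v v))" for u v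
    using assms(1) by (simp add: automorphism_def)
  finally have "h *v br u v = br (h *v u) (h *v v)" for u v
    by (simp add: hg)
  then show ?thesis using assms by (auto simp: automorphism_def invertible_def)
qed

lemma elementary_automorphism:
  assumes "g \<in> elementary"
  shows "automorphism g"
  using assms unfolding elementary_def
proof (induction rule: generate.induct)
  case one
  then show ?case by (simp add: GL_def automorphism_def invertible_def)
next
  case (incl g)
  then show ?case using root_mat_automorphism by blast
next
  case (inv g)
  then obtain r t where g: "g = root_mat r t" "r \<notin> {H1, H2}" by blast
  have "inv\<^bsub>GL\<^esub> g = root_mat r (- t)"
    using root_mat_inverse[OF g(2), of t] root_mat_inverse[OF g(2), of "- t"] g(1)
    by (intro inv_GL_eq) simp_all
  then show ?case using root_mat_automorphism[OF g(2)] by simp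
next
  case (eng g h)
  then show ?case by (simp add: GL_def automorphism_mult)
qed

text \<open>Stability under the root elements implies stability under the operators ad e_r, to which
  generation by a highest root vector applies. The lowest root vector is an equally good start,
  because bracketing it twice with \<open>E P32\<close> gives -2 times \<open>E P32\<close>.\<close>

lemma stable_submod_UNIV:
  fixes W :: "'a::comm_ring_1 g2_vec set"
  assumes units: "(2::'a) dvd 1" "(3::'a) dvd 1" and W: "submod W"
    and top: "E P32 \<in> W \<or> E N32 \<in> W"
    and stable: "\<And>g u. g \<in> elementary \<Longrightarrow> u \<in> W \<Longrightarrow> g *v u \<in> W"
  shows "u \<in> W"
proof -
  obtain e :: 'a where e: "24 * e = 1" using unit_24 units by blast
  have add: "u + v \<in> W" if "u \<in> W" "v \<in> W" for u v using W that by (auto simp: submod_def)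
  have scale: "c *s u \<in> W" if "u \<in> W" for c u using W that by (auto simp: submod_def)
  have br: "br (E r) u \<in> W" if r: "r \<notin> {H1, H2}" and u: "u \<in> W" for r u
  proof -
    have R: "root_exp r t u \<in> W" for t
      using stable[OF elementary_root[OF r] u, of t] by simp
    \<comment> \<open>The exponential is cubic in its parameter; the weights 8, -8, -1, 1 at 1, -1,
      2, -2 leave 12 times its linear coefficient, and \<open>2 * e\<close> is the inverse of
      12.\<close>
    have "br (E r) u = (2 * e) *s (8 *s root_exp r 1 u + (- 8) *s root_exp r (- 1) u
        + (- 1) *s root_exp r 2 u + root_exp r (- 2) u)"
      unfolding vec_eq_idx
      by (simp del: vector_add_ldistrib add: algebra_simps)
        (simp add: mult.assoc[symmetric] mult.commute[of e] e)
    then show ?thesis by (simp only: R add scale)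
  qed
  have "E P32 \<in> W"
  proof (cases "E P32 \<in> W")
    case False
    then have "E N32 \<in> W" using top by simp
    then have "(- 12 * e) *s br (E P32) (br (E P32) (E N32)) \<in> W"
      by (simp only: scale br g2_index.distinct insert_iff empty_iff simp_thms)
    moreover have "(- 12 * e) *s br (E P32) (br (E P32) (E N32)) = E P32"
      unfolding vec_eq_idx all_index by (simp add: e)
    ultimately show ?thesis by simp
  qed
  then show ?thesis by (rule submod_UNIV[OF units W]) (simp_all add: br)
qed


section \<open>Normalizing matrices as scalar multiples of automorphisms\<close>

lemma normalizing_derivation:
  fixes N N' :: "'a::comm_ring_1 g2_mat"
  assumes units: "(2::'a) dvd 1" "(3::'a) dvd 1"
    and N: "N ** N' = mat 1" "N' ** N = mat 1"
    and norm: "\<And>g. g \<in> elementary \<Longrightarrow> N ** g ** N' \<in> elementary"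
  shows "derivation (N ** adm u ** N')"
proof -
  define W where "W = {u. derivation (N ** adm u ** N')}"
  have NN': "N *v (N' *v u) = u" and N'N: "N' *v (N *v u) = u" for u
    by (simp_all add: matrix_vector_mul_assoc N)
  have W: "u \<in> W \<longleftrightarrow> (\<forall>v w. N *v br u (N' *v br v w) = br (N *v br u (N' *v v)) w + br v (N *v br u (N' *v w)))" for u
    by (simp add: W_def derivation_def flip: matrix_vector_mul_assoc)
  have "u \<in> W"
  proof (rule stable_submod_UNIV[OF units])
    show "submod W"
      by (simp add: submod_def W br_add_left br_add_right br_scale_left br_scale_right
          matrix_vector_right_distrib matrix_vector_scale algebra_simps)
    show "E P32 \<in> W \<or> E N32 \<in> W"
    proof (rule disjI1, unfold W, intro allI)
      fix v w
      define D where "D u = N *v br (E P32) (N' *v u)" for u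
      define Q where "Q u = N *v div_power P32 2 (N' *v u)" for u
      have conj: "(N ** root_mat P32 s ** N') *v u = u + s *s D u + s\<^sup>2 *s Q u" for s u
      proof -
        have "root_exp P32 s u = u + s *s br (E P32) u + s\<^sup>2 *s div_power P32 2 u" for u
          unfolding vec_eq_idx all_index by (simp add: div_power_def)
        then show ?thesis
          by (simp add: D_def Q_def matrix_vector_right_distrib matrix_vector_scale NN'
              flip: matrix_vector_mul_assoc)
      qed
      have "automorphism (N ** root_mat P32 s ** N')" for s
        by (rule elementary_automorphism, rule norm, rule elementary_root) simp
      then have "D (br v w) = br (D v) w + br v (D w)"
        by (intro derivation_of_quadratic_family[OF units, of D Q])
          (simp add: automorphism_def flip: conj)
      then show "N *v br (E P32) (N' *v br v w)
          = br (N *v br (E P32) (N' *v v)) w + br v (N *v br (E P32) (N' *v w))"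
        by (simp add: D_def)
    qed
    show "g *v u \<in> W" if g: "g \<in> elementary" and u: "u \<in> W" for g u
    proof -
      obtain h where h: "h \<in> elementary" "g ** h = mat 1" "h ** g = mat 1"
        using elementary_inverse[OF g] by blast
      have gh: "g *v (h *v v) = v" for v
        by (simp add: matrix_vector_mul_assoc h)
      define G H where "G = N ** g ** N'" and "H = N ** h ** N'"
      have aut: "G *v br v w = br (G *v v) (G *v w)" "H *v br v w = br (H *v v) (H *v w)" for v w
        using elementary_automorphism[OF norm[OF g]] elementary_automorphism[OF norm[OF h(1)]]
        by (simp_all add: automorphism_def G_def H_def)
      have GH: "G *v (H *v v) = v" for v
        by (simp add: G_def H_def N'N gh NN' flip: matrix_vector_mul_assoc)
      have "br (g *v u) v = g *v br u (h *v v)" for v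
        using elementary_automorphism[OF g] by (simp add: automorphism_def gh)
      \<comment> \<open>Thus N (ad (g u)) N' is the conjugate of N (ad u) N' by \<open>G\<close>. As
        \<open>G\<close> lies in the group and is an automorphism, the conjugate of a derivation is
        again one.\<close>
      then have conj: "N *v br (g *v u) (N' *v v) = G *v (N *v br u (N' *v (H *v v)))" for v
        by (simp add: G_def H_def N'N flip: matrix_vector_mul_assoc)
      show ?thesis
        using u unfolding W conj by (simp add: aut matrix_vector_right_distrib GH)
    qed
  qed
  then show ?thesis by (simp add: W_def)
qed

theorem normalizing_scaled_automorphism:
  fixes N N' :: "'a::comm_ring_1 g2_mat"
  assumes units: "(2::'a) dvd 1" "(3::'a) dvd 1"
    and N: "N ** N' = mat 1" "N' ** N = mat 1"
    and norm: "\<And>g. g \<in> elementary \<Longrightarrow> N ** g ** N' \<in> elementary"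
      "\<And>g. g \<in> elementary \<Longrightarrow> N' ** g ** N \<in> elementary"
  obtains c A where "c dvd 1" "automorphism A" "\<And>v. N *v v = c *s (A *v v)"
proof -
  have NN': "N *v (N' *v u) = u" and N'N: "N' *v (N *v u) = u" for u
    by (simp_all add: matrix_vector_mul_assoc N)
  have "\<exists>w. N ** adm u ** N' = adm w" for u
    by (rule derivation_inner[OF units normalizing_derivation[OF units N norm(1), of u]], assumption, erule exI)
  moreover have "\<exists>w. N' ** adm u ** N = adm w" for u
    by (rule derivation_inner[OF units normalizing_derivation[OF units N(2,1) norm(2), of u]], assumption, erule exI)
  ultimately obtain p q where p: "\<And>u. N ** adm u ** N' = adm (p u)" and q: "\<And>u. N' ** adm u ** N = adm (q u)"
    by metis
  have p_br: "br (p u) v = N *v br u (N' *v v)" and q_br: "br (q u) v = N' *v br u (N *v v)" for u v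
    using arg_cong[OF p, of "\<lambda>A. A *v v" u] arg_cong[OF q, of "\<lambda>A. A *v v" u]
    by (simp_all flip: matrix_vector_mul_assoc)
  \<comment> \<open>The maps \<open>p\<close> and \<open>q\<close> arise from a choice. Faithfulness
    of the adjoint representation makes their values unique, so they are linear, mutually inverse
    and compatible with the bracket.\<close>
  have eqI: "u = v" if "\<And>w. br u w = br v w" for u v :: "'a g2_vec"
    by (rule adm_inject[OF units]) (simp add: matrix_eq that)
  have p_add: "p (u + v) = p u + p v" and p_scale: "p (c *s u) = c *s p u" for u v c
    by (rule eqI, simp add: p_br br_add_left br_scale_left matrix_vector_right_distrib matrix_vector_scale)+
  have q_add: "q (u + v) = q u + q v" and q_scale: "q (c *s u) = c *s q u" for u v c
    by (rule eqI, simp add: q_br br_add_left br_scale_left matrix_vector_right_distrib matrix_vector_scale)+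
  have pq: "p (q u) = u" and qp: "q (p u) = u" for u
    by (rule eqI, simp add: p_br q_br NN' N'N)+
  define P where "P = mat_of p"
  have P: "P *v u = p u" for u
    unfolding P_def by (rule mat_of_mult_vec[OF p_add p_scale])
  define Q where "Q = mat_of q"
  have Q: "Q *v u = q u" for u
    unfolding Q_def by (rule mat_of_mult_vec[OF q_add q_scale])
  have PQ: "P ** Q = mat 1" "Q ** P = mat 1"
    by (simp_all add: matrix_eq P Q pq qp flip: matrix_vector_mul_assoc)
  have p_hom: "p (br u v) = br (p u) (p v)" for u v
  proof (rule eqI)
    fix w
    have "br (br u v) (N' *v w) = br u (br v (N' *v w)) - br v (br u (N' *v w))"
      using br_jacobi[of u v "N' *v w"] by simp
    moreover have "br (br (p u) (p v)) w = br (p u) (br (p v) w) - br (p v) (br (p u) w)"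
      using br_jacobi[of "p u" "p v" w] by simp
    ultimately show "br (p (br u v)) w = br (br (p u) (p v)) w"
      by (simp add: p_br N'N matrix_vector_mult_diff_distrib)
  qed
  have A: "automorphism P"
    using PQ by (auto simp: automorphism_def invertible_def P p_hom)
  have "automorphism Q" by (rule automorphism_inverse[OF A PQ])
  then have q_hom: "q (br u v) = br (q u) (q v)" for u v
    by (simp add: automorphism_def Q)
  have "(Q ** N) *v br u v = br u ((Q ** N) *v v)" for u v
  proof -
    have "(Q ** N) *v br u v = q (br (p u) (N *v v))"
      by (simp add: Q p_br N'N flip: matrix_vector_mul_assoc)
    then show ?thesis
      by (simp add: Q q_hom qp flip: matrix_vector_mul_assoc)
  qed
  then obtain c where c: "\<And>v. (Q ** N) *v v = c *s v"
    using centralizer_scalar[OF units] by blast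
  have cN: "N *v v = c *s (P *v v)" for v
  proof -
    have "N *v v = P *v ((Q ** N) *v v)"
      by (simp add: P Q pq flip: matrix_vector_mul_assoc)
    then show ?thesis by (simp add: c matrix_vector_scale)
  qed
  \<comment> \<open>That \<open>c\<close> is a unit follows from surjectivity of \<open>N\<close>:
    the coordinate 1 of a vector in its image is a multiple of \<open>c\<close>.\<close>
  have "(N *v (N' *v E P32))\<langle>P32\<rangle> = 1" by (simp add: NN')
  then have "c * (P *v (N' *v E P32))\<langle>P32\<rangle> = 1" by (simp add: cN)
  then have "c dvd 1" by (metis dvd_triv_left)
  then show ?thesis using that A cN by blast
qed

section \<open>Weyl and torus elements\<close>

definition weyl_mat :: "g2_index \<Rightarrow> g2_index \<Rightarrow> 'a::comm_ring_1 \<Rightarrow> 'a \<Rightarrow> 'a g2_mat" where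
  "weyl_mat r r' s s' = root_mat r s ** root_mat r' (- s') ** root_mat r s"

text \<open>Steinberg's elements w_r(s) = x_r(s) x_-r(-1/s) x_r(s) and h_r(s) = w_r(s) w_r(-1), with
  \<open>r'\<close> meant to be -r and \<open>s'\<close> the inverse of \<open>s\<close>. The second
  one acts on e_q by the power of s whose exponent is the Cartan integer of q against r.\<close>

definition torus_mat :: "g2_index \<Rightarrow> g2_index \<Rightarrow> 'a::comm_ring_1 \<Rightarrow> 'a \<Rightarrow> 'a g2_mat" where
  "torus_mat r r' s s' = weyl_mat r r' s s' ** weyl_mat r r' (- 1) (- 1)"

lemma torus_mat_elementary:
  "r \<notin> {H1, H2} \<Longrightarrow> r' \<notin> {H1, H2} \<Longrightarrow> torus_mat r r' s s' \<in> elementary"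
  unfolding torus_mat_def weyl_mat_def by (intro elementary_mult elementary_root)

text \<open>Besides the simple root vectors and their negatives the list contains their images under
  the reflection, since \<open>torus_mat\<close> applies two such elements in succession.\<close>

lemma weyl_mat_short:
  fixes s s' :: "'a::comm_ring_1"
  assumes "s * s' = 1"
  shows "weyl_mat P10 N10 s s' *v E P10 = (- (s'^2)) *s E N10"
    "weyl_mat P10 N10 s s' *v E N10 = (- (s^2)) *s E P10"
    "weyl_mat P10 N10 s s' *v E P01 = s^3 *s E P31"
    "weyl_mat P10 N10 s s' *v E P31 = (- (s'^3)) *s E P01"
    "weyl_mat P10 N10 s s' *v E N01 = s'^3 *s E N31"
    "weyl_mat P10 N10 s s' *v E N31 = (- (s^3)) *s E N01"
proof -
  have s: "s' * s = 1" "s * (s' * x) = x" "s' * (s * x) = x" for x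
    using assms by (simp_all add: mult.commute flip: mult.assoc)
  show "weyl_mat P10 N10 s s' *v E P10 = (- (s'^2)) *s E N10"
    "weyl_mat P10 N10 s s' *v E N10 = (- (s^2)) *s E P10"
    "weyl_mat P10 N10 s s' *v E P01 = s^3 *s E P31"
    "weyl_mat P10 N10 s s' *v E P31 = (- (s'^3)) *s E P01"
    "weyl_mat P10 N10 s s' *v E N01 = s'^3 *s E N31"
    "weyl_mat P10 N10 s s' *v E N31 = (- (s^3)) *s E N01"
    unfolding vec_eq_idx all_index
    by (simp_all add: weyl_mat_def assms s algebra_simps power2_eq_square power3_eq_cube
        flip: matrix_vector_mul_assoc)
qed

lemma weyl_mat_long:
  fixes s s' :: "'a::comm_ring_1"
  assumes "s * s' = 1"
  shows "weyl_mat P01 N01 s s' *v E P01 = (- (s'^2)) *s E N01"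
    "weyl_mat P01 N01 s s' *v E N01 = (- (s^2)) *s E P01"
    "weyl_mat P01 N01 s s' *v E P10 = (- s) *s E P11"
    "weyl_mat P01 N01 s s' *v E P11 = s' *s E P10"
    "weyl_mat P01 N01 s s' *v E N10 = (- s') *s E N11"
    "weyl_mat P01 N01 s s' *v E N11 = s *s E N10"
proof -
  have s: "s' * s = 1" "s * (s' * x) = x" "s' * (s * x) = x" for x
    using assms by (simp_all add: mult.commute flip: mult.assoc)
  show "weyl_mat P01 N01 s s' *v E P01 = (- (s'^2)) *s E N01"
    "weyl_mat P01 N01 s s' *v E N01 = (- (s^2)) *s E P01"
    "weyl_mat P01 N01 s s' *v E P10 = (- s) *s E P11"
    "weyl_mat P01 N01 s s' *v E P11 = s' *s E P10"
    "weyl_mat P01 N01 s s' *v E N10 = (- s') *s E N11"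
    "weyl_mat P01 N01 s s' *v E N11 = s *s E N10"
    unfolding vec_eq_idx all_index
    by (simp_all add: weyl_mat_def assms s algebra_simps power2_eq_square power3_eq_cube
        flip: matrix_vector_mul_assoc)
qed

lemma torus_mat_short:
  fixes s s' :: "'a::comm_ring_1"
  assumes "s * s' = 1"
  shows "torus_mat P10 N10 s s' *v E P10 = s^2 *s E P10"
    "torus_mat P10 N10 s s' *v E N10 = s'^2 *s E N10"
    "torus_mat P10 N10 s s' *v E P01 = s'^3 *s E P01"
    "torus_mat P10 N10 s s' *v E N01 = s^3 *s E N01"
  by (simp_all add: torus_mat_def weyl_mat_short[OF assms] weyl_mat_short[of "- 1" "- 1"]
      matrix_vector_scale flip: matrix_vector_mul_assoc)

lemma torus_mat_long:
  fixes s s' :: "'a::comm_ring_1"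
  assumes "s * s' = 1"
  shows "torus_mat P01 N01 s s' *v E P10 = s' *s E P10"
    "torus_mat P01 N01 s s' *v E N10 = s *s E N10"
    "torus_mat P01 N01 s s' *v E P01 = s^2 *s E P01"
    "torus_mat P01 N01 s s' *v E N01 = s'^2 *s E N01"
  by (simp_all add: torus_mat_def weyl_mat_long[OF assms] weyl_mat_long[of "- 1" "- 1"]
      matrix_vector_scale flip: matrix_vector_mul_assoc)

section \<open>Automorphisms over a local ring\<close>

lemma ideal_type_algebra_iff:
  "ideal I (ring_of_type_algebra :: 'a::comm_ring_1 ring) \<longleftrightarrow>
    0 \<in> I \<and> (\<forall>x\<in>I. \<forall>y\<in>I. x + y \<in> I) \<and> (\<forall>c. \<forall>x\<in>I. c * x \<in> I)"
  (is "?L = ?R")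
proof
  assume ?L
  then interpret ideal I "ring_of_type_algebra :: 'a ring" .
  show ?R
    using additive_subgroup.zero_closed[OF is_additive_subgroup]
      additive_subgroup.a_closed[OF is_additive_subgroup] I_l_closed
    by (simp add: ring_of_type_algebra_def)
next
  assume R: ?R
  then have R': "x * c \<in> I" if "x \<in> I" for c x
    using that by (metis mult.commute)
  show ?L
  proof (rule idealI)
    show "subgroup I (add_monoid (ring_of_type_algebra :: 'a ring))"
    proof (rule group.subgroupI)
      show group: "group (add_monoid (ring_of_type_algebra :: 'a ring))"
        using ring.is_abelian_group[OF ring_from_type_algebra] abelian_group.a_group by blast
      fix x assume x: "x \<in> I"
      have "inv\<^bsub>add_monoid (ring_of_type_algebra :: 'a ring)\<^esub> x = - x"
        by (rule group.inv_equality[OF group]) (auto simp: ring_of_type_algebra_def)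
      moreover have "- x \<in> I" using R x by (metis mult_minus1)
      ultimately show "inv\<^bsub>add_monoid (ring_of_type_algebra :: 'a ring)\<^esub> x \<in> I" by simp
    qed (use R in \<open>auto simp: ring_of_type_algebra_def\<close>)
  qed (use R R' in \<open>auto simp: ring_of_type_algebra_def ring_from_type_algebra[unfolded ring_of_type_algebra_def]\<close>)
qed

text \<open>Krull's theorem: Zorn's lemma for the ideals that contain \<open>a\<close> and avoid 1;
  the union of a nonempty chain of them still avoids 1.\<close>

lemma nonunit_in_maximalideal:
  fixes a :: "'a::comm_ring_1"
  assumes "\<not> a dvd 1"
  obtains M where "maximalideal M (ring_of_type_algebra :: 'a ring)" "a \<in> M"
proof -
  let ?R = "ring_of_type_algebra :: 'a ring"
  define S where "S = {I. ideal I ?R \<and> a \<in> I \<and> 1 \<notin> I}"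
  have "\<exists>I\<in>S. \<forall>J\<in>S. I \<subseteq> J \<longrightarrow> J = I"
  proof (rule subset_Zorn_nonempty)
    have "range (\<lambda>c. c * a) \<in> S"
    proof -
      have "ideal (range (\<lambda>c. c * a)) ?R"
        unfolding ideal_type_algebra_iff image_def
        by (auto simp flip: distrib_right mult.assoc) (metis mult_zero_left)
      moreover have "1 \<notin> range (\<lambda>c. c * a)"
        using assms by (metis dvd_triv_right imageE)
      moreover have "a \<in> range (\<lambda>c. c * a)" by (metis mult_1 rangeI)
      ultimately show ?thesis by (simp add: S_def)
    qed
    then show "S \<noteq> {}" by blast
  next
    fix C assume C: "C \<noteq> {}" "subset.chain S C"
    then have CS: "C \<subseteq> S" and tot: "\<And>U V. U \<in> C \<Longrightarrow> V \<in> C \<Longrightarrow> U \<subseteq> V \<or> V \<subseteq> U"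
      by (auto simp: subset_chain_def)
    have "ideal (\<Union>C) ?R"
      unfolding ideal_type_algebra_iff
    proof (intro conjI ballI allI)
      show "0 \<in> \<Union>C" using C CS by (auto simp: S_def ideal_type_algebra_iff)
      show "c * x \<in> \<Union>C" if "x \<in> \<Union>C" for c x
        using that CS by (auto simp: S_def ideal_type_algebra_iff)
      show "x + y \<in> \<Union>C" if xy: "x \<in> \<Union>C" "y \<in> \<Union>C" for x y
      proof -
        obtain U V where UV: "U \<in> C" "V \<in> C" "x \<in> U" "y \<in> V" using xy by blast
        obtain W where "W \<in> C" "x \<in> W" "y \<in> W" using tot[OF UV(1,2)] UV by blast
        moreover from this have "x + y \<in> W"
          using CS unfolding S_def ideal_type_algebra_iff by blast
        ultimately show ?thesis by blast
      qed
    qed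
    then show "\<Union>C \<in> S" using C CS by (auto simp: S_def)
  qed
  then obtain M where M: "M \<in> S" and max: "\<And>U. U \<in> S \<Longrightarrow> M \<subseteq> U \<Longrightarrow> U = M" by blast
  have "maximalideal M ?R"
  proof (rule maximalidealI)
    show "ideal M ?R" using M by (simp add: S_def)
    show "carrier ?R \<noteq> M" using M by (auto simp: S_def ring_of_type_algebra_def)
    fix J assume J: "ideal J ?R" "M \<subseteq> J" "J \<subseteq> carrier ?R"
    show "J = M \<or> J = carrier ?R"
    proof (cases "1 \<in> J")
      case True
      then have "x \<in> J" for x
        using J(1) unfolding ideal_type_algebra_iff by (metis mult_1_right)
      then show ?thesis by (auto simp: ring_of_type_algebra_def)
    next
      case False
      then show ?thesis using max[of J] J M by (auto simp: S_def)
    qed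
  qed
  then show ?thesis using that M by (simp add: S_def)
qed

text \<open>The only maximal ideal is exactly the set of non-units. It is in this elementary form
  that locality is applied to coordinates.\<close>

lemma local_ring_units:
  assumes "local_ring TYPE('a::comm_ring_1)"
  shows "\<not> (0::'a) dvd 1" "\<forall>x y :: 'a. x + y dvd 1 \<longrightarrow> x dvd 1 \<or> y dvd 1"
proof -
  let ?R = "ring_of_type_algebra :: 'a ring"
  obtain M where M: "maximalideal M ?R" and unique: "\<And>M'. maximalideal M' ?R \<Longrightarrow> M' = M"
    using assms by (auto simp: local_ring_def)
  have add: "x + y \<in> M" if "x \<in> M" "y \<in> M" for x y
    using M that unfolding maximalideal_def ideal_type_algebra_iff by blast
  have id: "ideal M ?R" and ne: "carrier ?R \<noteq> M"
    using M by (simp_all add: maximalideal_def maximalideal_axioms_def)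
  have unit: "\<not> x dvd 1" if "x \<in> M" for x
  proof
    assume "x dvd 1"
    then obtain y where "1 = x * y" by (auto simp: dvd_def)
    then have "z = (z * y) * x" for z by (metis mult.assoc mult.commute mult_1)
    then have "z \<in> M" for z using id that unfolding ideal_type_algebra_iff by metis
    then show False using ne by (auto simp: ring_of_type_algebra_def)
  qed
  have nonunit: "x \<in> M" if "\<not> x dvd 1" for x
    using nonunit_in_maximalideal[OF that] unique by metis
  show "\<not> (0::'a) dvd 1" using unit id by (simp add: ideal_type_algebra_iff)
  show "\<forall>x y :: 'a. x + y dvd 1 \<longrightarrow> x dvd 1 \<or> y dvd 1"
    using unit nonunit add by blast
qed

lemma dvd_1_mult_iff: "a * b dvd 1 \<longleftrightarrow> a dvd 1 \<and> b dvd 1" for a b :: "'a::comm_ring_1"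
  using mult_dvd_mono[of a 1 b 1] by (auto dest: dvd_mult_left dvd_mult_right)

section \<open>Normalising the images of the highest and lowest root vectors\<close>

context
  assumes units: "(2::'a::comm_ring_1) dvd 1" "(3::'a) dvd 1"
    and nontrivial: "\<not> (0::'a) dvd 1"
    and local: "\<forall>x y :: 'a. x + y dvd 1 \<longrightarrow> x dvd 1 \<or> y dvd 1"
begin

text \<open>Suppose the conclusion fails and consider the \<open>v\<close> whose translates all have
  a non-unit Killing product with \<open>f\<close>. By locality they form a stable submodule. It
  contains \<open>E N32\<close>, because pairing with \<open>E N32\<close> is 8 times the
  \<open>P32\<close>-coordinate, so it is everything, contradicting the choice of
  \<open>f'\<close>.\<close>

lemma elementary_unit_coord:
  fixes f f' :: "'a g2_vec"
  assumes "killing f f' dvd 1"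
  obtains g where "g \<in> elementary" "(g *v f)\<langle>P32\<rangle> dvd 1"
proof (rule ccontr)
  assume "\<not> thesis"
  with that have non: "\<And>g. g \<in> elementary \<Longrightarrow> \<not> (g *v f)\<langle>P32\<rangle> dvd 1"
    by blast
  define W where "W = {v. \<forall>g\<in>elementary. \<not> killing f (g *v v) dvd 1}"
  have add: "killing f (u + v) = killing f u + killing f v"
    and scale: "killing f (c *s u) = c * killing f u" for u v c
    by (simp_all add: killing_eq algebra_simps)
  have "f' \<in> W"
  proof (rule stable_submod_UNIV[OF units])
    have "killing f 0 = 0" by (simp add: killing_eq)
    then show "submod W"
      using nontrivial
      by (auto simp: submod_def W_def matrix_vector_right_distrib matrix_vector_scale add scale
          dvd_1_mult_iff dest!: local[rule_format])
    have "\<not> killing f (g *v E N32) dvd 1" if g: "g \<in> elementary" for g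
    proof -
      obtain h where h: "h \<in> elementary" "g ** h = mat 1" "h ** g = mat 1"
        using elementary_inverse[OF g] by blast
      have "killing f (g *v E N32) = killing (h *v f) (h *v (g *v E N32))"
        by (simp add: killing_automorphism[OF elementary_automorphism[OF h(1)]])
      also have "\<dots> = (h *v f)\<langle>P32\<rangle> * 8"
        by (simp add: matrix_vector_mul_assoc h) (simp add: killing_eq)
      finally show ?thesis
        using non[OF h(1)] by (simp add: dvd_1_mult_iff)
    qed
    then show "E P32 \<in> W \<or> E N32 \<in> W" by (simp add: W_def)
    show "g *v u \<in> W" if "g \<in> elementary" "u \<in> W" for g u
      using that by (simp add: W_def matrix_vector_mul_assoc elementary_mult)
  qed
  then have "\<not> killing f (mat 1 *v f') dvd 1"
    using elementary_one unfolding W_def by blast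
  then show False using assms by simp
qed

lemma unit_cancel: "c dvd 1 \<Longrightarrow> c * x = 0 \<Longrightarrow> x = 0" for c x :: 'a
  by (metis dvdE mult.assoc mult.commute mult_1 mult_zero_right)

text \<open>Grade L by the coroot h of theta = \<open>P32\<close>, and let c be the
  \<open>P32\<close>-coordinate of f. The zeros remove degree 1 and give [f, e_-theta] = c h, so the
  second bracket multiplies the component of degree d by -c d. Comparison with k f yields k = -2 c
  and shows that 2 c, 3 c, 4 c annihilate the components of degree 0, -1, -2; all three are
  units.\<close>

lemma extremal_top:
  fixes f :: "'a g2_vec"
  assumes c: "f\<langle>P32\<rangle> dvd 1"
    and zeros: "f\<langle>H2\<rangle> = 0" "f\<langle>P01\<rangle> = 0" "f\<langle>P11\<rangle> = 0" "f\<langle>P21\<rangle> = 0" "f\<langle>P31\<rangle> = 0"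
    and k: "br f (br f (E N32)) = k *s f"
  shows "f = f\<langle>P32\<rangle> *s E P32"
proof -
  have eq: "bracket_coord i f (br f (E N32)) = k * f\<langle>i\<rangle>" for i
    using arg_cong[OF k, of "\<lambda>w. w\<langle>i\<rangle>"] by simp
  have k: "k = - 2 * f\<langle>P32\<rangle>"
  proof -
    have "k * f\<langle>P32\<rangle> = - (2 * (f\<langle>P32\<rangle> * f\<langle>P32\<rangle>))"
      using eq[of P32, symmetric] zeros by (simp add: algebra_simps)
    then have "f\<langle>P32\<rangle> * (k + 2 * f\<langle>P32\<rangle>) = 0"
      by (simp add: algebra_simps)
    then show ?thesis using unit_cancel[OF c] by (simp add: eq_neg_iff_add_eq_0)
  qed
  have u: "2 * f\<langle>P32\<rangle> dvd 1" "3 * f\<langle>P32\<rangle> dvd 1" "4 * f\<langle>P32\<rangle> dvd 1"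
    using c units dvd_1_mult_iff[of 2 "2::'a"] by (simp_all add: dvd_1_mult_iff)
  have H1: "f\<langle>H1\<rangle> = 0"
    by (rule unit_cancel[OF u(1)]) (use eq[of H1] zeros k in \<open>simp add: algebra_simps\<close>)
  have P10: "f\<langle>P10\<rangle> = 0"
    by (rule unit_cancel[OF u(1)]) (use eq[of P10] zeros k in \<open>simp add: algebra_simps\<close>)
  have N10: "f\<langle>N10\<rangle> = 0"
    by (rule unit_cancel[OF u(1)]) (use eq[of N10] zeros k in \<open>simp add: algebra_simps\<close>)
  note zeros = zeros H1 P10 N10
  have N01: "f\<langle>N01\<rangle> = 0"
    by (rule unit_cancel[OF u(2)]) (use eq[of N01] zeros k in \<open>simp add: algebra_simps\<close>)
  have N11: "f\<langle>N11\<rangle> = 0"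
    by (rule unit_cancel[OF u(2)]) (use eq[of N11] zeros k in \<open>simp add: algebra_simps\<close>)
  have N21: "f\<langle>N21\<rangle> = 0"
    by (rule unit_cancel[OF u(2)]) (use eq[of N21] zeros k in \<open>simp add: algebra_simps\<close>)
  have N31: "f\<langle>N31\<rangle> = 0"
    by (rule unit_cancel[OF u(2)]) (use eq[of N31] zeros k in \<open>simp add: algebra_simps\<close>)
  note zeros = zeros N01 N11 N21 N31
  have "f\<langle>N32\<rangle> = 0"
    by (rule unit_cancel[OF u(3)]) (use eq[of N32] zeros k in \<open>simp add: algebra_simps\<close>)
  then show ?thesis using zeros
    unfolding vec_eq_idx all_index by simp
qed


text \<open>The comparison of \<open>extremal_top\<close> with the grading reversed.\<close>

lemma extremal_bottom:
  fixes f :: "'a g2_vec"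
  assumes c: "f\<langle>N32\<rangle> dvd 1"
    and zeros: "f\<langle>H2\<rangle> = 0" "f\<langle>N01\<rangle> = 0" "f\<langle>N11\<rangle> = 0" "f\<langle>N21\<rangle> = 0" "f\<langle>N31\<rangle> = 0"
    and k: "br f (br f (E P32)) = k *s f"
  shows "f = f\<langle>N32\<rangle> *s E N32"
proof -
  have eq: "bracket_coord i f (br f (E P32)) = k * f\<langle>i\<rangle>" for i
    using arg_cong[OF k, of "\<lambda>w. w\<langle>i\<rangle>"] by simp
  have k: "k = - 2 * f\<langle>N32\<rangle>"
  proof -
    have "k * f\<langle>N32\<rangle> = - (2 * (f\<langle>N32\<rangle> * f\<langle>N32\<rangle>))"
      using eq[of N32, symmetric] zeros by (simp add: algebra_simps)
    then have "f\<langle>N32\<rangle> * (k + 2 * f\<langle>N32\<rangle>) = 0"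
      by (simp add: algebra_simps)
    then show ?thesis using unit_cancel[OF c] by (simp add: eq_neg_iff_add_eq_0)
  qed
  have u: "2 * f\<langle>N32\<rangle> dvd 1" "3 * f\<langle>N32\<rangle> dvd 1" "4 * f\<langle>N32\<rangle> dvd 1"
    using c units dvd_1_mult_iff[of 2 "2::'a"] by (simp_all add: dvd_1_mult_iff)
  have H1: "f\<langle>H1\<rangle> = 0"
    by (rule unit_cancel[OF u(1)]) (use eq[of H1] zeros k in \<open>simp add: algebra_simps\<close>)
  have P10: "f\<langle>P10\<rangle> = 0"
    by (rule unit_cancel[OF u(1)]) (use eq[of P10] zeros k in \<open>simp add: algebra_simps\<close>)
  have N10: "f\<langle>N10\<rangle> = 0"
    by (rule unit_cancel[OF u(1)]) (use eq[of N10] zeros k in \<open>simp add: algebra_simps\<close>)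
  note zeros = zeros H1 P10 N10
  have P01: "f\<langle>P01\<rangle> = 0"
    by (rule unit_cancel[OF u(2)]) (use eq[of P01] zeros k in \<open>simp add: algebra_simps\<close>)
  have P11: "f\<langle>P11\<rangle> = 0"
    by (rule unit_cancel[OF u(2)]) (use eq[of P11] zeros k in \<open>simp add: algebra_simps\<close>)
  have P21: "f\<langle>P21\<rangle> = 0"
    by (rule unit_cancel[OF u(2)]) (use eq[of P21] zeros k in \<open>simp add: algebra_simps\<close>)
  have P31: "f\<langle>P31\<rangle> = 0"
    by (rule unit_cancel[OF u(2)]) (use eq[of P31] zeros k in \<open>simp add: algebra_simps\<close>)
  note zeros = zeros P01 P11 P21 P31
  have "f\<langle>P32\<rangle> = 0"
    by (rule unit_cancel[OF u(3)]) (use eq[of P32] zeros k in \<open>simp add: algebra_simps\<close>)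
  then show ?thesis using zeros
    unfolding vec_eq_idx all_index by simp
qed

text \<open>A root element of degree -1 changes the part of degree 1 only through the top component,
  in a single coordinate, so the four corrections do not interfere. One of degree -2 does not affect
  degree 1 and can then adjust \<open>H2\<close>.\<close>

lemma clear_below_top:
  fixes f :: "'a g2_vec"
  assumes "f\<langle>P32\<rangle> dvd 1"
  obtains g where "g \<in> elementary" "g *v E N32 = E N32" "(g *v f)\<langle>P32\<rangle> = f\<langle>P32\<rangle>"
    "(g *v f)\<langle>H2\<rangle> = 0" "(g *v f)\<langle>P01\<rangle> = 0" "(g *v f)\<langle>P11\<rangle> = 0" "(g *v f)\<langle>P21\<rangle> = 0"
    "(g *v f)\<langle>P31\<rangle> = 0"
proof -
  obtain d where d: "1 = f\<langle>P32\<rangle> * d" using assms by (auto simp: dvd_def)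
  obtain b :: 'a where b: "1 = 2 * b" using units by (auto simp: dvd_def)
  define g1 :: "'a g2_mat" where "g1 = root_mat N31 (f\<langle>P01\<rangle> * d) ** root_mat N21 (- f\<langle>P11\<rangle> * d)
    ** root_mat N11 (f\<langle>P21\<rangle> * d) ** root_mat N01 (- f\<langle>P31\<rangle> * d)"
  \<comment> \<open>The bracket of \<open>E N32\<close> with \<open>E P32\<close> has
    \<open>H2\<close>-coordinate -2, hence the factor \<open>b\<close>, which is 1/2.\<close>
  define g where "g = root_mat N32 ((g1 *v f)\<langle>H2\<rangle> * d * b) ** g1"
  have g1: "(g1 *v f)\<langle>P32\<rangle> = f\<langle>P32\<rangle>" "(g1 *v f)\<langle>P01\<rangle> = 0" "(g1 *v f)\<langle>P11\<rangle> = 0"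
    "(g1 *v f)\<langle>P21\<rangle> = 0" "(g1 *v f)\<langle>P31\<rangle> = 0" "g1 *v E N32 = E N32"
  proof -
    have fd: "f\<langle>P32\<rangle> * d = 1" and df: "d * f\<langle>P32\<rangle> = 1"
      using d by (simp_all add: mult.commute)
    have *: "d * (x * f\<langle>P32\<rangle>) = x" for x
    proof -
      have "d * (x * f\<langle>P32\<rangle>) = x * (f\<langle>P32\<rangle> * d)" by (simp only: mult_ac)
      then show ?thesis by (simp add: fd)
    qed
    show "(g1 *v f)\<langle>P32\<rangle> = f\<langle>P32\<rangle>" "(g1 *v f)\<langle>P01\<rangle> = 0" "(g1 *v f)\<langle>P11\<rangle> = 0"
      "(g1 *v f)\<langle>P21\<rangle> = 0" "(g1 *v f)\<langle>P31\<rangle> = 0"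
      by (simp_all add: g1_def fd df * algebra_simps flip: matrix_vector_mul_assoc)
    have "root_exp r t (E N32) = E N32" if "r \<in> {N31, N21, N11, N01}" for r and t :: 'a
      using that unfolding vec_eq_idx all_index by auto
    then show "g1 *v E N32 = E N32"
      by (simp add: g1_def flip: matrix_vector_mul_assoc)
  qed
  have "(g *v f)\<langle>H2\<rangle> = (g1 *v f)\<langle>H2\<rangle> - (g1 *v f)\<langle>H2\<rangle> * (f\<langle>P32\<rangle> * d) * (2 * b)"
    by (simp add: g_def g1 algebra_simps flip: matrix_vector_mul_assoc)
  then have "(g *v f)\<langle>H2\<rangle> = 0" by (simp flip: d b)
  moreover have "root_exp N32 t (E N32) = E N32" for t :: 'a
    unfolding vec_eq_idx all_index by simp
  then have "g *v E N32 = E N32"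
    by (simp add: g_def g1 flip: matrix_vector_mul_assoc)
  moreover have "g \<in> elementary"
    unfolding g_def g1_def by (intro elementary_mult elementary_root) simp_all
  ultimately show ?thesis
    using g1 by (intro that[of g]) (simp_all add: g_def flip: matrix_vector_mul_assoc)
qed

text \<open>The mirror image of \<open>clear_below_top\<close>. The raising elements fix
  \<open>E P32\<close>, so this stage does not disturb an image already brought into the line of
  \<open>E P32\<close>.\<close>

lemma clear_above_bottom:
  fixes f :: "'a g2_vec"
  assumes "f\<langle>N32\<rangle> dvd 1"
  obtains g where "g \<in> elementary" "g *v E P32 = E P32" "(g *v f)\<langle>N32\<rangle> = f\<langle>N32\<rangle>"
    "(g *v f)\<langle>H2\<rangle> = 0" "(g *v f)\<langle>N01\<rangle> = 0" "(g *v f)\<langle>N11\<rangle> = 0" "(g *v f)\<langle>N21\<rangle> = 0"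
    "(g *v f)\<langle>N31\<rangle> = 0"
proof -
  obtain d where d: "1 = f\<langle>N32\<rangle> * d" using assms by (auto simp: dvd_def)
  obtain b :: 'a where b: "1 = 2 * b" using units by (auto simp: dvd_def)
  define g1 :: "'a g2_mat" where "g1 = root_mat P31 (- f\<langle>N01\<rangle> * d) ** root_mat P21 (f\<langle>N11\<rangle> * d)
    ** root_mat P11 (- f\<langle>N21\<rangle> * d) ** root_mat P01 (f\<langle>N31\<rangle> * d)"
  define g where "g = root_mat P32 (- (g1 *v f)\<langle>H2\<rangle> * d * b) ** g1"
  have g1: "(g1 *v f)\<langle>N32\<rangle> = f\<langle>N32\<rangle>" "(g1 *v f)\<langle>N01\<rangle> = 0" "(g1 *v f)\<langle>N11\<rangle> = 0"
    "(g1 *v f)\<langle>N21\<rangle> = 0" "(g1 *v f)\<langle>N31\<rangle> = 0" "g1 *v E P32 = E P32"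
  proof -
    have fd: "f\<langle>N32\<rangle> * d = 1" and df: "d * f\<langle>N32\<rangle> = 1"
      using d by (simp_all add: mult.commute)
    have *: "d * (x * f\<langle>N32\<rangle>) = x" for x
    proof -
      have "d * (x * f\<langle>N32\<rangle>) = x * (f\<langle>N32\<rangle> * d)" by (simp only: mult_ac)
      then show ?thesis by (simp add: fd)
    qed
    show "(g1 *v f)\<langle>N32\<rangle> = f\<langle>N32\<rangle>" "(g1 *v f)\<langle>N01\<rangle> = 0" "(g1 *v f)\<langle>N11\<rangle> = 0"
      "(g1 *v f)\<langle>N21\<rangle> = 0" "(g1 *v f)\<langle>N31\<rangle> = 0"
      by (simp_all add: g1_def fd df * algebra_simps flip: matrix_vector_mul_assoc)
    have "root_exp r t (E P32) = E P32" if "r \<in> {P31, P21, P11, P01}" for r and t :: 'a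
      using that unfolding vec_eq_idx all_index by auto
    then show "g1 *v E P32 = E P32"
      by (simp add: g1_def flip: matrix_vector_mul_assoc)
  qed
  have "(g *v f)\<langle>H2\<rangle> = (g1 *v f)\<langle>H2\<rangle> - (g1 *v f)\<langle>H2\<rangle> * (f\<langle>N32\<rangle> * d) * (2 * b)"
    by (simp add: g_def g1 algebra_simps flip: matrix_vector_mul_assoc)
  then have "(g *v f)\<langle>H2\<rangle> = 0" by (simp flip: d b)
  moreover have "root_exp P32 t (E P32) = E P32" for t :: 'a
    unfolding vec_eq_idx all_index by simp
  then have "g *v E P32 = E P32"
    by (simp add: g_def g1 flip: matrix_vector_mul_assoc)
  moreover have "g \<in> elementary"
    unfolding g_def g1_def by (intro elementary_mult elementary_root) simp_all
  ultimately show ?thesis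
    using g1 by (intro that[of g]) (simp_all add: g_def flip: matrix_vector_mul_assoc)
qed

lemma is_unit_8: "(8::'a) dvd 1" and is_unit_24: "(24::'a) dvd 1" and is_unit_48: "(48::'a) dvd 1"
proof -
  have "(2 * (2 * 2)::'a) dvd 1" "(3 * (2 * (2 * 2))::'a) dvd 1" "(2 * (3 * (2 * (2 * 2)))::'a) dvd 1"
    unfolding dvd_1_mult_iff using units by simp_all
  then show "(8::'a) dvd 1" "(24::'a) dvd 1" "(48::'a) dvd 1" by simp_all
qed

lemma unit_cancel_eq: "c dvd 1 \<Longrightarrow> c * x = c * y \<Longrightarrow> x = y" for c x y :: 'a
  using unit_cancel[of c "x - y"] by (simp add: algebra_simps)

text \<open>The square of ad e maps L into the line of e when e is the highest or lowest root
  vector; automorphisms transport this property.\<close>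

lemma automorphism_extremal:
  fixes A :: "'a g2_mat"
  assumes "automorphism A"
  obtains k k' where "br (A *v E P32) (br (A *v E P32) y) = k *s (A *v E P32)"
    "br (A *v E N32) (br (A *v E N32) y) = k' *s (A *v E N32)"
proof -
  obtain B where B: "A ** B = mat 1"
    using assms by (auto simp: automorphism_def invertible_def)
  define z where "z = B *v y"
  have y: "y = A *v z" by (simp add: z_def matrix_vector_mul_assoc B)
  have AE: "br (A *v u) (br (A *v u) y) = A *v br u (br u z)" for u
    using assms by (simp add: y automorphism_def)
  have z: "br (E P32) (br (E P32) z) = (- 2 * z\<langle>N32\<rangle>) *s E P32"
    "br (E N32) (br (E N32) z) = (- 2 * z\<langle>P32\<rangle>) *s E N32"
    unfolding vec_eq_idx all_index by simp_all
  show ?thesis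
    by (rule that; unfold AE z) (rule matrix_vector_scale)+
qed

lemma normalize_long:
  fixes A :: "'a g2_mat"
  assumes A: "automorphism A"
  obtains g c c' where "g \<in> elementary" "c * c' = 1"
    "(g ** A) *v E P32 = c *s E P32" "(g ** A) *v E N32 = c' *s E N32"
proof -
  have "killing (A *v E P32) (A *v E N32) dvd 1"
    using is_unit_8 by (simp add: killing_automorphism[OF A]) (simp add: killing_eq)
  then obtain g where g: "g \<in> elementary" "(g *v (A *v E P32))\<langle>P32\<rangle> dvd 1"
    by (rule elementary_unit_coord)
  obtain h where h: "h \<in> elementary" "(h *v (g *v (A *v E P32)))\<langle>P32\<rangle> = (g *v (A *v E P32))\<langle>P32\<rangle>"
    "(h *v (g *v (A *v E P32)))\<langle>H2\<rangle> = 0" "(h *v (g *v (A *v E P32)))\<langle>P01\<rangle> = 0"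
    "(h *v (g *v (A *v E P32)))\<langle>P11\<rangle> = 0" "(h *v (g *v (A *v E P32)))\<langle>P21\<rangle> = 0"
    "(h *v (g *v (A *v E P32)))\<langle>P31\<rangle> = 0"
    using clear_below_top[OF g(2)] by metis
  define B where "B = (h ** g) ** A"
  have hg: "h ** g \<in> elementary" using h(1) g(1) by (rule elementary_mult)
  have B: "automorphism B" 
    unfolding B_def by (intro automorphism_mult elementary_automorphism hg A)
  define c where "c = (B *v E P32)\<langle>P32\<rangle>"
  have BP: "B *v E P32 = h *v (g *v (A *v E P32))"
    by (simp add: B_def flip: matrix_vector_mul_assoc)
  have c: "c dvd 1" using g h by (simp add: c_def BP)
  obtain k where "br (B *v E P32) (br (B *v E P32) (E N32)) = k *s (B *v E P32)"
    using automorphism_extremal[OF B] by metis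
  then have P32: "B *v E P32 = c *s E P32"
    using c h unfolding c_def by (intro extremal_top) (simp_all add: BP)
  \<comment> \<open>Invariance of the Killing form forces the \<open>N32\<close>-coordinate of the
    second image to be the inverse of \<open>c\<close>, so its unit coordinate comes for
    free.\<close>
  have "killing (B *v E P32) (B *v E N32) = 8"
    by (simp add: killing_automorphism[OF B]) (simp add: killing_eq)
  then have "8 * (c * (B *v E N32)\<langle>N32\<rangle>) = 8 * 1"
    unfolding P32 by (simp add: killing_eq)
  then have cc: "c * (B *v E N32)\<langle>N32\<rangle> = 1" by (rule unit_cancel_eq[OF is_unit_8])
  then have "(B *v E N32)\<langle>N32\<rangle> dvd 1" by (metis dvd_triv_right)
  then obtain m where m: "m \<in> elementary" "m *v E P32 = E P32"
    "(m *v (B *v E N32))\<langle>N32\<rangle> = (B *v E N32)\<langle>N32\<rangle>"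
    "(m *v (B *v E N32))\<langle>H2\<rangle> = 0" "(m *v (B *v E N32))\<langle>N01\<rangle> = 0"
    "(m *v (B *v E N32))\<langle>N11\<rangle> = 0" "(m *v (B *v E N32))\<langle>N21\<rangle> = 0"
    "(m *v (B *v E N32))\<langle>N31\<rangle> = 0"
    using clear_above_bottom by metis
  have C: "automorphism (m ** B)"
    by (intro automorphism_mult elementary_automorphism m B)
  have CN: "(m ** B) *v E N32 = m *v (B *v E N32)"
    by (simp flip: matrix_vector_mul_assoc)
  obtain k where "br ((m ** B) *v E N32) (br ((m ** B) *v E N32) (E P32)) = k *s ((m ** B) *v E N32)"
    using automorphism_extremal[OF C] by metis
  then have "(m ** B) *v E N32 = (B *v E N32)\<langle>N32\<rangle> *s E N32"
    using m cc unfolding CN m(3)[symmetric] by (intro extremal_bottom) (simp_all, metis dvd_triv_right)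
  moreover have "(m ** B) *v E P32 = c *s E P32"
    by (simp add: P32 matrix_vector_scale m flip: matrix_vector_mul_assoc)
  ultimately show ?thesis
    using that[of "m ** (h ** g)" c "(B *v E N32)\<langle>N32\<rangle>"] cc elementary_mult[OF m(1) hg]
    by (simp add: B_def matrix_mul_assoc)
qed

section \<open>The copy of sl_2 centralizing the long root vectors\<close>

definition in_levi :: "'a g2_vec \<Rightarrow> bool" where
  "in_levi f \<longleftrightarrow> (\<forall>i. i \<notin> {H1, P10, N10} \<longrightarrow> f\<langle>i\<rangle> = 0)"

text \<open>Bracketing with \<open>E P32\<close> detects the \<open>H2\<close>-coordinate and those
  of degree -1 and -2 for the coroot of theta; bracketing with \<open>E N32\<close> detects degree 1
  and 2. There remain \<open>H1\<close> and the roots +-a orthogonal to theta.\<close>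

lemma levi_centralizes:
  assumes "br (E P32) f = 0" "br (E N32) f = 0"
  shows "in_levi f"
proof -
  have "bracket_coord i (E P32) f = 0" "bracket_coord i (E N32) f = 0" for i
    using arg_cong[OF assms(1), of "\<lambda>w. w\<langle>i\<rangle>"] arg_cong[OF assms(2), of "\<lambda>w. w\<langle>i\<rangle>"] by simp_all
  note eq = this(1)[of P31] this(1)[of P21] this(1)[of P11] this(1)[of P01] this(1)[of P32]
    this(2)[of N31] this(2)[of N21] this(2)[of N11] this(2)[of N01] this(1)[of H1] this(2)[of H1]
  have "f\<langle>i\<rangle> = 0" if "i \<notin> {H1, P10, N10}" for i
    using that eq by (cases i) simp_all
  then show ?thesis by (simp add: in_levi_def)
qed

lemma levi_killing:
  "in_levi f \<Longrightarrow> in_levi f' \<Longrightarrow>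
    killing f f' = 48 * f\<langle>H1\<rangle> * f'\<langle>H1\<rangle> + 24 * (f\<langle>P10\<rangle> * f'\<langle>N10\<rangle> + f\<langle>N10\<rangle> * f'\<langle>P10\<rangle>)"
  by (simp add: killing_eq in_levi_def)

lemma levi_root_exp:
  assumes "in_levi f"
  shows "(root_exp P10 t f)\<langle>H1\<rangle> = f\<langle>H1\<rangle> + t * f\<langle>N10\<rangle>"
    "(root_exp P10 t f)\<langle>P10\<rangle> = f\<langle>P10\<rangle> - 2 * t * f\<langle>H1\<rangle> - t^2 * f\<langle>N10\<rangle>"
    "(root_exp P10 t f)\<langle>N10\<rangle> = f\<langle>N10\<rangle>"
    "(root_exp N10 t f)\<langle>H1\<rangle> = f\<langle>H1\<rangle> - t * f\<langle>P10\<rangle>"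
    "(root_exp N10 t f)\<langle>P10\<rangle> = f\<langle>P10\<rangle>"
  using assms by (simp_all add: in_levi_def)

definition preserves_long :: "'a g2_mat \<Rightarrow> bool" where
  "preserves_long A \<longleftrightarrow> automorphism A \<and>
    (\<exists>c c'. c * c' = 1 \<and> A *v E P32 = c *s E P32 \<and> A *v E N32 = c' *s E N32)"

lemma preserves_long_levi:
  assumes "preserves_long A"
  shows "in_levi (A *v E P10)" "in_levi (A *v E N10)"
proof -
  obtain c c' where c: "c * c' = 1" "A *v E P32 = c *s E P32" "A *v E N32 = c' *s E N32"
    and A: "automorphism A"
    using assms by (auto simp: preserves_long_def)
  have "in_levi (A *v u)" if u: "br (E P32) u = 0" "br (E N32) u = 0" for u
  proof (rule levi_centralizes)
    have 1: "br (A *v E P32) (A *v u) = 0" "br (A *v E N32) (A *v u) = 0"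
      using A u unfolding automorphism_def by (metis matrix_vector_mult_0_right)+
    have "br (E P32) (A *v u) = c' *s br (A *v E P32) (A *v u)"
      using c by (simp add: br_scale_left mult.commute)
    then show "br (E P32) (A *v u) = 0" by (simp add: 1)
    have "br (E N32) (A *v u) = c *s br (A *v E N32) (A *v u)"
      using c by (simp add: br_scale_left)
    then show "br (E N32) (A *v u) = 0" by (simp add: 1)
  qed
  moreover have "br (E P32) (E P10) = (0 :: 'a g2_vec)" "br (E N32) (E P10) = (0 :: 'a g2_vec)"
    "br (E P32) (E N10) = (0 :: 'a g2_vec)" "br (E N32) (E N10) = (0 :: 'a g2_vec)"
    unfolding vec_eq_idx all_index by simp_all
  ultimately show "in_levi (A *v E P10)" "in_levi (A *v E N10)" by blast+
qed

lemma preserves_long_killing: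
  assumes "preserves_long A"
  shows "killing (A *v u) (A *v v) = killing u v"
  using assms by (simp add: preserves_long_def killing_automorphism)

lemma preserves_long_root:
  assumes "preserves_long A" "r \<in> {P10, N10}"
  shows "preserves_long (root_mat r t ** A)"
proof -
  have "root_exp r t (E P32) = E P32" "root_exp r t (E N32) = E N32"
    using assms(2) unfolding vec_eq_idx all_index by auto
  moreover obtain c c' where c: "c * c' = 1" "A *v E P32 = c *s E P32" "A *v E N32 = c' *s E N32"
    using assms by (auto simp: preserves_long_def)
  ultimately have "(root_mat r t ** A) *v E P32 = c *s E P32" "(root_mat r t ** A) *v E N32 = c' *s E N32"
    by (simp_all add: root_exp_scale flip: matrix_vector_mul_assoc)
  moreover have "automorphism (root_mat r t ** A)"
    using assms by (intro automorphism_mult root_mat_automorphism) (auto simp: preserves_long_def)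
  ultimately show ?thesis
    using c(1) unfolding preserves_long_def by blast
qed

lemma normalize_short:
  fixes A :: "'a g2_mat"
  assumes A: "preserves_long A"
  obtains g v v' where "g \<in> elementary" "v * v' = 1" "preserves_long (g ** A)"
    "(g ** A) *v E P10 = v *s E P10" "(g ** A) *v E N10 = v' *s E N10"
proof -
  \<comment> \<open>In this sl_2 the Killing norm is -48 times the determinant of [[h, p], [n, -h]],
    with h, p, n the coordinates at \<open>H1\<close>, \<open>P10\<close>, \<open>N10\<close>. Its
    vanishing takes over the role of extremality.\<close>
  have isotropic: "f\<langle>H1\<rangle> * f\<langle>H1\<rangle> + f\<langle>P10\<rangle> * f\<langle>N10\<rangle> = 0"
    if "killing f f = 0" "in_levi f" for f :: "'a g2_vec"
  proof (rule unit_cancel[OF is_unit_48])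
    show "48 * (f\<langle>H1\<rangle> * f\<langle>H1\<rangle> + f\<langle>P10\<rangle> * f\<langle>N10\<rangle>) = 0"
      using that by (simp add: levi_killing algebra_simps)
  qed
  have iso: "(B *v E P10)\<langle>H1\<rangle> * (B *v E P10)\<langle>H1\<rangle> + (B *v E P10)\<langle>P10\<rangle> * (B *v E P10)\<langle>N10\<rangle> = 0"
    "(B *v E N10)\<langle>H1\<rangle> * (B *v E N10)\<langle>H1\<rangle> + (B *v E N10)\<langle>P10\<rangle> * (B *v E N10)\<langle>N10\<rangle> = 0"
    if "preserves_long B" for B
    using that
    by (auto intro!: isotropic preserves_long_levi simp: preserves_long_killing) (simp_all add: killing_eq)
  have dual: "2 * (B *v E P10)\<langle>H1\<rangle> * (B *v E N10)\<langle>H1\<rangle> + (B *v E P10)\<langle>P10\<rangle> * (B *v E N10)\<langle>N10\<rangle>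
      + (B *v E P10)\<langle>N10\<rangle> * (B *v E N10)\<langle>P10\<rangle> = 1" if B: "preserves_long B" for B
  proof (rule unit_cancel_eq[OF is_unit_24])
    have "killing (B *v E P10) (B *v E N10) = 24"
      unfolding preserves_long_killing[OF B] by (simp add: killing_eq)
    then show "24 * (2 * (B *v E P10)\<langle>H1\<rangle> * (B *v E N10)\<langle>H1\<rangle> + (B *v E P10)\<langle>P10\<rangle> * (B *v E N10)\<langle>N10\<rangle>
      + (B *v E P10)\<langle>N10\<rangle> * (B *v E N10)\<langle>P10\<rangle>) = 24 * 1"
      using preserves_long_levi[OF B] by (simp add: levi_killing algebra_simps)
  qed

  obtain g where g: "g \<in> elementary" "preserves_long (g ** A)" "((g ** A) *v E P10)\<langle>P10\<rangle> dvd 1"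
  proof (cases "(A *v E P10)\<langle>P10\<rangle> dvd 1")
    case True
    then show ?thesis using that[of "mat 1"] elementary_one A by simp
  next
    case v: False
    define f where "f = A *v E P10"
    \<comment> \<open>If p is not a unit, isotropy h^2 = -p n makes h a non-unit too. Pairing with
      the image of \<open>E N10\<close> then leaves n as the only source of a unit.\<close>
    have "\<not> f\<langle>H1\<rangle> * f\<langle>H1\<rangle> dvd 1"
    proof
      assume "f\<langle>H1\<rangle> * f\<langle>H1\<rangle> dvd 1"
      moreover have "f\<langle>H1\<rangle> * f\<langle>H1\<rangle> = - (f\<langle>P10\<rangle> * f\<langle>N10\<rangle>)"
        using iso(1)[OF A] by (simp add: f_def eq_neg_iff_add_eq_0)
      ultimately have "f\<langle>P10\<rangle> * f\<langle>N10\<rangle> dvd 1" by (metis minus_dvd_iff)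
      then show False using v by (simp add: f_def dvd_1_mult_iff)
    qed
    then have u: "\<not> f\<langle>H1\<rangle> dvd 1" by (simp add: dvd_1_mult_iff)
    have w: "f\<langle>N10\<rangle> dvd 1"
    proof -
      have "2 * f\<langle>H1\<rangle> * (A *v E N10)\<langle>H1\<rangle> + f\<langle>P10\<rangle> * (A *v E N10)\<langle>N10\<rangle> + f\<langle>N10\<rangle> * (A *v E N10)\<langle>P10\<rangle> dvd 1"
        using dual[OF A] by (simp add: f_def)
      then show ?thesis
        using v u by (auto simp: f_def dvd_1_mult_iff dest!: local[rule_format])
    qed
    \<comment> \<open>This is the new \<open>P10\<close>-coordinate after the root element with
      parameter 1; among its three terms only the last is a unit.\<close>
    have "f\<langle>P10\<rangle> - 2 * f\<langle>H1\<rangle> - f\<langle>N10\<rangle> dvd 1"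
    proof (rule ccontr)
      assume non: "\<not> ?thesis"
      have "f\<langle>N10\<rangle> = - (f\<langle>P10\<rangle> - 2 * f\<langle>H1\<rangle> - f\<langle>N10\<rangle>) + (f\<langle>P10\<rangle> + (- 2) * f\<langle>H1\<rangle>)" by simp
      then have "f\<langle>P10\<rangle> + (- 2) * f\<langle>H1\<rangle> dvd 1"
        using w local[rule_format] non by (metis minus_dvd_iff)
      from local[rule_format, OF this] show False
        using v u by (auto simp: f_def dvd_1_mult_iff)
    qed
    then have "(root_exp P10 1 f)\<langle>P10\<rangle> dvd 1"
      using preserves_long_levi(1)[OF A] by (simp only: levi_root_exp f_def) simp
    then show ?thesis
      using that[of "root_mat P10 1"] preserves_long_root[OF A, of P10 1] elementary_root[of P10 1]
      by (simp add: f_def flip: matrix_vector_mul_assoc)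
  qed

  define B where "B = g ** A"
  have B: "preserves_long B" using g by (simp add: B_def)
  define v where "v = (B *v E P10)\<langle>P10\<rangle>"
  have v: "v dvd 1" using g by (simp add: v_def B_def)
  then obtain d where d: "1 = v * d" by (auto simp: dvd_def)
  \<comment> \<open>The root element of -a with parameter t replaces h by h - t p, so t = h / p
    clears \<open>H1\<close>; isotropy then clears \<open>N10\<close>.\<close>
  define C where "C = root_mat N10 ((B *v E P10)\<langle>H1\<rangle> * d) ** B"
  have C: "preserves_long C" unfolding C_def by (rule preserves_long_root[OF B]) simp
  have CP: "C *v E P10 = root_exp N10 ((B *v E P10)\<langle>H1\<rangle> * d) (B *v E P10)"
    by (simp add: C_def flip: matrix_vector_mul_assoc)
  have Cv: "(C *v E P10)\<langle>P10\<rangle> = v"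
    unfolding CP using preserves_long_levi(1)[OF B] by (simp only: levi_root_exp v_def)
  have "(C *v E P10)\<langle>H1\<rangle> = (B *v E P10)\<langle>H1\<rangle> - (B *v E P10)\<langle>H1\<rangle> * d * v"
    unfolding CP using preserves_long_levi(1)[OF B] by (simp only: levi_root_exp v_def)
  also have "\<dots> = (B *v E P10)\<langle>H1\<rangle> - (B *v E P10)\<langle>H1\<rangle> * (v * d)" by (simp only: mult_ac)
  finally have Cu: "(C *v E P10)\<langle>H1\<rangle> = 0" by (simp flip: d)
  have Cw: "(C *v E P10)\<langle>N10\<rangle> = 0"
    using iso(1)[OF C] unit_cancel[OF v] by (simp add: Cu Cv)
  have CP10: "C *v E P10 = v *s E P10"
    using preserves_long_levi(1)[OF C] Cu Cv Cw
    unfolding vec_eq_idx all_index by (simp add: in_levi_def)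

  define w where "w = (C *v E N10)\<langle>N10\<rangle>"
  have vw: "v * w = 1"
    using dual[OF C] by (simp add: CP10 w_def)
  then have w: "w dvd 1" by (metis dvd_triv_right)
  \<comment> \<open>Since \<open>v\<close> is the inverse of \<open>w\<close>, this clears the
    \<open>H1\<close>-coordinate of the second image, and isotropy clears \<open>P10\<close>. The
    element fixes \<open>E P10\<close>, so the first image stays in place.\<close>
  define t where "t = - ((C *v E N10)\<langle>H1\<rangle> * v)"
  define D where "D = root_mat P10 t ** C"
  have D: "preserves_long D" unfolding D_def by (rule preserves_long_root[OF C]) simp
  have DN: "D *v E N10 = root_exp P10 t (C *v E N10)"
    by (simp add: D_def flip: matrix_vector_mul_assoc)
  have Dw: "(D *v E N10)\<langle>N10\<rangle> = w"
    unfolding DN using preserves_long_levi(2)[OF C] by (simp only: levi_root_exp w_def)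
  have "(D *v E N10)\<langle>H1\<rangle> = (C *v E N10)\<langle>H1\<rangle> + t * w"
    unfolding DN using preserves_long_levi(2)[OF C] by (simp only: levi_root_exp w_def)
  also have "\<dots> = (C *v E N10)\<langle>H1\<rangle> - (C *v E N10)\<langle>H1\<rangle> * (v * w)"
    by (simp add: t_def mult.assoc)
  finally have Du: "(D *v E N10)\<langle>H1\<rangle> = 0" by (simp add: vw)
  have Dv: "(D *v E N10)\<langle>P10\<rangle> = 0"
    using iso(2)[OF D] unit_cancel[OF w] by (simp add: Du Dw mult.commute)
  have DN10: "D *v E N10 = w *s E N10"
    using preserves_long_levi(2)[OF D] Du Dv Dw
    unfolding vec_eq_idx all_index by (simp add: in_levi_def)
  have "root_exp P10 t (E P10) = E P10"
    unfolding vec_eq_idx all_index by simp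
  then have DP10: "D *v E P10 = v *s E P10"
    by (simp add: D_def CP10 root_exp_scale matrix_vector_scale flip: matrix_vector_mul_assoc)
  define h where "h = root_mat P10 t ** (root_mat N10 ((B *v E P10)\<langle>H1\<rangle> * d) ** g)"
  have h: "h \<in> elementary"
    unfolding h_def by (intro elementary_mult elementary_root g) simp_all
  have "D = h ** A"
    by (simp only: D_def C_def B_def h_def matrix_mul_assoc)
  then show ?thesis using that[of h v w] h vw D DP10 DN10 by simp
qed


text \<open>\<open>A\<close> fixes the coroots [e_a, e_-a] and [e_theta, e_-theta], hence
  \<open>E H1\<close> and \<open>E H2\<close>. As 2 and -2 differ by units from the other
  eigenvalues of ad \<open>E H2\<close>, the lines of e_b and e_-b are preserved, and a torus
  element with the same values on e_+-a, e_+-b equals \<open>A\<close>.\<close>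

lemma diagonal_elementary:
  fixes A :: "'a g2_mat"
  assumes A: "preserves_long A"
    and v: "v * v' = 1" "A *v E P10 = v *s E P10" "A *v E N10 = v' *s E N10"
  shows "A \<in> elementary"
proof -
  obtain c c' where c: "c * c' = 1" "A *v E P32 = c *s E P32" "A *v E N32 = c' *s E N32"
    using A by (auto simp: preserves_long_def)
  have br: "A *v br x y = br (A *v x) (A *v y)" for x y
    using A by (simp add: preserves_long_def automorphism_def)
  have "v' * v = 1" "c' * c = 1"
    using v c by (simp_all add: mult.commute)
  note v = v this(1) and c = c this(2)
  have brs: "br (E P10) (E N10) = (E H1 :: 'a g2_vec)"
    "br (E P32) (E N32) = (E H1 + 2 *s E H2 :: 'a g2_vec)"
    "br (E H2) (E P01) = (2 *s E P01 :: 'a g2_vec)"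
    "br (E H2) (E N01) = ((- 2) *s E N01 :: 'a g2_vec)"
    unfolding vec_eq_idx all_index by simp_all
  have H1: "A *v E H1 = E H1"
    using br[of "E P10" "E N10"] v by (simp add: br_scale_left br_scale_right brs)
  have "A *v (E H1 + 2 *s E H2) = E H1 + 2 *s E H2"
    using br[of "E P32" "E N32"] c by (simp add: br_scale_left br_scale_right brs del: vector_add_ldistrib)
  then have "2 *s (A *v E H2) = 2 *s E H2"
    by (simp add: H1 matrix_vector_right_distrib matrix_vector_scale)
  then have "2 * (A *v E H2) $ i = 2 * E H2 $ i" for i
    by (metis vector_smult_component)
  then have H2: "A *v E H2 = E H2"
    using unit_cancel_eq[OF units(1)] by (simp add: vec_eq_iff)

  have is_unit_4: "(4::'a) dvd 1" using dvd_1_mult_iff[of 2 "2::'a"] units by simp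
  define d where "d = (A *v E P01)\<langle>P01\<rangle>"
  define d' where "d' = (A *v E N01)\<langle>N01\<rangle>"
  have P01: "A *v E P01 = d *s E P01"
  proof -
    have "br (E H2) (A *v E P01) = 2 *s (A *v E P01)"
      using br[of "E H2" "E P01"] by (simp add: H2 brs matrix_vector_scale)
    then have eq: "bracket_coord i (E H2) (A *v E P01) = 2 * (A *v E P01)\<langle>i\<rangle>" for i
      by (metis br_nth vector_smult_component)
    have "(A *v E P01)\<langle>i\<rangle> = 0" if "i \<noteq> P01" for i
    proof (rule unit_cancel)
      \<comment> \<open>\<open>k\<close> is 2 minus the eigenvalue of ad \<open>E H2\<close> on
        \<open>E i\<close>; for \<open>i\<close> other than \<open>P01\<close> it is 1, 2, 3 or
        4.\<close>
      define k :: 'a where "k = (case i of P10 \<Rightarrow> 3 | P11 \<Rightarrow> 1 | P31 \<Rightarrow> 3 | P32 \<Rightarrow> 1 | N10 \<Rightarrow> 1 | N01 \<Rightarrow> 4 | N11 \<Rightarrow> 3 | N31 \<Rightarrow> 1 | N32 \<Rightarrow> 3 | _ \<Rightarrow> 2)"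
      show "k dvd 1" using units is_unit_4 by (cases i) (simp_all add: k_def)
      have "k * (A *v E P01)\<langle>i\<rangle> = 2 * (A *v E P01)\<langle>i\<rangle> - bracket_coord i (E H2) (A *v E P01)"
        using that by (cases i) (simp_all add: k_def algebra_simps)
      then show "k * (A *v E P01)\<langle>i\<rangle> = 0" by (simp add: eq)
    qed
    then show ?thesis unfolding vec_eq_idx by (simp add: d_def)
  qed
  have N01: "A *v E N01 = d' *s E N01"
  proof -
    have "br (E H2) (A *v E N01) = (- 2) *s (A *v E N01)"
      using br[of "E H2" "E N01"] by (simp only: H2 brs matrix_vector_scale)
    then have eq: "bracket_coord i (E H2) (A *v E N01) = (- 2) * (A *v E N01)\<langle>i\<rangle>" for i
      by (metis br_nth vector_smult_component)
    have "(A *v E N01)\<langle>i\<rangle> = 0" if "i \<noteq> N01" for i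
    proof (rule unit_cancel)
      define k :: 'a where "k = (case i of P10 \<Rightarrow> 1 | P01 \<Rightarrow> 4 | P11 \<Rightarrow> 3 | P31 \<Rightarrow> 1 | P32 \<Rightarrow> 3 | N10 \<Rightarrow> 3 | N11 \<Rightarrow> 1 | N31 \<Rightarrow> 3 | N32 \<Rightarrow> 1 | _ \<Rightarrow> 2)"
      show "k dvd 1" using units is_unit_4 by (cases i) (simp_all add: k_def)
      have "k * (A *v E N01)\<langle>i\<rangle> = bracket_coord i (E H2) (A *v E N01) - (- 2) * (A *v E N01)\<langle>i\<rangle>"
        using that by (cases i) (simp_all add: k_def algebra_simps)
      then show "k * (A *v E N01)\<langle>i\<rangle> = 0" by (simp add: eq)
    qed
    then show ?thesis unfolding vec_eq_idx by (simp add: d'_def)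
  qed
  have d: "d * d' = 1"
  proof (rule unit_cancel_eq[OF is_unit_8])
    have "killing (A *v E P01) (A *v E N01) = 8"
      unfolding preserves_long_killing[OF A] by (simp add: killing_eq)
    then show "8 * (d * d') = 8 * 1" unfolding P01 N01 by (simp add: killing_eq)
  qed

  \<comment> \<open>The torus element multiplies e_a by s^2 / t and e_b by t^2 / s^3. The exponent
    matrix [[2, -1], [-3, 2]] has determinant 1, so prescribing the values v and d is solved without
    roots by s = v^2 d and t = v^3 d^2.\<close>
  define s s' t t' where "s = v^2 * d" and "s' = v'^2 * d'" and "t = v^3 * d^2" and "t' = v'^3 * d'^2"
  have "s * s' = (v * v')^2 * (d * d')" "t * t' = (v * v')^3 * (d * d')^2"
    by (simp_all add: s_def s'_def t_def t'_def power_mult_distrib mult_ac)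
  then have st: "s * s' = 1" "t * t' = 1" by (simp_all add: v d)
  define g where "g = torus_mat P10 N10 s s' ** torus_mat P01 N01 t t'"
  have "g *v E P10 = (t' * s^2) *s E P10" "g *v E N10 = (t * s'^2) *s E N10"
    "g *v E P01 = (t^2 * s'^3) *s E P01" "g *v E N01 = (t'^2 * s^3) *s E N01"
    by (simp_all add: g_def torus_mat_short[OF st(1)] torus_mat_long[OF st(2)] matrix_vector_scale
        flip: matrix_vector_mul_assoc)
  moreover have "t' * s^2 = v * ((v * v')^3 * (d * d')^2)" "t * s'^2 = v' * ((v * v')^3 * (d * d')^2)"
    "t^2 * s'^3 = d * ((v * v')^6 * (d * d')^3)" "t'^2 * s^3 = d' * ((v * v')^6 * (d * d')^3)"
    by (simp_all add: s_def s'_def t_def t'_def eval_nat_numeral mult_ac)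
  ultimately have gE: "g *v E P10 = A *v E P10" "g *v E N10 = A *v E N10"
    "g *v E P01 = A *v E P01" "g *v E N01 = A *v E N01"
    by (simp_all add: v d P01 N01)
  have g: "g \<in> elementary"
    unfolding g_def by (intro elementary_mult torus_mat_elementary) simp_all
  \<comment> \<open>\<open>A\<close> and \<open>g\<close> agree on generators of L. To see that
    \<open>W\<close> is everything it suffices to reach \<open>E P32\<close>, which is 1/6 of [e_b,
    [e_a, [e_a, [e_a, e_b]]]], since 1 * 2 * 3 * 1 = 6.\<close>
  define W where "W = {u. A *v u = g *v u}"
  have gbr: "g *v br x y = br (g *v x) (g *v y)" for x y
    using elementary_automorphism[OF g] by (simp add: automorphism_def)
  have W: "br (E r) u \<in> W" if "u \<in> W" "r \<in> {P10, N10, P01, N01}" for r u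
    using that gE by (auto simp: W_def br gbr)
  have "u \<in> W" for u
  proof (rule submod_UNIV[OF units])
    show sub: "submod W"
      by (auto simp: submod_def W_def matrix_vector_right_distrib matrix_vector_scale)
    have "(6::'a) dvd 1" using units dvd_1_mult_iff[of 2 "3::'a"] by simp
    then obtain b :: 'a where b: "b * 6 = 1" by (metis dvdE mult.commute)
    have "E P01 \<in> W" using gE by (simp add: W_def)
    then have "br (E P01) (br (E P10) (br (E P10) (br (E P10) (E P01)))) \<in> W"
      by (intro W) simp_all
    then have "b *s br (E P01) (br (E P10) (br (E P10) (br (E P10) (E P01)))) \<in> W"
      using sub by (simp add: submod_def)
    moreover have "br (E P10) (E P01) = (E P11 :: 'a g2_vec)" "br (E P10) (E P11) = (2 *s E P21 :: 'a g2_vec)"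
      "br (E P10) (E P21) = (3 *s E P31 :: 'a g2_vec)" "br (E P01) (E P31) = (E P32 :: 'a g2_vec)"
      unfolding vec_eq_idx all_index by simp_all
    ultimately show "E P32 \<in> W" by (simp add: br_scale_right b)
  qed (simp_all add: W)
  then have "A = g" by (simp add: W_def matrix_eq)
  then show ?thesis using g by simp
qed

theorem automorphism_elementary:
  fixes A :: "'a g2_mat"
  assumes A: "automorphism A"
  shows "A \<in> elementary"
proof -
  obtain g c c' where g: "g \<in> elementary" "c * c' = 1"
    "(g ** A) *v E P32 = c *s E P32" "(g ** A) *v E N32 = c' *s E N32"
    using normalize_long[OF A] by metis
  have "automorphism (g ** A)" 
    using elementary_automorphism[OF g(1)] A by (rule automorphism_mult)
  then have "preserves_long (g ** A)"
    unfolding preserves_long_def using g by blast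
  then obtain h v v' where h: "h \<in> elementary" "v * v' = 1" "preserves_long (h ** (g ** A))"
    "(h ** (g ** A)) *v E P10 = v *s E P10" "(h ** (g ** A)) *v E N10 = v' *s E N10"
    using normalize_short by metis
  have hg: "h ** g \<in> elementary" using h(1) g(1) by (rule elementary_mult)
  have hgA: "(h ** g) ** A \<in> elementary"
    using diagonal_elementary[OF h(3,2,4,5)] by (simp add: matrix_mul_assoc)
  obtain m where m: "m \<in> elementary" "m ** (h ** g) = mat 1"
    using elementary_inverse[OF hg] by metis
  have "A = (m ** (h ** g)) ** A"
    by (simp add: m)
  also have "\<dots> = m ** ((h ** g) ** A)"
    by (simp only: matrix_mul_assoc)
  finally show ?thesis using elementary_mult[OF m(1) hgA] by simp
qed

end

section \<open>Chevalley bases\<close>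

lemma mem_g2_roots: "a \<in> g2_roots \<longleftrightarrow> (a$1, a$2) \<in>
    {(1,0), (0,1), (1,1), (2,1), (3,1), (3,2), (-1,0), (0,-1), (-1,-1), (-2,-1), (-3,-1), (-3,-2)}"
  by (auto simp: g2_roots_def g2_pos_roots_def vec_eq_iff forall_2)

lemma ex_index: "(\<exists>i. P i) \<longleftrightarrow> P H1 \<or> P H2 \<or> P P10 \<or> P P01 \<or> P P11 \<or> P P21 \<or> P P31 \<or> P P32 \<or> P N10 \<or> P N01 \<or> P N11 \<or> P N21 \<or> P N31 \<or> P N32"
  using all_index[of "\<lambda>i. \<not> P i"] by blast

lemma g2_root_weight:
  assumes "a \<in> g2_roots"
  obtains r where "r \<notin> {H1, H2}" "a = weight r"
proof -
  have "\<exists>r. r \<notin> {H1, H2} \<and> a = weight r"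
    using assms by (auto simp: mem_g2_roots ex_index vec_eq_iff forall_2)
  then show ?thesis using that by blast
qed

lemma string_length_eqI:
  assumes "\<beta> - int p *s \<alpha> \<in> g2_roots" "\<And>q. \<beta> - int q *s \<alpha> \<in> g2_roots \<Longrightarrow> q \<le> p"
  shows "string_length \<alpha> \<beta> = p"
  unfolding string_length_def by (rule Greatest_equality) (use assms in auto)

lemma string_lengths:
  "string_length (weight P10) (weight P01) = 0" "string_length (weight P10) (weight P11) = 1"
  "string_length (weight P10) (weight P21) = 2" "string_length (weight P01) (weight P31) = 0"
  "string_length (weight N10) (weight N01) = 0" "string_length (weight N10) (weight N11) = 1"
  "string_length (weight N10) (weight N21) = 2" "string_length (weight N01) (weight N31) = 0"
  by (rule string_length_eqI; auto simp: mem_g2_roots)+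

section \<open>Sign normalisation of a Chevalley basis\<close>

context g2_chevalley_basis
begin

lemma bracket_add_right: "bracket u (v + w) = bracket u v + bracket u w"
  and bracket_scale_right: "bracket u (scale c v) = scale c (bracket u v)"
  and bracket_add_left: "bracket (u + v) w = bracket u w + bracket v w"
  and bracket_scale_left: "bracket (scale c u) v = scale c (bracket u v)"
proof -
  interpret right: Vector_Spaces.linear scale scale "\<lambda>v. bracket u v"
    by (rule linear_bracket_right)
  show "bracket u (v + w) = bracket u v + bracket u w" "bracket u (scale c v) = scale c (bracket u v)"
    by (rule right.add right.scale)+
next
  interpret left: Vector_Spaces.linear scale scale "\<lambda>u. bracket u w"
    by (rule linear_bracket_left)
  show "bracket (u + v) w = bracket u w + bracket v w"
    by (rule left.add)
next
  interpret left: Vector_Spaces.linear scale scale "\<lambda>u. bracket u v"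
    by (rule linear_bracket_left)
  show "bracket (scale c u) v = scale c (bracket u v)"
    by (rule left.scale)
qed

lemma bracket_zero_right: "bracket u 0 = 0"
  using bracket_scale_right[of u 0 0] by simp

lemma bracket_anticomm: "bracket v u = - bracket u v"
proof -
  have "bracket (u + v) (u + v) = bracket u u + bracket u v + (bracket v u + bracket v v)"
    by (simp only: bracket_add_left bracket_add_right add_ac)
  then have "bracket u v + bracket v u = 0"
    by (simp add: bracket_self)
  then show ?thesis by (simp add: add_eq_0_iff)
qed

lemma bracket_jacobi: "bracket u (bracket v w) = bracket (bracket u v) w + bracket v (bracket u w)"
proof -
  have "bracket v (bracket w u) = - bracket v (bracket u w)"
    using bracket_anticomm[of w u] bracket_scale_right[of v "-1" "bracket u w"] by simp
  moreover have "bracket w (bracket u v) = - bracket (bracket u v) w"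
    by (rule bracket_anticomm)
  ultimately show ?thesis using jacobi[of u v w] by (simp add: algebra_simps)
qed

lemma basis_idx: "basis (idx i) = (case i of H1 \<Rightarrow> h 1 | H2 \<Rightarrow> h 2 | _ \<Rightarrow> x (weight i))"
  by (cases i) (simp_all add: basis_def idx_def Abs_g2_root_inverse weight_in_roots del: weight.simps)

lemma basis_root: "i \<notin> {H1, H2} \<Longrightarrow> basis (idx i) = x (weight i)"
  by (cases i) (simp_all add: basis_idx)

text \<open>The sign is recovered as an integer, because it will become an entry of a matrix over an
  arbitrary ring.\<close>

lemma bracket_sign:
  assumes "i \<notin> {H1, H2}" "j \<notin> {H1, H2}" "k \<notin> {H1, H2}" "weight i + weight j = weight k"
    "string_length (weight i) (weight j) = p"
  obtains e :: int where "e = 1 \<or> e = -1"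
    "bracket (basis (idx i)) (basis (idx j)) = scale (of_int (e * int (p + 1))) (basis (idx k))"
proof -
  have "\<exists>\<epsilon>\<in>{1, -1}. bracket (x (weight i)) (x (weight j)) =
      scale (\<epsilon> * of_nat (string_length (weight i) (weight j) + 1)) (x (weight i + weight j))"
    by (rule bracket_x_x) (use assms weight_in_roots[of i] weight_in_roots[of j] weight_in_roots[of k] in auto)
  then obtain \<epsilon> :: complex where e: "\<epsilon> \<in> {1, -1}"
    "bracket (x (weight i)) (x (weight j)) = scale (\<epsilon> * of_nat (p + 1)) (x (weight k))"
    unfolding assms(4,5) by blast
  obtain e :: int where "e = 1 \<or> e = -1" "\<epsilon> = of_int e"
    using e(1) by (metis insert_iff empty_iff of_int_1 of_int_minus)
  moreover from this have "\<epsilon> * of_nat (p + 1) = of_int (e * int (p + 1))" by simp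
  then have "bracket (basis (idx i)) (basis (idx j)) = scale (of_int (e * int (p + 1))) (basis (idx k))"
    using e(2) by (simp only: basis_root[OF assms(1)] basis_root[OF assms(2)] basis_root[OF assms(3)])
  ultimately show ?thesis using that[of e] by blast
qed

lemma bracket_zero:
  assumes "i \<notin> {H1, H2}" "j \<notin> {H1, H2}" "weight i + weight j \<notin> g2_roots" "weight i + weight j \<noteq> 0"
  shows "bracket (basis (idx i)) (basis (idx j)) = 0"
  using bracket_x_x_0[of "weight i" "weight j"] assms weight_in_roots[of i] weight_in_roots[of j]
  by (simp add: basis_root)

text \<open>The candidate isomorphism from the table algebra over the complex numbers onto the given
  one: it sends \<open>E i\<close> to the basis vector with the sign \<open>s i\<close>.\<close>

definition lin_comb :: "(g2_index \<Rightarrow> int) \<Rightarrow> complex g2_vec \<Rightarrow> 'l" where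
  "lin_comb s u = (\<Sum>i\<in>UNIV. scale (u\<langle>i\<rangle> * of_int (s i)) (basis (idx i)))"

lemma lin_comb_add: "lin_comb s (u + v) = lin_comb s u + lin_comb s v"
  and lin_comb_scale: "lin_comb s (c *s u) = scale c (lin_comb s u)"
  by (simp_all add: lin_comb_def algebra_simps scale_left_distrib sum.distrib scale_sum_right)

lemma lin_comb_E: "lin_comb s (E i) = scale (of_int (s i)) (basis (idx i))"
proof -
  have "lin_comb s (E i) = (\<Sum>j\<in>UNIV. if j = i then scale (of_int (s j)) (basis (idx j)) else 0)"
    unfolding lin_comb_def by (rule sum.cong) auto
  then show ?thesis by simp
qed

text \<open>
  Changing signs of the root vectors makes the eight brackets of \<open>sign_normalisation\<close> agree with the
  table. All other brackets with the four generators \<open>e\<^bsub>\<plusminus>a\<^esub>\<close>, \<open>e\<^bsub>\<plusminus>b\<^esub>\<close> then follow from the Jacobi identity,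
  and the \<open>u\<close> that are compatible with every \<open>v\<close> form a submodule closed under the bracket.
\<close>

definition hom_pair :: "(g2_index \<Rightarrow> int) \<Rightarrow> complex g2_vec \<Rightarrow> complex g2_vec \<Rightarrow> bool" where
  "hom_pair s u v \<longleftrightarrow> bracket (lin_comb s u) (lin_comb s v) = lin_comb s (br u v)"

lemma lin_comb_zero: "lin_comb s 0 = 0"
  by (simp add: lin_comb_def)

lemma lin_comb_uminus: "lin_comb s (- u) = - lin_comb s u"
  using lin_comb_scale[of s "-1" u] by simp

lemma hom_pair_sym: "hom_pair s u v \<Longrightarrow> hom_pair s v u"
  unfolding hom_pair_def using bracket_anticomm[of "lin_comb s v" "lin_comb s u"]
  by (simp add: br_anticomm[of v u] lin_comb_uminus)

lemma hom_pair_zero: "hom_pair s u 0" "hom_pair s 0 u"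
  using hom_pair_sym[of s u 0] by (simp_all add: hom_pair_def lin_comb_zero bracket_zero_right)

lemma hom_pair_self: "hom_pair s u u"
proof -
  have "br u u = 0" unfolding vec_eq_idx all_index by (simp add: mult.commute)
  then show ?thesis by (simp add: hom_pair_def bracket_self lin_comb_zero)
qed

lemma hom_pair_add: "hom_pair s u v \<Longrightarrow> hom_pair s u w \<Longrightarrow> hom_pair s u (v + w)"
  by (simp add: hom_pair_def br_add_right lin_comb_add bracket_add_right)

lemma hom_pair_scale: "hom_pair s u v \<Longrightarrow> hom_pair s u (c *s v)"
  by (simp add: hom_pair_def br_scale_right lin_comb_scale bracket_scale_right)

lemma hom_pair_jacobi:
  assumes "hom_pair s v w" "hom_pair s u v" "hom_pair s u w"
    "hom_pair s (br u v) w" "hom_pair s v (br u w)"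
  shows "hom_pair s u (br v w)"
proof -
  have "bracket (lin_comb s u) (bracket (lin_comb s v) (lin_comb s w)) =
    lin_comb s (br (br u v) w + br v (br u w))"
    unfolding bracket_jacobi[of "lin_comb s u"] using assms by (simp add: hom_pair_def lin_comb_add)
  then show ?thesis using assms(1) by (simp add: hom_pair_def br_jacobi[of u v w])
qed

text \<open>The Jacobi step with all inner brackets given as evaluated vectors; the table constant
  \<open>c\<close> is divided out over the complex numbers.\<close>

lemma hom_pair_jacobi':
  assumes "hom_pair s v w" "hom_pair s u v" "hom_pair s u w"
    "br u v = p" "hom_pair s p w" "br u w = q" "hom_pair s v q" "br v w = c *s z" "c \<noteq> 0"
  shows "hom_pair s u z"
proof -
  have "hom_pair s u (c *s z)"
    using hom_pair_jacobi[of s v w u] assms by simp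
  then have "hom_pair s u ((1 / c) *s (c *s z))"
    by (rule hom_pair_scale)
  then show ?thesis using assms(9) by simp
qed

lemma hom_pair_br:
  assumes "\<And>w. hom_pair s u w" "\<And>w. hom_pair s v w"
  shows "hom_pair s (br u v) w"
proof -
  have "bracket (bracket (lin_comb s u) (lin_comb s v)) (lin_comb s w)
      = bracket (lin_comb s u) (bracket (lin_comb s v) (lin_comb s w))
        - bracket (lin_comb s v) (bracket (lin_comb s u) (lin_comb s w))"
    using bracket_jacobi[of "lin_comb s u" "lin_comb s v" "lin_comb s w"] by simp
  also have "\<dots> = lin_comb s (br u (br v w)) - lin_comb s (br v (br u w))"
    using assms by (simp add: hom_pair_def)
  also have "\<dots> = lin_comb s (br (br u v) w)"
    using br_jacobi[of u v w] by (simp add: lin_comb_add)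
  finally show ?thesis using assms(1)[of v] by (simp add: hom_pair_def)
qed

lemma hom_pair_E:
  assumes "\<And>i. hom_pair s u (E i)"
  shows "hom_pair s u v"
proof -
  have "hom_pair s u (\<Sum>i\<in>I. v\<langle>i\<rangle> *s E i)" if "finite I" for I
    using that by (induction I rule: finite_induct)
      (simp_all add: hom_pair_zero hom_pair_add hom_pair_scale assms)
  then show ?thesis by (subst vec_expansion[of v]) simp
qed

lemma hom_pair_zero_sum:
  assumes "i \<notin> {H1, H2}" "j \<notin> {H1, H2}" "weight i + weight j \<notin> g2_roots" "weight i + weight j \<noteq> 0"
    "br (E i) (E j) = (0 :: complex g2_vec)"
  shows "hom_pair s (E i) (E j)"
  using bracket_zero[OF assms(1-4)]
  by (simp add: hom_pair_def assms(5) lin_comb_E bracket_scale_left bracket_scale_right lin_comb_zero)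

lemma hom_pair_step:
  assumes "bracket (basis (idx i)) (basis (idx j)) = scale a (basis (idx k))"
    and "br (E i) (E j) = c *s (E k :: complex g2_vec)"
    and "of_int (s i * s j) * a = c * of_int (s k)"
  shows "hom_pair s (E i) (E j)"
proof -
  have "bracket (lin_comb s (E i)) (lin_comb s (E j)) = scale (of_int (s i * s j) * a) (basis (idx k))"
    by (simp add: lin_comb_E bracket_scale_left bracket_scale_right assms(1))
  then show ?thesis
    by (simp only: hom_pair_def assms(2,3) lin_comb_scale lin_comb_E scale_scale)
qed

lemma hom_pair_cartan:
  assumes "s H1 = 1" "s H2 = 1"
  shows "hom_pair s (E H1) (E i)" "hom_pair s (E H2) (E i)"
proof -
  have "bracket (basis (idx H1)) (basis (idx i)) = scale ((br (E H1) (E i))\<langle>i\<rangle>) (basis (idx i))"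
    "bracket (basis (idx H2)) (basis (idx i)) = scale ((br (E H2) (E i))\<langle>i\<rangle>) (basis (idx i))"
    by (cases i; simp add: basis_idx bracket_h_h bracket_h_x weight_in_roots
        mem_g2_roots cartan_int_def g2_inner_def axis_def)+
  moreover have "br (E H1) (E i) = (br (E H1) (E i))\<langle>i\<rangle> *s (E i :: complex g2_vec)"
    "br (E H2) (E i) = (br (E H2) (E i))\<langle>i\<rangle> *s (E i :: complex g2_vec)"
    unfolding vec_eq_idx all_index by (cases i; simp)+
  ultimately show "hom_pair s (E H1) (E i)" "hom_pair s (E H2) (E i)"
    using assms by (auto intro: hom_pair_step)
qed

lemma hom_pair_opposite:
  assumes "s H1 = 1" "s H2 = 1" "s P10 = 1" "s N10 = 1" "s P01 = 1" "s N01 = 1"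
  shows "hom_pair s (E P10) (E N10)" "hom_pair s (E P01) (E N01)"
proof -
  have "bracket (x (weight P10)) (x (- weight P10)) = h 1" "bracket (x (weight P01)) (x (- weight P01)) = h 2"
    by (subst bracket_x_uminus;
        simp add: mem_g2_roots sum_2 coroot_coeff_def g2_inner_def axis_def)+
  moreover have "- weight P10 = weight N10" "- weight P01 = weight N01"
    by (simp_all add: vec_eq_iff forall_2)
  moreover have "br (E P10) (E N10) = (E H1 :: complex g2_vec)" "br (E P01) (E N01) = (E H2 :: complex g2_vec)"
    unfolding vec_eq_idx all_index by simp_all
  ultimately show "hom_pair s (E P10) (E N10)" "hom_pair s (E P01) (E N01)"
    using assms by (simp_all add: hom_pair_def lin_comb_E basis_idx)
qed

lemma sign_normalisation:
  obtains s :: "g2_index \<Rightarrow> int" where "\<And>i. s i = 1 \<or> s i = -1"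
    "\<And>u v. lin_comb s (br u v) = bracket (lin_comb s u) (lin_comb s v)"
proof -
  obtain e1 :: int where e1: "e1 = 1 \<or> e1 = -1"
    "bracket (basis (idx P10)) (basis (idx P01)) = scale (of_int (e1 * int (0 + 1))) (basis (idx P11))"
    by (rule bracket_sign[of P10 P01 P11 0])
      (simp_all add: string_lengths del: weight.simps, simp add: vec_eq_iff forall_2)
  obtain e2 :: int where e2: "e2 = 1 \<or> e2 = -1"
    "bracket (basis (idx P10)) (basis (idx P11)) = scale (of_int (e2 * int (1 + 1))) (basis (idx P21))"
    by (rule bracket_sign[of P10 P11 P21 1])
      (simp_all add: string_lengths del: weight.simps, simp add: vec_eq_iff forall_2)
  obtain e3 :: int where e3: "e3 = 1 \<or> e3 = -1"
    "bracket (basis (idx P10)) (basis (idx P21)) = scale (of_int (e3 * int (2 + 1))) (basis (idx P31))"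
    by (rule bracket_sign[of P10 P21 P31 2])
      (simp_all add: string_lengths del: weight.simps, simp add: vec_eq_iff forall_2)
  obtain e4 :: int where e4: "e4 = 1 \<or> e4 = -1"
    "bracket (basis (idx P01)) (basis (idx P31)) = scale (of_int (e4 * int (0 + 1))) (basis (idx P32))"
    by (rule bracket_sign[of P01 P31 P32 0])
      (simp_all add: string_lengths del: weight.simps, simp add: vec_eq_iff forall_2)
  obtain f1 :: int where f1: "f1 = 1 \<or> f1 = -1"
    "bracket (basis (idx N10)) (basis (idx N01)) = scale (of_int (f1 * int (0 + 1))) (basis (idx N11))"
    by (rule bracket_sign[of N10 N01 N11 0])
      (simp_all add: string_lengths del: weight.simps, simp add: vec_eq_iff forall_2)
  obtain f2 :: int where f2: "f2 = 1 \<or> f2 = -1"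
    "bracket (basis (idx N10)) (basis (idx N11)) = scale (of_int (f2 * int (1 + 1))) (basis (idx N21))"
    by (rule bracket_sign[of N10 N11 N21 1])
      (simp_all add: string_lengths del: weight.simps, simp add: vec_eq_iff forall_2)
  obtain f3 :: int where f3: "f3 = 1 \<or> f3 = -1"
    "bracket (basis (idx N10)) (basis (idx N21)) = scale (of_int (f3 * int (2 + 1))) (basis (idx N31))"
    by (rule bracket_sign[of N10 N21 N31 2])
      (simp_all add: string_lengths del: weight.simps, simp add: vec_eq_iff forall_2)
  obtain f4 :: int where f4: "f4 = 1 \<or> f4 = -1"
    "bracket (basis (idx N01)) (basis (idx N31)) = scale (of_int (f4 * int (0 + 1))) (basis (idx N32))"
    by (rule bracket_sign[of N01 N31 N32 0])
      (simp_all add: string_lengths del: weight.simps, simp add: vec_eq_iff forall_2)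
  \<comment> \<open>Each sign is forced by the preceding one along a+b, 2a+b, 3a+b, 3a+2b. On the
    negative side the table has negated constants, whence the alternating extra minus signs.\<close>
  define s :: "g2_index \<Rightarrow> int" where "s i = (case i of P11 \<Rightarrow> e1 | P21 \<Rightarrow> e1 * e2 | P31 \<Rightarrow> e1 * e2 * e3
    | P32 \<Rightarrow> e1 * e2 * e3 * e4 | N11 \<Rightarrow> - f1 | N21 \<Rightarrow> f1 * f2 | N31 \<Rightarrow> - (f1 * f2 * f3)
    | N32 \<Rightarrow> f1 * f2 * f3 * f4 | _ \<Rightarrow> 1)" for i
  have sign: "\<bar>e\<bar> = 1" if "e = 1 \<or> e = -1" for e :: int
    using that by auto
  note abs = sign[OF e1(1)] sign[OF e2(1)] sign[OF e3(1)] sign[OF e4(1)]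
    sign[OF f1(1)] sign[OF f2(1)] sign[OF f3(1)] sign[OF f4(1)]
  have "\<bar>s i\<bar> = 1" for i
    by (cases i) (simp_all add: s_def abs abs_mult)
  then have s: "s i = 1 \<or> s i = -1" for i
    by (metis abs_eq_iff abs_1)
  have simple: "s H1 = 1" "s H2 = 1" "s P10 = 1" "s N10 = 1" "s P01 = 1" "s N01 = 1"
    by (simp_all add: s_def)
  note cartan = hom_pair_cartan[OF simple(1,2)] 
  note opposite = hom_pair_opposite[OF simple]
  have step:
    "hom_pair s (E P10) (E P01)"
    "hom_pair s (E P10) (E P11)"
    "hom_pair s (E P10) (E P21)"
    "hom_pair s (E P01) (E P31)"
    "hom_pair s (E N10) (E N01)"
    "hom_pair s (E N10) (E N11)"
    "hom_pair s (E N10) (E N21)"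
    "hom_pair s (E N01) (E N31)"
    subgoal by (rule hom_pair_step[OF e1(2), of "1"]) (unfold vec_eq_idx all_index, simp_all add: s_def)
    subgoal by (rule hom_pair_step[OF e2(2), of "2"]) (unfold vec_eq_idx all_index, simp_all add: s_def)
    subgoal by (rule hom_pair_step[OF e3(2), of "3"]) (unfold vec_eq_idx all_index, simp_all add: s_def)
    subgoal by (rule hom_pair_step[OF e4(2), of "1"]) (unfold vec_eq_idx all_index, simp_all add: s_def)
    subgoal by (rule hom_pair_step[OF f1(2), of "-1"]) (unfold vec_eq_idx all_index, simp_all add: s_def)
    subgoal by (rule hom_pair_step[OF f2(2), of "-2"]) (unfold vec_eq_idx all_index, simp_all add: s_def)
    subgoal by (rule hom_pair_step[OF f3(2), of "-3"]) (unfold vec_eq_idx all_index, simp_all add: s_def)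
    subgoal by (rule hom_pair_step[OF f4(2), of "-1"]) (unfold vec_eq_idx all_index, simp_all add: s_def)
    done
  note zero = hom_pair_zero_sum
  have P10_P31: "hom_pair s (E P10) (E P31)"
    by (rule zero, simp, simp, simp add: mem_g2_roots, simp add: vec_eq_iff forall_2, unfold vec_eq_idx all_index, simp)
  have P10_P32: "hom_pair s (E P10) (E P32)"
    by (rule zero, simp, simp, simp add: mem_g2_roots, simp add: vec_eq_iff forall_2, unfold vec_eq_idx all_index, simp)
  have P10_N01: "hom_pair s (E P10) (E N01)"
    by (rule zero, simp, simp, simp add: mem_g2_roots, simp add: vec_eq_iff forall_2, unfold vec_eq_idx all_index, simp)
  \<comment> \<open>The basis axioms leave the sign of such a bracket open; the Jacobi identity
    determines it once \<open>E N11\<close> is written as minus [e_-a, e_-b]. The instantiated terms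
    are the two inner brackets and this constant -1; the same scheme recurs below.\<close>
  have P10_N11: "hom_pair s (E P10) (E N11)"
    by (rule hom_pair_jacobi'[OF step(5) opposite(1) P10_N01, of "(E H1)" "0" "-1"])
      ((rule cartan(1)[of N01] | rule hom_pair_zero(1) | (unfold vec_eq_idx all_index)?, simp)+)
  have P10_N21: "hom_pair s (E P10) (E N21)"
    by (rule hom_pair_jacobi'[OF step(6) opposite(1) P10_N11, of "(E H1)" "(-3) *s (E N01)" "-2"])
      ((rule cartan(1)[of N11] | rule hom_pair_scale[OF step(5)] | (unfold vec_eq_idx all_index)?, simp)+)
  have P10_N31: "hom_pair s (E P10) (E N31)"
    by (rule hom_pair_jacobi'[OF step(7) opposite(1) P10_N21, of "(E H1)" "(-2) *s (E N11)" "-3"])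
      ((rule cartan(1)[of N21] | rule hom_pair_scale[OF step(6)] | (unfold vec_eq_idx all_index)?, simp)+)
  have P10_N32: "hom_pair s (E P10) (E N32)"
    by (rule zero, simp, simp, simp add: mem_g2_roots, simp add: vec_eq_iff forall_2, unfold vec_eq_idx all_index, simp)
  have "hom_pair s (E P10) (E i)" for i
    by (cases i) (simp_all only: hom_pair_sym[OF cartan(1)[of P10]]
      hom_pair_sym[OF cartan(2)[of P10]]
      hom_pair_self
      step(1)
      step(2)
      step(3)
      P10_P31
      P10_P32
      opposite(1)
      P10_N01
      P10_N11
      P10_N21
      P10_N31
      P10_N32)
  note P10 = hom_pair_E[OF this]
  have P01_P11: "hom_pair s (E P01) (E P11)"
    by (rule zero, simp, simp, simp add: mem_g2_roots, simp add: vec_eq_iff forall_2, unfold vec_eq_idx all_index, simp)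
  have P01_P21: "hom_pair s (E P01) (E P21)"
    by (rule zero, simp, simp, simp add: mem_g2_roots, simp add: vec_eq_iff forall_2, unfold vec_eq_idx all_index, simp)
  have P01_P32: "hom_pair s (E P01) (E P32)"
    by (rule zero, simp, simp, simp add: mem_g2_roots, simp add: vec_eq_iff forall_2, unfold vec_eq_idx all_index, simp)
  have P01_N10: "hom_pair s (E P01) (E N10)"
    by (rule zero, simp, simp, simp add: mem_g2_roots, simp add: vec_eq_iff forall_2, unfold vec_eq_idx all_index, simp)
  have P01_N11: "hom_pair s (E P01) (E N11)"
    by (rule hom_pair_jacobi'[OF step(5) P01_N10 opposite(2), of "0" "(E H2)" "-1"])
      ((rule hom_pair_zero(2) | rule hom_pair_sym[OF cartan(2)[of N10]] | (unfold vec_eq_idx all_index)?, simp)+)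
  have P01_N21: "hom_pair s (E P01) (E N21)"
    by (rule zero, simp, simp, simp add: mem_g2_roots, simp add: vec_eq_iff forall_2, unfold vec_eq_idx all_index, simp)
  have P01_N31: "hom_pair s (E P01) (E N31)"
    by (rule zero, simp, simp, simp add: mem_g2_roots, simp add: vec_eq_iff forall_2, unfold vec_eq_idx all_index, simp)
  have P01_N32: "hom_pair s (E P01) (E N32)"
    by (rule hom_pair_jacobi'[OF step(8) opposite(2) P01_N31, of "(E H2)" "0" "-1"])
      ((rule cartan(2)[of N31] | rule hom_pair_zero(1) | (unfold vec_eq_idx all_index)?, simp)+)
  have "hom_pair s (E P01) (E i)" for i
    by (cases i) (simp_all only: hom_pair_sym[OF cartan(1)[of P01]]
      hom_pair_sym[OF cartan(2)[of P01]]
      hom_pair_sym[OF step(1)]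
      hom_pair_self
      P01_P11
      P01_P21
      step(4)
      P01_P32
      P01_N10
      opposite(2)
      P01_N11
      P01_N21
      P01_N31
      P01_N32)
  note P01 = hom_pair_E[OF this]
  have N10_P11: "hom_pair s (E N10) (E P11)"
    by (rule hom_pair_jacobi'[OF step(1) hom_pair_sym[OF opposite(1)] hom_pair_sym[OF P01_N10], of "(-1) *s (E H1)" "0" "1"])
      ((rule hom_pair_sym[OF hom_pair_scale[OF hom_pair_sym[OF cartan(1)[of P01]]]] | rule hom_pair_zero(1) | (unfold vec_eq_idx all_index)?, simp)+)
  have N10_P21: "hom_pair s (E N10) (E P21)"
    by (rule hom_pair_jacobi'[OF step(2) hom_pair_sym[OF opposite(1)] N10_P11, of "(-1) *s (E H1)" "(3) *s (E P01)" "2"])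
      ((rule hom_pair_sym[OF hom_pair_scale[OF hom_pair_sym[OF cartan(1)[of P11]]]] | rule hom_pair_scale[OF step(1)] | (unfold vec_eq_idx all_index)?, simp)+)
  have N10_P31: "hom_pair s (E N10) (E P31)"
    by (rule hom_pair_jacobi'[OF step(3) hom_pair_sym[OF opposite(1)] N10_P21, of "(-1) *s (E H1)" "(2) *s (E P11)" "3"])
      ((rule hom_pair_sym[OF hom_pair_scale[OF hom_pair_sym[OF cartan(1)[of P21]]]] | rule hom_pair_scale[OF step(2)] | (unfold vec_eq_idx all_index)?, simp)+)
  have N10_P32: "hom_pair s (E N10) (E P32)"
    by (rule zero, simp, simp, simp add: mem_g2_roots, simp add: vec_eq_iff forall_2, unfold vec_eq_idx all_index, simp)
  have N10_N31: "hom_pair s (E N10) (E N31)"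
    by (rule zero, simp, simp, simp add: mem_g2_roots, simp add: vec_eq_iff forall_2, unfold vec_eq_idx all_index, simp)
  have N10_N32: "hom_pair s (E N10) (E N32)"
    by (rule zero, simp, simp, simp add: mem_g2_roots, simp add: vec_eq_iff forall_2, unfold vec_eq_idx all_index, simp)
  have "hom_pair s (E N10) (E i)" for i
    by (cases i) (simp_all only: hom_pair_sym[OF cartan(1)[of N10]]
      hom_pair_sym[OF cartan(2)[of N10]]
      hom_pair_sym[OF opposite(1)]
      hom_pair_sym[OF P01_N10]
      N10_P11
      N10_P21
      N10_P31
      N10_P32
      hom_pair_self
      step(5)
      step(6)
      step(7)
      N10_N31
      N10_N32)
  note N10 = hom_pair_E[OF this]
  have N01_P11: "hom_pair s (E N01) (E P11)"
    by (rule hom_pair_jacobi'[OF step(1) hom_pair_sym[OF P10_N01] hom_pair_sym[OF opposite(2)], of "0" "(-1) *s (E H2)" "1"])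
      ((rule hom_pair_zero(2) | rule hom_pair_scale[OF hom_pair_sym[OF cartan(2)[of P10]]] | (unfold vec_eq_idx all_index)?, simp)+)
  have N01_P21: "hom_pair s (E N01) (E P21)"
    by (rule zero, simp, simp, simp add: mem_g2_roots, simp add: vec_eq_iff forall_2, unfold vec_eq_idx all_index, simp)
  have N01_P31: "hom_pair s (E N01) (E P31)"
    by (rule zero, simp, simp, simp add: mem_g2_roots, simp add: vec_eq_iff forall_2, unfold vec_eq_idx all_index, simp)
  have N01_P32: "hom_pair s (E N01) (E P32)"
    by (rule hom_pair_jacobi'[OF step(4) hom_pair_sym[OF opposite(2)] N01_P31, of "(-1) *s (E H2)" "0" "1"])
      ((rule hom_pair_sym[OF hom_pair_scale[OF hom_pair_sym[OF cartan(2)[of P31]]]] | rule hom_pair_zero(1) | (unfold vec_eq_idx all_index)?, simp)+)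
  have N01_N11: "hom_pair s (E N01) (E N11)"
    by (rule zero, simp, simp, simp add: mem_g2_roots, simp add: vec_eq_iff forall_2, unfold vec_eq_idx all_index, simp)
  have N01_N21: "hom_pair s (E N01) (E N21)"
    by (rule zero, simp, simp, simp add: mem_g2_roots, simp add: vec_eq_iff forall_2, unfold vec_eq_idx all_index, simp)
  have N01_N32: "hom_pair s (E N01) (E N32)"
    by (rule zero, simp, simp, simp add: mem_g2_roots, simp add: vec_eq_iff forall_2, unfold vec_eq_idx all_index, simp)
  have "hom_pair s (E N01) (E i)" for i
    by (cases i) (simp_all only: hom_pair_sym[OF cartan(1)[of N01]]
      hom_pair_sym[OF cartan(2)[of N01]]
      hom_pair_sym[OF P10_N01]
      hom_pair_sym[OF opposite(2)]
      N01_P11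
      N01_P21
      N01_P31
      N01_P32
      hom_pair_sym[OF step(5)]
      hom_pair_self
      N01_N11
      N01_N21
      step(8)
      N01_N32)
  note N01 = hom_pair_E[OF this]
  have "hom_pair s u w" for u w
  proof -
    have "u \<in> {u. \<forall>w. hom_pair s u w}"
    proof (rule submod_UNIV)
      show "submod {u. \<forall>w. hom_pair s u w}"
        by (auto simp: submod_def hom_pair_zero
            intro: hom_pair_sym[OF hom_pair_add] hom_pair_sym[OF hom_pair_scale] hom_pair_sym)
      \<comment> \<open>This iterated bracket of simple root vectors is \<open>6 *s E P32\<close>,
        so closure under brackets reaches the highest root vector.\<close>
      have "hom_pair s (br (E P01) (br (E P10) (br (E P10) (br (E P10) (E P01))))) w" for w
        by (intro hom_pair_br P10 P01)
      moreover have "br (E P10) (E P01) = (E P11 :: complex g2_vec)" "br (E P10) (E P11) = (2 *s E P21 :: complex g2_vec)"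
        "br (E P10) (E P21) = (3 *s E P31 :: complex g2_vec)" "br (E P01) (E P31) = (E P32 :: complex g2_vec)"
        unfolding vec_eq_idx all_index by simp_all
      ultimately have "hom_pair s (6 *s E P32) w" for w
        by (simp add: br_scale_right)
      then have "hom_pair s w ((1 / 6) *s (6 *s E P32))" for w
        by (rule hom_pair_scale[OF hom_pair_sym])
      then have "hom_pair s (E P32) w" for w
        by (intro hom_pair_sym[of s w]) simp
      then show "E P32 \<in> {u. \<forall>w. hom_pair s u w}" by blast
      show "br (E N10) u \<in> {u. \<forall>w. hom_pair s u w}" "br (E N01) u \<in> {u. \<forall>w. hom_pair s u w}"
        if "u \<in> {u. \<forall>w. hom_pair s u w}" for u
        using that hom_pair_br[OF N10, of u] hom_pair_br[OF N01, of u] by blast+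
    qed (simp_all add: dvd_field_iff)
    then show ?thesis by simp
  qed
  then show ?thesis using that[of s] s by (simp add: hom_pair_def)
qed

end

section \<open>Root elements of a Chevalley basis in terms of the table\<close>

lemma div_power_E:
  "(div_power r k (E j :: 'a::comm_ring_1 g2_vec))\<langle>i\<rangle> = of_int ((div_power r k (E j))\<langle>i\<rangle>)"
proof -
  have "(\<chi> i. of_int ((E j :: int g2_vec) $ i)) = (E j :: 'a g2_vec)"
    by (simp add: vec_eq_idx)
  moreover have "(div_power r k (\<chi> i. of_int ((E j :: int g2_vec) $ i)) :: 'a g2_vec)\<langle>i\<rangle>
      = of_int ((div_power r k (E j))\<langle>i\<rangle>)"
    unfolding of_int_div_power[symmetric] by simp
  ultimately show ?thesis by simp
qed

definition sign_mat :: "(g2_index \<Rightarrow> int) \<Rightarrow> 'a::comm_ring_1 g2_mat" where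
  "sign_mat s = (\<chi> i j. if i = j then of_int (s (inv_into UNIV idx i)) else 0)"

lemma sign_mat_mult_vec: "(sign_mat s *v u)\<langle>i\<rangle> = of_int (s i) * u\<langle>i\<rangle>"
proof -
  have "(sign_mat s *v u)\<langle>i\<rangle> = (\<Sum>j\<in>UNIV. if idx i = j then of_int (s i) * u $ j else 0)"
    unfolding matrix_vector_mult_def sign_mat_def vec_lambda_beta
    by (rule sum.cong) auto
  then show ?thesis by simp
qed

lemma sign_mat_involution:
  assumes "\<And>i. s i = 1 \<or> s i = -1"
  shows "sign_mat s ** sign_mat s = (mat 1 :: 'a::comm_ring_1 g2_mat)"
proof -
  have "s i * s i = 1" for i using assms[of i] by auto
  then have "of_int (s i) * (of_int (s i) * c) = c" for i and c :: 'a
    by (metis mult.assoc mult_1 of_int_1 of_int_mult)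
  then show ?thesis
    by (simp add: matrix_eq vec_eq_idx sign_mat_mult_vec flip: matrix_vector_mul_assoc)
qed

lemma matrix_nth: "A $ i $ j = (A *v axis j 1) $ i" for A :: "'a::comm_ring_1^'n^'m"
  by (simp add: matrix_vector_mult_def axis_def if_distrib cong: if_cong)

lemma sign_mat_conj_root_mat:
  fixes t :: "'a::comm_ring_1"
  shows "(sign_mat s ** root_mat r t ** sign_mat s) $ idx i $ idx j
    = of_int (s i * s j) * (root_exp r t (E j))\<langle>i\<rangle>"
proof -
  have "sign_mat s *v E j = of_int (s j) *s (E j :: 'a g2_vec)"
    unfolding vec_eq_idx sign_mat_mult_vec by simp
  then show ?thesis
    unfolding matrix_nth
    by (simp add: root_exp_scale sign_mat_mult_vec mult.assoc del: root_exp_nth flip: matrix_vector_mul_assoc)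
qed

context g2_chevalley_basis
begin

lemma independent_range_basis: "independent (range basis)"
  and span_range_basis: "span (range basis) = UNIV"
  and inj_basis_fun: "inj basis"
  using independent_basis span_basis inj_basis by (simp_all add: basis_def)

lemma representation_lin_comb:
  "representation (range basis) (lin_comb s u) (basis (idx i)) = u\<langle>i\<rangle> * of_int (s i)"
proof -
  have "representation (range basis) (lin_comb s u) (basis (idx i))
      = (\<Sum>j\<in>UNIV. u\<langle>j\<rangle> * of_int (s j) * representation (range basis) (basis (idx j)) (basis (idx i)))"
    unfolding lin_comb_def
    by (simp add: representation_sum representation_scale independent_range_basis span_range_basis)
  also have "\<dots> = (\<Sum>j\<in>UNIV. if j = i then u\<langle>j\<rangle> * of_int (s j) else 0)"
    by (rule sum.cong)
      (auto simp: representation_basis independent_range_basis inj_eq[OF inj_basis_fun])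
  finally show ?thesis by simp
qed

text \<open>Changing the signs of the basis conjugates matrices by \<open>sign_mat s\<close>. Since
  the root vector itself is \<open>s r\<close> times the normalised one, the parameter is multiplied
  by \<open>s r\<close> as well.\<close>

lemma root_elt_sign_conj:
  obtains s :: "g2_index \<Rightarrow> int" where "\<And>i. s i = 1 \<or> s i = -1"
    "\<And>r t. r \<notin> {H1, H2} \<Longrightarrow> root_elt (weight r) t
      = sign_mat s ** root_mat r (of_int (s r) * t :: 'a::comm_ring_1) ** sign_mat s"
proof -
  obtain s :: "g2_index \<Rightarrow> int" where s: "\<And>i. s i = 1 \<or> s i = -1"
    and hom: "\<And>u v. lin_comb s (br u v) = bracket (lin_comb s u) (lin_comb s v)"
    by (rule sign_normalisation) (rule that)
  have ss: "s i * s i = 1" for i using s[of i] by auto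
  have ssc: "of_int (s i) * z * of_int (s i) = z" for i and z :: complex using s[of i] by auto
  have basis_lin_comb: "basis (idx i) = lin_comb s (of_int (s i) *s E i)" for i
    by (simp only: lin_comb_scale lin_comb_E scale_scale flip: of_int_mult) (simp add: ss)
  have surj: "\<exists>u. v = lin_comb s u" for v
  proof
    have "v = (\<Sum>b\<in>range basis. scale (representation (range basis) v b) b)"
      by (rule sum_representation_eq[symmetric]) (auto simp: independent_range_basis span_range_basis)
    also have "\<dots> = (\<Sum>k\<in>UNIV. scale (representation (range basis) v (basis k)) (basis k))"
      using inj_basis_fun by (simp add: sum.reindex)
    also have "\<dots> = lin_comb s (of_coords (\<lambda>i. of_int (s i) * representation (range basis) v (basis (idx i))))"
      unfolding lin_comb_def sum_idx
      by (rule sum.cong) (simp_all add: ssc)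
    finally show "v = lin_comb s (of_coords (\<lambda>i. of_int (s i) * representation (range basis) v (basis (idx i))))" .
  qed
  have ad: "ad_power (weight r) k (lin_comb s u) = lin_comb s ((of_int (s r) ^ k * fact k) *s div_power r k u)"
    if r: "r \<notin> {H1, H2}" for r k u
  proof -
    have "bracket (x (weight r)) (lin_comb s v) = lin_comb s (of_int (s r) *s br (E r) v)" for v
      by (simp only: basis_root[OF r, symmetric] basis_lin_comb hom[symmetric] br_scale_left)
    then have "(bracket (x (weight r)) ^^ k) (lin_comb s u) = lin_comb s (of_int (s r) ^ k *s (br (E r) ^^ k) u)"
      by (induction k) (simp_all add: br_scale_right)
    then show ?thesis by (simp add: ad_power_def br_power[OF r])
  qed
  have entry: "ad_entry (weight r) k (idx i) (idx j) = s r ^ k * s j * s i * (div_power r k (E j))\<langle>i\<rangle>"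
    if r: "r \<notin> {H1, H2}" for r k i j
  proof -
    have "scale (1 / fact k) (ad_power (weight r) k (basis (idx j)))
        = lin_comb s ((of_int (s r) ^ k * of_int (s j)) *s div_power r k (E j))"
      by (simp add: basis_lin_comb ad[OF r] div_power_scale flip: lin_comb_scale)
    then have "representation (range basis) (scale (1 / fact k) (ad_power (weight r) k (basis (idx j)))) (basis (idx i))
        = of_int (s r ^ k * s j * s i * (div_power r k (E j))\<langle>i\<rangle>)"
      by (simp add: representation_lin_comb div_power_E[where 'a = complex] mult_ac)
    then show ?thesis
      unfolding ad_entry_def by (simp only: of_int_eq_iff the_eq_trivial)
  qed
  have "root_elt (weight r) t = sign_mat s ** root_mat r (of_int (s r) * t :: 'a) ** sign_mat s"
    if r: "r \<notin> {H1, H2}" for r t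
  proof -
    have "root_elt (weight r) t $ idx i $ idx j
        = (sign_mat s ** root_mat r (of_int (s r) * t :: 'a) ** sign_mat s) $ idx i $ idx j" for i j
    proof -
      have zero: "ad_power (weight r) k = (\<lambda>v. 0)" if "k \<notin> {..<4}" for k
      proof
        fix v
        obtain u where "v = lin_comb s u" using surj by blast
        then show "ad_power (weight r) k v = 0"
          using that by (simp add: ad[OF r] div_power_ge lin_comb_zero)
      qed
      have "root_elt (weight r) t $ idx i $ idx j
          = (\<Sum>k | ad_power (weight r) k \<noteq> (\<lambda>v. 0). t ^ k * of_int (ad_entry (weight r) k (idx i) (idx j)))"
        by (simp add: root_elt_def)
      \<comment> \<open>The series runs over the nonzero powers only: beyond exponent 3 all powers
        vanish, and a vanishing power below that has zero entries, so the range can be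
        fixed.\<close>
      also have "\<dots> = (\<Sum>k<4. t ^ k * of_int (ad_entry (weight r) k (idx i) (idx j)))"
      proof (rule sum.mono_neutral_left)
        show "{k. ad_power (weight r) k \<noteq> (\<lambda>v. 0)} \<subseteq> {..<4}" using zero by blast
        have "ad_entry (weight r) k (idx i) (idx j) = 0" if "ad_power (weight r) k = (\<lambda>v. 0)" for k
          by (simp add: ad_entry_def that representation_zero)
        then show "\<forall>k\<in>{..<4} - {k. ad_power (weight r) k \<noteq> (\<lambda>v. 0)}.
            t ^ k * of_int (ad_entry (weight r) k (idx i) (idx j)) = 0" by simp
      qed simp
      also have "\<dots> = of_int (s i * s j) * (\<Sum>k<4. (of_int (s r) * t) ^ k * (div_power r k (E j))\<langle>i\<rangle>)"
        by (simp add: entry[OF r] div_power_E[where 'a = 'a] sum_distrib_left power_mult_distrib mult_ac)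
      also have "\<dots> = of_int (s i * s j) * (root_exp r (of_int (s r) * t) (E j))\<langle>i\<rangle>"
        by (simp add: root_exp_def del: root_exp_nth)
      finally show ?thesis by (simp only: sign_mat_conj_root_mat)
    qed
    then show ?thesis by (simp add: vec_eq_iff all_idx)
  qed
  then show ?thesis using that s by blast
qed

text \<open>Conjugation by the involution \<open>S\<close> is an endomorphism of \<open>GL\<close>
  and commutes with generating a subgroup. It matches the two sets of generators because multiplying
  the parameter by a sign is a bijection.\<close>

lemma chevalley_group_conj:
  obtains S :: "'a::comm_ring_1 g2_mat" where "S ** S = mat 1"
    "chevalley_group = (\<lambda>g. S ** g ** S) ` elementary"
proof -
  obtain s :: "g2_index \<Rightarrow> int" where s: "\<And>i. s i = 1 \<or> s i = -1"
    and conj: "\<And>r t. r \<notin> {H1, H2} \<Longrightarrow> root_elt (weight r) t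
      = sign_mat s ** root_mat r (of_int (s r) * t :: 'a) ** sign_mat s"
    by (rule root_elt_sign_conj) (rule that)
  define S :: "'a g2_mat" where "S = sign_mat s"
  have S: "S ** S = mat 1" unfolding S_def by (rule sign_mat_involution[OF s])
  have ss: "of_int (s i) * (of_int (s i) * t) = t" for i and t :: 'a using s[of i] by auto
  have gens: "{root_elt \<alpha> t | \<alpha> (t :: 'a). \<alpha> \<in> g2_roots}
      = (\<lambda>g. S ** g ** S) ` {root_mat r t | r t. r \<notin> {H1, H2}}" (is "?L = ?R")
  proof (intro equalityI subsetI)
    fix g assume "g \<in> ?L"
    then obtain \<alpha> t where "\<alpha> \<in> g2_roots" "g = root_elt \<alpha> t" by blast
    then show "g \<in> ?R" using conj unfolding S_def by (metis (mono_tags, lifting) g2_root_weight imageI mem_Collect_eq)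
  next
    fix g assume "g \<in> ?R"
    then obtain r t where r: "r \<notin> {H1, H2}" and g: "g = S ** root_mat r t ** S" by blast
    have "g = root_elt (weight r) (of_int (s r) * t)"
      by (simp add: conj[OF r] ss g S_def)
    then show "g \<in> ?L" using r weight_in_roots[of r] by blast
  qed
  have "S ** A ** S ** (S ** B ** S) = S ** (A ** B) ** S" for A B
  proof -
    have "S ** A ** S ** (S ** B ** S) = S ** A ** (S ** S) ** B ** S"
      by (simp only: matrix_mul_assoc)
    then show ?thesis by (simp only: S matrix_mul_rid matrix_mul_assoc)
  qed
  moreover have "invertible S" using S by (auto simp: invertible_def)
  ultimately have "(\<lambda>g. S ** g ** S) \<in> hom GL GL"
    by (auto simp: hom_def GL_def invertible_mult)
  then have "group_hom GL GL (\<lambda>g. S ** g ** S)"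
    by (intro group_hom.intro group_hom_axioms.intro group_GL)
  moreover have "{root_mat r t | r (t :: 'a). r \<notin> {H1, H2}} \<subseteq> carrier GL"
    using root_mat_automorphism by (auto simp: GL_def automorphism_def)
  ultimately have "(\<lambda>g. S ** g ** S) ` elementary = chevalley_group"
    unfolding chevalley_group_def elementary_def gens by (rule group_hom.generate_img[symmetric])
  then show ?thesis using that[OF S] by simp
qed

end

section \<open>The normalizer in the general linear group\<close>

lemma normalizer_GL_iff:
  fixes N :: "'a::comm_ring_1^'n^'n"
  assumes "G \<subseteq> carrier GL" and N: "N ** N' = mat 1" "N' ** N = mat 1"
  shows "N \<in> normalizer GL G \<longleftrightarrow> (\<lambda>g. N ** g ** N') ` G = G"
proof -
  have "N <#\<^bsub>GL\<^esub> G #>\<^bsub>GL\<^esub> (inv\<^bsub>GL\<^esub> N) = (\<lambda>g. N ** g ** N') ` G"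
    unfolding inv_GL_eq[OF N] l_coset_def r_coset_def by (auto simp: GL_def matrix_mul_assoc)
  moreover have "N \<in> carrier GL" using N by (auto simp: GL_def invertible_def)
  ultimately show ?thesis using assms(1)
    by (simp add: normalizer_def stabilizer_def)
qed

lemma normalizer_elementary:
  fixes N N' :: "'a::comm_ring_1 g2_mat"
  assumes units: "(2::'a) dvd 1" "(3::'a) dvd 1" and loc: "local_ring TYPE('a)"
    and N: "N ** N' = mat 1" "N' ** N = mat 1"
    and norm: "(\<lambda>g. N ** g ** N') ` elementary = elementary"
  obtains c g where "c dvd 1" "g \<in> elementary" "N = map_matrix ((*) c) g"
proof -
  have 1: "N ** g ** N' \<in> elementary" if "g \<in> elementary" for g
    using imageI[OF that, of "\<lambda>g. N ** g ** N'"] unfolding norm .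
  \<comment> \<open>Surjectivity of the conjugation gives the same inclusion for the inverse, which
    is what makes the induced map on L invertible.\<close>
  have 2: "N' ** g ** N \<in> elementary" if "g \<in> elementary" for g
  proof -
    have "g \<in> (\<lambda>g. N ** g ** N') ` elementary" by (simp only: norm that)
    then obtain k where k: "k \<in> elementary" "g = N ** k ** N'" by blast
    have "N' ** g ** N = (N' ** N) ** k ** (N' ** N)"
      unfolding k by (simp only: matrix_mul_assoc)
    then show ?thesis using k by (simp add: N)
  qed
  obtain c A where c: "c dvd 1" "automorphism A" "\<And>v. N *v v = c *s (A *v v)"
    using normalizing_scaled_automorphism[OF units N 1 2] by blast
  have "N $ i $ j = c * A $ i $ j" for i j
    using c(3)[of "axis j 1"] matrix_nth[of N i j] matrix_nth[of A i j] by simp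
  then have "N = map_matrix ((*) c) A"
    by (simp add: vec_eq_iff map_matrix_def)
  then show ?thesis
    using that c automorphism_elementary[OF units local_ring_units[OF loc] c(2)] by blast
qed

theorem theorem2:
  fixes scale :: "complex \<Rightarrow> 'l::ab_group_add \<Rightarrow> 'l" and bracket :: "'l \<Rightarrow> 'l \<Rightarrow> 'l"
    and h :: "2 \<Rightarrow> 'l" and x :: "int^2 \<Rightarrow> 'l"
    and G :: "('a::comm_ring_1^(2 + g2_root)^(2 + g2_root)) set"
  assumes "g2_chevalley_basis scale bracket h x"
    and "local_ring TYPE('a)"
    and "(2 :: 'a) dvd 1" and "(3 :: 'a) dvd 1"
    and "G = g2_chevalley_basis.chevalley_group scale bracket h x"
  shows "normalizer GL G = {map_matrix ((*) c) g | c g. c dvd 1 \<and> g \<in> G}"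
proof -
  obtain S :: "'a g2_mat" where S: "S ** S = mat 1" and G: "G = (\<lambda>g. S ** g ** S) ` elementary"
    using g2_chevalley_basis.chevalley_group_conj[OF assms(1)] assms(5) by metis
  have SS: "S ** (S ** A) = A" for A
    using S by (simp add: matrix_mul_assoc)
  have "invertible S" using S by (auto simp: invertible_def)
  then have "invertible (S ** g ** S)" if "g \<in> elementary" for g
    using elementary_automorphism[OF that] by (intro invertible_mult) (simp_all add: automorphism_def)
  then have carrier: "G \<subseteq> carrier GL"
    unfolding G by (auto simp: GL_def)
  have scaled: "map_matrix ((*) c) A ** B = map_matrix ((*) c) (A ** B)"
    "A ** map_matrix ((*) c) B = map_matrix ((*) c) (A ** B)" for c and A B :: "'a g2_mat"
    by (simp_all add: vec_eq_iff map_matrix_def matrix_matrix_mult_def sum_distrib_left mult_ac)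
  show ?thesis
  proof (intro equalityI subsetI)
    fix N assume N: "N \<in> normalizer GL G"
    then have "invertible N" by (simp add: normalizer_def stabilizer_def GL_def)
    then obtain N' where N': "N ** N' = mat 1" "N' ** N = mat 1" by (auto simp: invertible_def)
    have conj: "(\<lambda>g. N ** g ** N') ` G = G"
      using N normalizer_GL_iff[OF carrier N'] by simp
    \<comment> \<open>As \<open>S\<close> is its own inverse, \<open>M\<close> normalizes the table
      group exactly when \<open>N\<close> normalizes \<open>G\<close>, and conjugating back does not
      change the scalar.\<close>
    define M M' where "M = S ** N ** S" and "M' = S ** N' ** S"
    have M: "M ** M' = mat 1" "M' ** M = mat 1"
      unfolding M_def M'_def by (simp_all add: SS S N' flip: matrix_mul_assoc)
        (simp_all add: matrix_mul_assoc N' S)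
    have "(\<lambda>g. M ** g ** M') ` elementary = (\<lambda>g. S ** g ** S) ` (\<lambda>g. N ** g ** N') ` G"
      unfolding G image_image M_def M'_def by (simp only: matrix_mul_assoc)
    also have "\<dots> = elementary"
      unfolding conj unfolding G image_image by (simp add: SS S flip: matrix_mul_assoc)
    finally obtain c g where cg: "c dvd 1" "g \<in> elementary" "M = map_matrix ((*) c) g"
      using normalizer_elementary[OF assms(3,4,2) M] by metis
    have "N = S ** M ** S"
      unfolding M_def by (simp add: SS S flip: matrix_mul_assoc)
    then have "N = map_matrix ((*) c) (S ** g ** S)" by (simp add: cg(3) scaled)
    then show "N \<in> {map_matrix ((*) c) g | c g. c dvd 1 \<and> g \<in> G}"
      using cg unfolding G by blast
  next
    fix N assume "N \<in> {map_matrix ((*) c) g | c g. c dvd 1 \<and> g \<in> G}"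
    then obtain c k where c: "c dvd 1" and k: "k \<in> elementary" and Nk: "N = map_matrix ((*) c) (S ** k ** S)"
      unfolding G by blast
    obtain d where d: "1 = c * d" using c by (auto simp: dvd_def)
    obtain k' where k': "k' \<in> elementary" "k ** k' = mat 1" "k' ** k = mat 1"
      using elementary_inverse[OF k] by blast
    define N' where "N' = map_matrix ((*) d) (S ** k' ** S)"
    have cd: "map_matrix ((*) c) (map_matrix ((*) d) A) = A" "map_matrix ((*) d) (map_matrix ((*) c) A) = A"
      for A :: "'a g2_mat"
      using d by (simp_all add: vec_eq_iff map_matrix_def mult.commute flip: mult.assoc)
    have kk: "k ** (k' ** A) = A" "k' ** (k ** A) = A" for A
      by (simp_all add: matrix_mul_assoc k')
    have N': "N ** N' = mat 1" "N' ** N = mat 1"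
      unfolding Nk N'_def by (simp_all add: scaled cd SS kk S flip: matrix_mul_assoc)
    have "(\<lambda>g. N ** g ** N') ` G = (\<lambda>g. S ** (k ** g ** k') ** S) ` elementary"
      unfolding G image_image Nk N'_def
      by (simp add: scaled cd SS flip: matrix_mul_assoc)
    also have "\<dots> = (\<lambda>g. S ** g ** S) ` (\<lambda>g. k ** g ** k') ` elementary"
      by (simp only: image_image)
    also have "(\<lambda>g. k ** g ** k') ` elementary = elementary"
    proof (intro equalityI subsetI)
      fix g :: "'a g2_mat" assume g: "g \<in> elementary"
      have "g = k ** (k' ** g ** k) ** k'"
        by (simp add: kk k' flip: matrix_mul_assoc)
      moreover have "k' ** g ** k \<in> elementary" by (intro elementary_mult k' g k)
      ultimately show "g \<in> (\<lambda>g. k ** g ** k') ` elementary" by blast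
    qed (auto intro: elementary_mult k k')
    finally have "(\<lambda>g. N ** g ** N') ` G = G" by (simp only: G)
    then show "N \<in> normalizer GL G"
      by (simp only: normalizer_GL_iff[OF carrier N'])
  qed
qed

end
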